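(* Let $L$ be the algebraic closure of $\mathbb{Z}/(2)$, let $L(t)$ be the field of rational functions in one variable $t$ over $L$, and let $R_t = L(t)[x,y,z]/(z^4+xyz^2+x^3z+y^3z+t x^2y^2)$. Then $f=y^3z^3$ belongs to the tight closure of the ideal $(x^4,y^4,z^4)$ in $R_t$, but does not belong to its plus closure. In particular, tight closure and plus closure do not coincide in general, even in dimension two.
   Context: For a commutative noetherian domain $R$ containing a field of characteristic $p>0$ and an ideal $I\subseteq R$, the tight closure of $I$ is $I^*=\{f\in R : \text{there exists } c\neq 0 \text{ in } R \text{ with } c f^{q}\in I^{[q]} \text{ for all } q=p^e,\ e\ge 0\}$, where $I^{[q]}$ is the ideal generated by all $q$-th powers of elements of $I$. The plus closure $I^+$ of $I$ is the set of $f\in R$ for which there is a finite extension of domains $R\subseteq T$ with $f\in IT$. *)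

theory Defs
  imports
    "HOL-Algebra.Algebra"
    "HOL-Algebra.Algebraic_Closure_Type"
    "HOL-Computational_Algebra.Computational_Algebra"
    "HOL-Library.Z2"
    "HOL-Library.Extended_Nat"
begin

section \<open>Tight closure and plus closure\<close>

definition contains_field_of_char :: "nat \<Rightarrow> ('a, 'm) ring_scheme \<Rightarrow> bool" where
  "contains_field_of_char p R \<longleftrightarrow>
     (\<exists>K. subfield K R \<and> (\<forall>n::nat. [n] \<cdot>\<^bsub>R\<^esub> \<one>\<^bsub>R\<^esub> = \<zero>\<^bsub>R\<^esub> \<longleftrightarrow> p dvd n))"

definition noetherian_domain_of_char :: "nat \<Rightarrow> ('a, 'm) ring_scheme \<Rightarrow> bool" where
  "noetherian_domain_of_char p R \<longleftrightarrow>
     0 < p \<and> noetherian_domain R \<and> contains_field_of_char p R"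

definition frobenius_power :: "('a, 'm) ring_scheme \<Rightarrow> 'a set \<Rightarrow> nat \<Rightarrow> 'a set" where
  "frobenius_power R I q = Idl\<^bsub>R\<^esub> ((\<lambda>a. a [^]\<^bsub>R\<^esub> q) ` I)"

definition tight_closure :: "nat \<Rightarrow> ('a, 'm) ring_scheme \<Rightarrow> 'a set \<Rightarrow> 'a set" where
  "tight_closure p R I =
     {f \<in> carrier R. \<exists>c \<in> carrier R. c \<noteq> \<zero>\<^bsub>R\<^esub> \<and>
        (\<forall>e::nat. c \<otimes>\<^bsub>R\<^esub> f [^]\<^bsub>R\<^esub> (p ^ e) \<in> frobenius_power R I (p ^ e))}"

definition finite_domain_extension ::
  "('a, 'm) ring_scheme \<Rightarrow> ('b, 'n) ring_scheme \<Rightarrow> ('a \<Rightarrow> 'b) \<Rightarrow> bool" where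
  "finite_domain_extension R T \<phi> \<longleftrightarrow>
     domain R \<and> domain T \<and> \<phi> \<in> ring_hom R T \<and> inj_on \<phi> (carrier R) \<and>
     (\<exists>B. finite B \<and> B \<subseteq> carrier T \<and>
        (\<forall>s \<in> carrier T. \<exists>c \<in> B \<rightarrow> carrier R. s = (\<Oplus>\<^bsub>T\<^esub>b\<in>B. \<phi> (c b) \<otimes>\<^bsub>T\<^esub> b)))"

text \<open>
  HOL cannot quantify over types inside a formula, so the extension \<open>T\<close> must range over rings on
  one fixed type.  A module generated by \<open>n\<close> elements is a quotient of \<open>R\<^sup>n\<close>, hence every finite
  extension of a ring on \<open>'a\<close> has an isomorphic copy on \<open>'a list set\<close>; the lemma
  \<open>plus_closureI\<close> below confirms that no extension, on whatever type, is lost.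
\<close>

definition plus_closure :: "('a, 'm) ring_scheme \<Rightarrow> 'a set \<Rightarrow> 'a set" where
  "plus_closure R I =
     {f \<in> carrier R. \<exists>(T :: 'a list set ring) \<phi>.
        finite_domain_extension R T \<phi> \<and> \<phi> f \<in> Idl\<^bsub>T\<^esub> (\<phi> ` I)}"

lemma plus_closureI:
  fixes R :: "('a, 'm) ring_scheme" and T :: "('b, 'n) ring_scheme"
  assumes ext: "finite_domain_extension R T \<phi>"
    and f: "f \<in> carrier R" and I: "I \<subseteq> carrier R" and mem: "\<phi> f \<in> Idl\<^bsub>T\<^esub> (\<phi> ` I)"
  shows "f \<in> plus_closure R I"
proof -
  from ext have R: "domain R" and T: "domain T" and hom: "\<phi> \<in> ring_hom R T"
    and inj: "inj_on \<phi> (carrier R)" by (auto simp: finite_domain_extension_def)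
  from ext obtain B where B: "finite B" "B \<subseteq> carrier T"
    and gen: "\<And>s. s \<in> carrier T \<Longrightarrow>
      \<exists>c \<in> B \<rightarrow> carrier R. s = (\<Oplus>\<^bsub>T\<^esub>b\<in>B. \<phi> (c b) \<otimes>\<^bsub>T\<^esub> b)"
    unfolding finite_domain_extension_def by blast
  interpret T: domain T by fact
  have \<phi>_closed: "\<phi> a \<in> carrier T" if "a \<in> carrier R" for a
    using ring_hom_closed[OF hom that] .
  obtain bs where bs: "set bs = B" using finite_list[OF B(1)] by blast
  define g where "g s = {map c bs | c. c \<in> B \<rightarrow> carrier R \<and>
      s = (\<Oplus>\<^bsub>T\<^esub>b\<in>B. \<phi> (c b) \<otimes>\<^bsub>T\<^esub> b)}" for s
  have g_inj: "inj_on g (carrier T)"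
  proof (rule inj_onI)
    fix s s' assume s: "s \<in> carrier T" and eq: "g s = g s'"
    obtain c where c: "c \<in> B \<rightarrow> carrier R" "s = (\<Oplus>\<^bsub>T\<^esub>b\<in>B. \<phi> (c b) \<otimes>\<^bsub>T\<^esub> b)"
      using gen[OF s] by blast
    have "map c bs \<in> g s" unfolding g_def using c by blast
    hence "map c bs \<in> g s'" by (simp only: eq)
    then obtain c' where c': "map c bs = map c' bs" "c' \<in> B \<rightarrow> carrier R"
      "s' = (\<Oplus>\<^bsub>T\<^esub>b\<in>B. \<phi> (c' b) \<otimes>\<^bsub>T\<^esub> b)" unfolding g_def by blast
    have "\<And>b. b \<in> B \<Longrightarrow> c b = c' b" using c'(1) bs by auto
    moreover have "\<phi> (c' b) \<in> carrier T" "b \<in> carrier T" if "b \<in> B" for b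
      using that c'(2) B(2) \<phi>_closed by auto
    ultimately have "(\<Oplus>\<^bsub>T\<^esub>b\<in>B. \<phi> (c b) \<otimes>\<^bsub>T\<^esub> b) = (\<Oplus>\<^bsub>T\<^esub>b\<in>B. \<phi> (c' b) \<otimes>\<^bsub>T\<^esub> b)"
      by (intro T.finsum_cong') auto
    thus "s = s'" by (simp only: c(2)[symmetric] c'(3)[symmetric])
  qed
  define T' where "T' = image_ring g T"
  have T': "domain T'" unfolding T'_def by (rule T.inj_imp_image_ring_is_domain[OF g_inj])
  have iso: "g \<in> ring_iso T T'" unfolding T'_def by (rule inj_imp_image_ring_iso[OF g_inj])
  hence g_hom: "g \<in> ring_hom T T'" and g_onto: "g ` carrier T = carrier T'"
    by (auto simp: ring_iso_def bij_betw_def)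
  interpret T': domain T' by fact
  interpret g: ring_hom_cring T T' g
    using g_hom by unfold_locales
  have "\<exists>c \<in> g ` B \<rightarrow> carrier R. s' = (\<Oplus>\<^bsub>T'\<^esub>b'\<in>g ` B. (g \<circ> \<phi>) (c b') \<otimes>\<^bsub>T'\<^esub> b')"
    if s': "s' \<in> carrier T'" for s'
  proof -
    obtain s where s: "s \<in> carrier T" "s' = g s" using s' g_onto by blast
    obtain c where c: "c \<in> B \<rightarrow> carrier R" "s = (\<Oplus>\<^bsub>T\<^esub>b\<in>B. \<phi> (c b) \<otimes>\<^bsub>T\<^esub> b)"
      using gen[OF s(1)] by blast
    have injB: "inj_on g B" using inj_on_subset[OF g_inj B(2)] .
    define c' where "c' = c \<circ> inv_into B g"
    have c'g: "c' (g b) = c b" if "b \<in> B" for b using injB that by (simp add: c'_def)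
    have "c' \<in> g ` B \<rightarrow> carrier R" using c(1) c'g by auto
    moreover have "s' = (\<Oplus>\<^bsub>T'\<^esub>b'\<in>g ` B. (g \<circ> \<phi>) (c' b') \<otimes>\<^bsub>T'\<^esub> b')"
    proof -
      have cl: "c b \<in> carrier R" "b \<in> carrier T" "\<phi> (c b) \<in> carrier T" if "b \<in> B" for b
        using that c(1) B(2) \<phi>_closed by auto
      have "s' = g (\<Oplus>\<^bsub>T\<^esub>b\<in>B. \<phi> (c b) \<otimes>\<^bsub>T\<^esub> b)" by (simp only: s(2) c(2)[symmetric])
      also have "\<dots> = (\<Oplus>\<^bsub>T'\<^esub>b\<in>B. (g \<circ> (\<lambda>b. \<phi> (c b) \<otimes>\<^bsub>T\<^esub> b)) b)"
        by (rule g.hom_finsum) (use cl in auto)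
      also have "\<dots> = (\<Oplus>\<^bsub>T'\<^esub>b\<in>B. (g \<circ> \<phi>) (c' (g b)) \<otimes>\<^bsub>T'\<^esub> g b)"
        by (rule T'.finsum_cong') (use cl c'g in auto)
      also have "\<dots> = (\<Oplus>\<^bsub>T'\<^esub>b'\<in>g ` B. (g \<circ> \<phi>) (c' b') \<otimes>\<^bsub>T'\<^esub> b')"
        by (rule T'.finsum_reindex[symmetric]) (use cl c'g injB in auto)
      finally show ?thesis .
    qed
    ultimately show ?thesis by (intro bexI[of _ c'])
  qed
  hence "\<forall>s' \<in> carrier T'. \<exists>c \<in> g ` B \<rightarrow> carrier R.
      s' = (\<Oplus>\<^bsub>T'\<^esub>b'\<in>g ` B. (g \<circ> \<phi>) (c b') \<otimes>\<^bsub>T'\<^esub> b')" by (rule ballI)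
  moreover have "g \<circ> \<phi> \<in> ring_hom R T'" using ring_hom_trans[OF hom g_hom] .
  moreover have "inj_on (g \<circ> \<phi>) (carrier R)"
    by (rule comp_inj_on[OF inj inj_on_subset[OF g_inj]]) (use \<phi>_closed in auto)
  moreover have "finite (g ` B)" "g ` B \<subseteq> carrier T'" using B g_onto by auto
  ultimately have "finite_domain_extension R T' (g \<circ> \<phi>)"
    unfolding finite_domain_extension_def using R T'
    by (intro conjI exI[of _ "g ` B"]) assumption+
  moreover have "(g \<circ> \<phi>) f \<in> Idl\<^bsub>T'\<^esub> ((g \<circ> \<phi>) ` I)"
  proof -
    have "(g \<circ> \<phi>) f \<in> J" if J: "ideal J T'" "(g \<circ> \<phi>) ` I \<subseteq> J" for J
    proof -
      interpret J: ideal J T' by fact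
      have "ideal {s \<in> carrier T. g s \<in> J} T"
        by (rule ring_hom_ring.ideal_vimage[OF ring_hom_ringI2 J(1)])
          (rule T.ring_axioms T'.ring_axioms g_hom)+
      moreover have "\<phi> ` I \<subseteq> {s \<in> carrier T. g s \<in> J}" using J(2) I \<phi>_closed by auto
      ultimately have "Idl\<^bsub>T\<^esub> (\<phi> ` I) \<subseteq> {s \<in> carrier T. g s \<in> J}"
        by (rule T.genideal_minimal)
      thus ?thesis using mem by auto
    qed
    thus ?thesis unfolding genideal_def by (intro InterI) (elim CollectE conjE)
  qed
  ultimately show ?thesis
    unfolding plus_closure_def using f by (intro CollectI conjI exI) assumption+
qed

definition krull_dim :: "('a, 'm) ring_scheme \<Rightarrow> enat" where
  "krull_dim R = Sup {enat n | n. \<exists>P :: nat \<Rightarrow> 'a set.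
     (\<forall>i\<le>n. primeideal (P i) R) \<and> (\<forall>i<n. P i \<subset> P (Suc i))}"

section \<open>The ring \<open>R\<^sub>t\<close>\<close>

type_synonym L = "bit alg_closure"

type_synonym Lt = "L poly fract"

text \<open>\<open>L(t)[x,y,z]\<close> as the iterated polynomial ring \<open>L(t)[x][y][z]\<close>\<close>

type_synonym Lt_xyz = "Lt poly poly poly"

definition t_gen :: Lt_xyz where "t_gen = [:[:[:Fract [:0, 1:] 1:]:]:]"

definition x_gen :: Lt_xyz where "x_gen = [:[:[:0, 1:]:]:]"

definition y_gen :: Lt_xyz where "y_gen = [:[:0, 1:]:]"

definition z_gen :: Lt_xyz where "z_gen = [:0, 1:]"

definition F_t :: Lt_xyz where
  "F_t = z_gen ^ 4 + x_gen * y_gen * z_gen ^ 2 + x_gen ^ 3 * z_gen + y_gen ^ 3 * z_gen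
         + t_gen * x_gen ^ 2 * y_gen ^ 2"

abbreviation Lt_xyz_ring :: "Lt_xyz ring" where
  "Lt_xyz_ring \<equiv> ring_of_type_algebra"

definition R_t :: "Lt_xyz set ring" where
  "R_t = Lt_xyz_ring Quot (Idl\<^bsub>Lt_xyz_ring\<^esub> {F_t})"

definition residue_class :: "Lt_xyz \<Rightarrow> Lt_xyz set" where
  "residue_class g = (Idl\<^bsub>Lt_xyz_ring\<^esub> {F_t}) +>\<^bsub>Lt_xyz_ring\<^esub> g"

definition I_t :: "Lt_xyz set set" where
  "I_t = Idl\<^bsub>R_t\<^esub> {residue_class (x_gen ^ 4), residue_class (y_gen ^ 4), residue_class (z_gen ^ 4)}"

definition f_t :: "Lt_xyz set" where
  "f_t = residue_class (y_gen ^ 3 * z_gen ^ 3)"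

end

theory Submission
  imports Defs
begin

text \<open>
  Write \<open>\<lambda>\<^sub>n = t + t\<^sup>2 + t\<^sup>4 + \<dots>\<close> (\<open>n\<close> terms) and \<open>E\<^sub>k = Syz(x\<^sup>2, y\<^sup>2, z\<^sup>2 + k x y)\<close> on the
  plane quartic with parameter \<open>t\<close>.  The Frobenius pullbacks of the syzygy bundle are described by the \<open>E\<^sub>k\<close>
  with \<open>k\<close> running through the \<open>\<lambda>\<^sub>n\<close>.  For transcendental \<open>t\<close> no \<open>\<lambda>\<^sub>n\<close> vanishes, there are no syzygies of
  low degree, and a dimension count together with the Gorenstein duality of \<open>K[x,y,z]/(x\<^sup>N, y\<^sup>N, z\<^sup>N)\<close> puts
  \<open>y f\<^sup>q\<close> into the Frobenius powers of the ideal.  For algebraic \<open>t\<close> some \<open>\<lambda>\<^sub>m\<close> is \<open>0\<close>, the pullback is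
  destabilised, and \<open>f\<close> is not even in the tight closure.

  A finite extension of \<open>R\<^sub>t\<close> with \<open>f\<close> in the extended ideal has a linear functional to \<open>R\<^sub>t\<close> that is nonzero
  at \<open>1\<close>; applied to the \<open>q\<close>-th powers of the membership equation it gives a multiplier with denominators
  independent of \<open>q\<close>.  Hence \<open>t\<close> can be specialised to an algebraic value, a contradiction.
\<close>

text \<open>The multiplier in the tight closure part is \<open>y\<close> because it raises the
  degree of \<open>f^q\<close> from \<open>6q\<close> to \<open>6q + 1\<close>: the dual element
  then has degree at most \<open>6q - 4\<close>, its product with the quartic at most
  \<open>6q\<close>, and with \<open>N = 4q\<close> the syzygy coefficients at most
  \<open>2q\<close>, exactly the range that is excluded. For the plus closure, a class in
  \<open>H^1\<close> is followed through wedge maps \<open>F^* E_l -> E_k\<close>,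
  \<open>k = t + l^2\<close>. It keeps the form \<open>eta A B\<close> times the section
  \<open>(c1, c2, J)\<close>, with \<open>eta A B\<close> a combination of \<open>1/(xy)\<close> and
  \<open>z^3/(x^4 y)\<close>, and each step replaces \<open>B\<close> by \<open>k B^2\<close>. So
  \<open>B\<close> survives until \<open>lam\<close> vanishes, where a destabilising section leaves
  the class of \<open>(z^3 + xyz)/(x^2 y^2)\<close>. For a variable \<open>t\<close>, no nonzero
  multiplier free of \<open>z\<close> kills all its Frobenius powers; the coefficient that shows
  this is fixed over \<open>L[t]\<close> before \<open>t\<close> is specialised, since the choice of
  \<open>\<alpha>\<close> depends on it. The power of the denominator \<open>D\<close> may grow with
  \<open>q\<close>, but only \<open>D(\<alpha>) \<noteq> 0\<close> matters.\<close>

locale ring_map =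
  fixes f :: "'a::comm_ring_1 \<Rightarrow> 'b::comm_ring_1"
  assumes add: "f (a + b) = f a + f b" and mult: "f (a * b) = f a * f b" and one: "f 1 = 1"
begin

lemma zero: "f 0 = 0"
  using add[of 0 0] by simp

lemma uminus: "f (- a) = - f a"
  using add[of a "- a"] by (simp add: zero eq_neg_iff_add_eq_0 add.commute)

lemma diff: "f (a - b) = f a - f b"
  using add[of a "- b"] by (simp add: uminus)

lemma power: "f (a ^ n) = f a ^ n"
  by (induction n) (simp_all add: one mult)

lemma sum: "f (\<Sum>i\<in>I. g i) = (\<Sum>i\<in>I. f (g i))"
  by (induction I rule: infinite_finite_induct) (simp_all add: zero add)

lemmas simps = zero one add mult diff uminus power sum

lemma map_poly_pCons: "map_poly f (pCons a p) = pCons (f a) (map_poly f p)"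
  by (rule Polynomial.map_poly_pCons) (rule zero)

lemma ring_map_map_poly: "ring_map (map_poly f)"
proof
  show "map_poly f (p + q) = map_poly f p + map_poly f q" for p q
    by (intro poly_eqI) (simp add: coeff_map_poly zero add)
  show "map_poly f (p * q) = map_poly f p * map_poly f q" for p q
    by (intro poly_eqI) (simp add: coeff_map_poly zero coeff_mult sum mult)
  show "map_poly f 1 = 1"
    by (simp add: one_pCons map_poly_pCons one zero)
qed

end

lemma ring_map_poly: "ring_map (\<lambda>p. poly p a)"
  by standard simp_all

lemma ring_map_comp: "ring_map f \<Longrightarrow> ring_map g \<Longrightarrow> ring_map (\<lambda>a. g (f a))"
  by (simp add: ring_map_def)

lemma ring_map_to_ac: "ring_map to_ac"
  by standard simp_all

lemma ring_map_to_fract: "ring_map to_fract"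
  by standard simp_all

lemma inj_map_poly: "f 0 = 0 \<Longrightarrow> inj f \<Longrightarrow> inj (map_poly f)"
  by (rule injI) (metis coeff_map_poly injD poly_eqI)

text \<open>Pseudo-division scales the dividend by a power of the leading coefficient, here 1, so it
  is true division over any commutative ring.\<close>

lemma monic_division:
  fixes f p :: "'a::comm_ring_1 poly"
  assumes "lead_coeff f = 1"
  obtains q r where "p = f * q + r" "r = 0 \<or> degree r < degree f"
proof -
  have "f \<noteq> 0" using assms by auto
  obtain q r where qr: "pseudo_divmod p f = (q, r)" by (cases "pseudo_divmod p f")
  show thesis
    using that[of q r] pseudo_divmod[OF \<open>f \<noteq> 0\<close> qr] assms by simp
qed

definition map3 :: "('a::zero \<Rightarrow> 'b::zero) \<Rightarrow> 'a poly poly poly \<Rightarrow> 'b poly poly poly" where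
  "map3 f = map_poly (map_poly (map_poly f))"

lemma ring_map_map3: "ring_map f \<Longrightarrow> ring_map (map3 f)"
  unfolding map3_def by (intro ring_map.ring_map_map_poly)

lemma inj_map3: "f 0 = 0 \<Longrightarrow> inj f \<Longrightarrow> inj (map3 f)"
  unfolding map3_def by (intro inj_map_poly) simp_all

subsection \<open>The quartic is irreducible\<close>

text \<open>Constants and variables over an arbitrary coefficient ring: the quartic is needed over
  \<open>L(t)\<close>, its algebraic closure, \<open>L[t]\<close> and \<open>L\<close>.\<close>

definition cst :: "'a::comm_ring_1 \<Rightarrow> 'a poly poly poly" where "cst c = [:[:[:c:]:]:]"
definition px :: "'a::comm_ring_1 poly poly poly" where "px = [:[:[:0, 1:]:]:]"
definition py :: "'a::comm_ring_1 poly poly poly" where "py = [:[:0, 1:]:]"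
definition pz :: "'a::comm_ring_1 poly poly poly" where "pz = [:0, 1:]"

definition quartic :: "'a::comm_ring_1 \<Rightarrow> 'a poly poly poly" where
  "quartic t = pz ^ 4 + px * py * pz\<^sup>2 + (px ^ 3 + py ^ 3) * pz + cst t * px\<^sup>2 * py\<^sup>2"

lemma ring_map_cst: "ring_map cst"
  by standard (simp_all add: cst_def one_pCons)

lemma map3_gens:
  assumes "ring_map f"
  shows "map3 f px = px" "map3 f py = py" "map3 f pz = pz" "map3 f (cst c) = cst (f c)"
proof -
  interpret f: ring_map f by fact
  interpret f1: ring_map "map_poly f" by (rule f.ring_map_map_poly)
  interpret f2: ring_map "map_poly (map_poly f)" by (rule f1.ring_map_map_poly)
  show "map3 f px = px" "map3 f py = py" "map3 f pz = pz" "map3 f (cst c) = cst (f c)"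
    by (simp_all add: map3_def px_def py_def pz_def cst_def f.map_poly_pCons f1.map_poly_pCons
          f2.map_poly_pCons f.simps f1.simps f2.simps)
qed

lemma map3_quartic: "ring_map f \<Longrightarrow> map3 f (quartic t) = quartic (f t)"
proof -
  assume f: "ring_map f"
  interpret m: ring_map "map3 f" by (rule ring_map_map3[OF f])
  show ?thesis by (simp add: quartic_def m.simps map3_gens[OF f])
qed

lemma quartic_eq:
  "quartic t = [: [:[:t:]:] * [:[:0, 1:]:]\<^sup>2 * [:0, 1:]\<^sup>2, [:[:0, 1:]:] ^ 3 + [:0, 1:] ^ 3,
     [:[:0, 1:]:] * [:0, 1:], 0, 1 :]"
  by (simp add: quartic_def px_def py_def pz_def cst_def numeral_eq_Suc algebra_simps)

lemma degree_quartic: "degree (quartic t) = 4" and lead_coeff_quartic: "lead_coeff (quartic t) = 1"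
  by (simp_all add: quartic_eq)

lemma char2_add_self:
  assumes "CHAR('a::comm_ring_1) = 2"
  shows "a + a = (0::'a)"
proof -
  have "of_nat 2 = (0::'a)" using assms by (metis of_nat_CHAR)
  hence "a * (1 + 1) = 0" by simp
  thus ?thesis by (simp only: distrib_left mult_1_right)
qed

text \<open>Since \<open>u * v = 1\<close>, the factors can be rescaled to monic ones; the missing
  cubic term then forces opposite linear coefficients in a product of two quadratics.\<close>

lemma quartic_factorization:
  fixes A B :: "'a::idom_divide poly"
  assumes AB: "A * B = [:c, b, a, 0, 1:]" and nu: "\<not> is_unit A" "\<not> is_unit B"
  shows "(\<exists>r. poly [:c, b, a, 0, 1:] r = 0) \<or>
    (\<exists>p q s. a = q + s - p\<^sup>2 \<and> b = p * (s - q) \<and> c = q * s)"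
proof -
  define u where "u = lead_coeff A"
  define v where "v = lead_coeff B"
  have "lead_coeff (A * B) = 1" by (simp add: AB)
  hence uv: "u * v = 1" by (simp add: u_def v_def lead_coeff_mult)
  have "u \<noteq> 0" using uv by (metis mult_zero_left zero_neq_one)
  have "v \<noteq> 0" using uv by (metis mult_zero_right zero_neq_one)
  have "A \<noteq> 0" "B \<noteq> 0" using \<open>u \<noteq> 0\<close> \<open>v \<noteq> 0\<close> unfolding u_def v_def by force+
  hence deg: "degree A + degree B = 4" using AB degree_mult_eq[of A B] by simp
  define A' where "A' = smult v A"
  define B' where "B' = smult u B"
  have AB': "A' * B' = [:c, b, a, 0, 1:]" using uv by (simp add: A'_def B'_def mult.commute AB)
  have dA: "degree A' = degree A" "degree B' = degree B"
    using \<open>u \<noteq> 0\<close> \<open>v \<noteq> 0\<close> by (simp_all add: A'_def B'_def)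
  have "lead_coeff A' = v * u" "lead_coeff B' = u * v"
    unfolding A'_def B'_def u_def v_def by (rule lead_coeff_smult)+
  hence monic: "lead_coeff A' = 1" "lead_coeff B' = 1" using uv by (simp_all add: mult.commute)
  have unit: "is_unit P" if "degree P = 0" "lead_coeff P * w = 1" for P :: "'a poly" and w
  proof -
    obtain p where "P = [:p:]" using \<open>degree P = 0\<close> by (rule degree_eq_zeroE)
    hence "1 = P * [:w:]" using that by (simp add: one_pCons mult.commute)
    thus ?thesis by (rule dvdI)
  qed
  have "degree A \<noteq> 0" using nu(1) unit[of A v] uv unfolding u_def by blast
  moreover have "degree B \<noteq> 0"
    using nu(2) unit[of B u] uv unfolding v_def mult.commute[of u] by blast
  ultimately consider "degree A = 1" | "degree B = 1" | "degree A = 2" "degree B = 2"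
    using deg by linarith
  moreover have root: "\<exists>r. poly P r = 0" if "degree P = 1" "lead_coeff P = 1" for P :: "'a poly"
  proof
    have "P = [:coeff P 0, 1:]"
      using that by (intro poly_eqI) (auto simp: coeff_pCons coeff_eq_0 split: nat.splits)
    thus "poly P (- coeff P 0) = 0" by (metis add.right_inverse mult.right_neutral mult_zero_right
          add_0_right poly_0 poly_pCons)
  qed
  ultimately show ?thesis
  proof cases
    case 1
    then obtain r where "poly A' r = 0" using root[of A'] monic dA by auto
    hence "poly (A' * B') r = 0" by simp
    thus ?thesis unfolding AB' by blast
  next
    case 2
    then obtain r where "poly B' r = 0" using root[of B'] monic dA by auto
    hence "poly (A' * B') r = 0" by simp
    thus ?thesis unfolding AB' by blast
  next
    case 3
    have quad: "\<exists>q p. P = [:q, p, 1:]" if "degree P = 2" "lead_coeff P = 1" for P :: "'a poly"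
    proof (intro exI)
      show "P = [:coeff P 0, coeff P 1, 1:]"
      proof (rule poly_eqI)
        fix n :: nat
        consider "n = 0" | "n = 1" | "n = 2" | "n > 2" by linarith
        thus "coeff P n = coeff [:coeff P 0, coeff P 1, 1:] n"
          using that by cases (auto simp: coeff_pCons coeff_eq_0 numeral_2_eq_2 split: nat.splits)
      qed
    qed
    obtain q p where A': "A' = [:q, p, 1:]" using quad[of A'] 3 monic dA by auto
    obtain s p' where B': "B' = [:s, p', 1:]" using quad[of B'] 3 monic dA by auto
    have "p' = - p" "a = q + s + p * p'" "b = q * p' + p * s" "c = q * s"
      using AB' by (auto simp: A' B' algebra_simps eq_neg_iff_add_eq_0)
    thus ?thesis by (intro disjI2 exI[of _ p] exI[of _ q] exI[of _ s])
       (simp add: power2_eq_square algebra_simps)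
  qed
qed

lemma coeff_mult_01:
  "coeff (p * q) 0 = coeff p 0 * coeff q 0"
  "coeff (p * q) (Suc 0) = coeff p 0 * coeff q (Suc 0) + coeff p (Suc 0) * coeff q 0"
  "coeff (p * q) (Suc (Suc 0)) = coeff p 0 * coeff q (Suc (Suc 0)) + coeff p (Suc 0) * coeff q (Suc 0)
     + coeff p (Suc (Suc 0)) * coeff q 0"
  "coeff (p * q) (Suc (Suc (Suc 0))) = coeff p 0 * coeff q (Suc (Suc (Suc 0)))
     + coeff p (Suc 0) * coeff q (Suc (Suc 0)) + coeff p (Suc (Suc 0)) * coeff q (Suc 0)
     + coeff p (Suc (Suc (Suc 0))) * coeff q 0" for p q :: "'a::comm_ring_1 poly"
  by (simp_all add: coeff_mult)

context
  fixes t :: "'a::field"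
  assumes char: "CHAR('a) = 2" and t: "t \<noteq> 0"
begin

private lemma dbl: "a + a = (0::'a poly)"
  by (rule char2_add_self) (simp add: char)

private lemma two: "(2::'a poly) = 0"
  using dbl[of 1] by simp

private lemma dbl2: "a + a = (0::'a poly poly)"
  by (rule char2_add_self) (simp add: char)

text \<open>In characteristic 2 a square has no linear term in \<open>y\<close>, so the
  \<open>y^2\<close> coefficient of the equation reduces to \<open>x^3 r_2 + t x^2\<close>. Divided
  by \<open>x^2\<close> and taken at \<open>x = 0\<close> it gives \<open>t = 0\<close>.\<close>

lemma quartic_no_root: "poly (quartic t) r \<noteq> 0"
proof
  define V where "V = ([:0, 1:] :: 'a poly)"
  assume "poly (quartic t) r = 0"
  hence eq: "(r * r) * (r * r) + [:0, V:] * (r * r) + [:V ^ 3, 0, 0, 1:] * r + [:0, 0, [:t:] * V\<^sup>2:] = 0"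
  proof -
    have gen: "poly [:a, b, c, 0, 1:] r = (r * r) * (r * r) + c * (r * r) + b * r + a"
      for a b c :: "'a poly poly" by (simp add: algebra_simps)
    have "quartic t = [: [:0, 0, [:t:] * V\<^sup>2:], [:V ^ 3, 0, 0, 1:], [:0, V:], 0, 1 :]"
      by (simp add: quartic_eq V_def power2_eq_square power3_eq_cube)
    thus ?thesis using \<open>poly (quartic t) r = 0\<close> by (simp only: gen)
  qed
  define s where "s = r * r"
  have s1: "coeff s 1 = 0" by (simp add: s_def coeff_mult_01 mult.commute dbl)
  have "coeff (s * s + [:0, V:] * s + [:V ^ 3, 0, 0, 1:] * r + [:0, 0, [:t:] * V\<^sup>2:]) 2 = 0"
    using eq by (simp add: s_def)
  hence "V ^ 3 * coeff r 2 + [:t:] * V\<^sup>2 = 0"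
    using s1 by (simp add: coeff_mult_01 coeff_pCons mult.commute numeral_2_eq_2 two[unfolded numeral_2_eq_2])
  hence "V\<^sup>2 * (V * coeff r 2 + [:t:]) = 0" by (simp add: algebra_simps numeral_eq_Suc)
  moreover have "V\<^sup>2 \<noteq> 0" by (simp add: V_def)
  ultimately have "V * coeff r 2 + [:t:] = 0" by (metis mult_eq_0_iff)
  hence "coeff (V * coeff r 2 + [:t:]) 0 = 0" by simp
  thus False using t by (simp add: V_def)
qed

text \<open>Compare coefficients of powers of \<open>y\<close>. By symmetry \<open>q_0 = 0\<close>;
  then \<open>s_0\<close> is \<open>p_0^2\<close> up to sign and \<open>p_0 s_0 = x^3\<close>, so
  \<open>s_0\<close> has degree 2 in \<open>x\<close>. But \<open>q_3 s_0^2\<close> equals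
  \<open>t x^3\<close> up to sign, of degree 3 instead of at least 4.\<close>

lemma quartic_no_quadratic_factor:
  fixes p q s :: "'a poly poly"
  defines "x \<equiv> [:[:0, 1:]:]" and "y \<equiv> [:0, 1:]"
  assumes 1: "x * y = q + s + p\<^sup>2" and 2: "x ^ 3 + y ^ 3 = p * (s + q)"
    and 3: "[:[:t:]:] * x\<^sup>2 * y\<^sup>2 = q * s"
  shows False
proof -
  define V where "V = ([:0, 1:] :: 'a poly)"
  have Vn: "V \<noteq> 0" by (simp add: V_def)
  have c1: "q + s + p * p = [:0, V:]"
    using 1 by (simp add: x_def y_def V_def power2_eq_square)
  have c2: "p * (s + q) = [:V ^ 3, 0, 0, 1:]"
    using 2 by (simp add: x_def y_def V_def power3_eq_cube)
  have c3: "q * s = [:0, 0, [:t:] * V\<^sup>2:]"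
    using 3 by (simp add: x_def y_def V_def power2_eq_square)
  have step: False if cc1: "q + s + p * p = [:0, V:]" and cc2: "p * (s + q) = [:V ^ 3, 0, 0, 1:]"
    and cc3: "q * s = [:0, 0, [:t:] * V\<^sup>2:]" and q0: "coeff q 0 = 0" for q s :: "'a poly poly"
  proof -
    have 10: "coeff q 0 + coeff s 0 + coeff p 0 * coeff p 0 = 0"
      using arg_cong[OF cc1, of "\<lambda>p. coeff p 0"] by (simp add: coeff_mult_01)
    have 11: "coeff q 1 + coeff s 1 = V"
      using arg_cong[OF cc1, of "\<lambda>p. coeff p 1"]
      by (simp add: coeff_mult_01 mult.commute two)
    have 20: "coeff p 0 * (coeff s 0 + coeff q 0) = V ^ 3"
      using arg_cong[OF cc2, of "\<lambda>p. coeff p 0"] by (simp add: coeff_mult_01)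
    have s0n: "coeff s 0 \<noteq> 0" using 20 q0 Vn by auto
    have "coeff q 1 * coeff s 0 = 0"
      using arg_cong[OF cc3, of "\<lambda>p. coeff p 1"] q0 by (simp add: coeff_mult_01)
    hence q1: "coeff q 1 = 0" using s0n by simp
    have 32: "coeff q 2 * coeff s 0 = [:t:] * V\<^sup>2"
      using arg_cong[OF cc3, of "\<lambda>p. coeff p 2"] q0 q1
      by (simp add: coeff_mult_01 coeff_pCons numeral_2_eq_2)
    have 33: "coeff q 2 * V + coeff q 3 * coeff s 0 = 0"
      using arg_cong[OF cc3, of "\<lambda>p. coeff p 3"] q0 q1 11
      by (simp add: coeff_mult_01 coeff_pCons numeral_3_eq_3 numeral_2_eq_2)
    \<comment> \<open>Eliminates \<open>coeff q 2\<close> between 32 and 33; the term subtracted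
      last is a double, hence zero.\<close>
    have "coeff q 3 * (coeff s 0 * coeff s 0) + [:t:] * V ^ 3
      = coeff s 0 * (coeff q 2 * V + coeff q 3 * coeff s 0)
        + ([:t:] * V\<^sup>2 + coeff q 2 * coeff s 0) * V
        - (coeff q 2 * coeff s 0 * V + coeff q 2 * coeff s 0 * V)"
      by (simp add: algebra_simps power2_eq_square power3_eq_cube)
    also have "\<dots> = 0" unfolding 32 33 by (simp only: dbl) simp
    finally have eq: "coeff q 3 * (coeff s 0 * coeff s 0) = - ([:t:] * V ^ 3)"
      by (simp add: eq_neg_iff_add_eq_0)
    have degV: "degree (- ([:t:] * V ^ 3)) = 3" using t by (simp add: V_def degree_power_eq degree_mult_eq)
    have s0: "coeff s 0 = - (coeff p 0 * coeff p 0)" using 10 q0 by (simp add: eq_neg_iff_add_eq_0)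
    have p0n: "coeff p 0 \<noteq> 0" using s0 s0n by auto
    have "degree (coeff p 0 * coeff s 0) = 3"
      using 20 q0 by (simp add: V_def degree_power_eq)
    hence "degree (coeff p 0) = 1"
      using p0n s0n by (simp add: degree_mult_eq s0)
    hence "degree (coeff s 0) = 2" using p0n by (simp add: s0 degree_mult_eq)
    moreover have "coeff q 3 \<noteq> 0" using eq t Vn by auto
    ultimately have "degree (coeff q 3 * (coeff s 0 * coeff s 0)) \<ge> 4"
      using s0n by (simp add: degree_mult_eq)
    thus False unfolding eq degV by simp
  qed
  have "coeff q 0 * coeff s 0 = 0"
    using arg_cong[OF c3, of "\<lambda>p. coeff p 0"] by (simp add: coeff_mult_01)
  hence "coeff q 0 = 0 \<or> coeff s 0 = 0" by simp
  thus False
    using step[OF c1 c2 c3] step[of s q] c1 c2 c3 by (auto simp: add.commute mult.commute)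
qed

lemma irreducible_quartic: "Factorial_Ring.irreducible (quartic t)"
proof (rule Factorial_Ring.irreducibleI)
  show "quartic t \<noteq> 0" by (simp add: quartic_eq)
  show "\<not> is_unit (quartic t)"
    using degree_quartic[of t] by (metis degree_pCons_0 is_unit_poly_iff zero_neq_numeral)
  fix A B assume AB: "quartic t = A * B"
  show "is_unit A \<or> is_unit B"
  proof (rule ccontr)
    assume "\<not> (is_unit A \<or> is_unit B)"
    hence nu: "\<not> is_unit A" "\<not> is_unit B" by simp_all
    note AB' = AB[symmetric, unfolded quartic_eq]
    have "(\<exists>r. poly (quartic t) r = 0) \<or> (\<exists>p q s. [:[:0, 1:]:] * [:0, 1:] = q + s - p\<^sup>2 \<and>
      [:[:0, 1:]:] ^ 3 + [:0, 1:] ^ 3 = p * (s - q) \<and>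
      [:[:t:]:] * [:[:0, 1:]:]\<^sup>2 * [:0, 1:]\<^sup>2 = q * s)"
      unfolding quartic_eq by (rule quartic_factorization[OF AB' nu])
    then consider r where "poly (quartic t) r = 0"
      | p q s where "[:[:0, 1:]:] * [:0, 1:] = q + s - p\<^sup>2"
          "[:[:0, 1:]:] ^ 3 + [:0, 1:] ^ 3 = p * (s - q)"
          "[:[:t:]:] * [:[:0, 1:]:]\<^sup>2 * [:0, 1:]\<^sup>2 = q * s"
      by (elim disjE exE conjE)
    thus False
    proof cases
      case 1
      thus False using quartic_no_root by blast
    next
      case 2
      have neg: "- a = a" for a :: "'a poly poly" using dbl2[of a] by (metis add_eq_0_iff)
      have minus: "a - b = a + b" for a b :: "'a poly poly" using neg[of b] by (metis diff_conv_add_uminus)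
      show False using quartic_no_quadratic_factor[OF 2[unfolded minus]] .
    qed
  qed
qed

end

subsection \<open>A field containing the coordinate ring\<close>

text \<open>Algebraic closure of \<open>K(x, y)\<close>. It contains a root of the quartic, so
  identities on the curve become identities in a field, where the denominators of the charts are
  available.\<close>

type_synonym 'k big = "'k poly poly fract alg_closure"

definition emb :: "'k::field poly poly \<Rightarrow> 'k big" where
  "emb p = to_ac (to_fract p)"

lemma ring_map_emb: "ring_map emb"
  unfolding emb_def by (rule ring_map_comp[OF ring_map_to_fract ring_map_to_ac])

text \<open>Any root will do: once the quartic is irreducible, the kernel of evaluation does not
  depend on the choice.\<close>

definition zeta :: "'k::field \<Rightarrow> 'k big" where
  "zeta t = (SOME \<zeta>. poly (map_poly emb (quartic t)) \<zeta> = 0)"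

definition ev :: "'k::field \<Rightarrow> 'k poly poly poly \<Rightarrow> 'k big" where
  "ev t p = poly (map_poly emb p) (zeta t)"

lemma ring_map_ev: "ring_map (ev t)"
proof -
  interpret e: ring_map emb by (rule ring_map_emb)
  show ?thesis unfolding ev_def by (rule ring_map_comp[OF e.ring_map_map_poly ring_map_poly])
qed

lemma ev_quartic: "ev t (quartic t) = 0"
proof -
  interpret e: ring_map emb by (rule ring_map_emb)
  have "map_poly emb (quartic t) = [: emb ([:[:t:]:] * [:[:0, 1:]:]\<^sup>2 * [:0, 1:]\<^sup>2),
      emb ([:[:0, 1:]:] ^ 3 + [:0, 1:] ^ 3), emb ([:[:0, 1:]:] * [:0, 1:]), 0, 1 :]"
    unfolding quartic_eq by (simp only: e.map_poly_pCons e.zero e.one map_poly_0)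
  hence "degree (map_poly emb (quartic t)) > 0" by simp
  hence "\<exists>\<zeta>. poly (map_poly emb (quartic t)) \<zeta> = 0" by (rule alg_closed_imp_poly_has_root)
  thus ?thesis unfolding ev_def zeta_def by (rule someI_ex)
qed

text \<open>Gauss' lemma: the quartic stays irreducible over \<open>K(x, y)\<close>, hence is the minimal polynomial.\<close>

lemma ev_eq_0_imp_eq_0:
  fixes t :: "'k::{field,factorial_ring_gcd,semiring_gcd_mult_normalize}"
  assumes char: "CHAR('k) = 2" and t: "t \<noteq> 0"
    and p: "ev t p = 0" "degree p < 4"
  shows "p = 0"
proof (rule ccontr)
  assume "p \<noteq> 0"
  interpret a: ring_map "to_ac :: 'k poly poly fract \<Rightarrow> 'k big" by (rule ring_map_to_ac)
  interpret m: ring_map "map_poly (to_ac :: 'k poly poly fract \<Rightarrow> 'k big)"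
    by (rule a.ring_map_map_poly)
  define e where "e q = poly (map_poly to_ac q) (zeta t)" for q :: "'k poly poly fract poly"
  have e_fract: "e (fract_poly q) = ev t q" for q
    by (simp add: e_def ev_def emb_def emb_def[abs_def] map_poly_map_poly o_def)
  define G where "G = fract_poly (quartic t)"
  have irr: "Factorial_Ring.irreducible G"
    using irreducible_quartic[OF char t] nonconst_poly_irreducible_iff[of "quartic t"]
    by (simp add: degree_quartic G_def)
  have degG: "degree G = 4" by (simp add: G_def degree_map_poly degree_quartic)
  define d where "d = (LEAST n. \<exists>q. q \<noteq> 0 \<and> e q = 0 \<and> degree q = n)"
  have ex: "\<exists>n q. q \<noteq> 0 \<and> e q = 0 \<and> degree q = n"
    using \<open>p \<noteq> 0\<close> p(1) e_fract[of p] by (intro exI[of _ "degree (fract_poly p)"] exI[of _ "fract_poly p"]) auto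
  have "\<exists>q. q \<noteq> 0 \<and> e q = 0 \<and> degree q = d" unfolding d_def by (rule LeastI_ex[OF ex])
  then obtain D where D: "D \<noteq> 0" "e D = 0" "degree D = d" by blast
  have min: "d \<le> degree q" if "q \<noteq> 0" "e q = 0" for q
    unfolding d_def by (rule Least_le) (use that in blast)
  have "e (G mod D) = 0"
  proof -
    have "e G = e (G div D * D + G mod D)" by simp
    also have "\<dots> = e (G div D) * e D + e (G mod D)"
      unfolding e_def m.add m.mult poly_add poly_mult by (rule refl)
    finally show ?thesis using D(2) e_fract[of "quartic t"] ev_quartic[of t] by (simp add: G_def)
  qed
  moreover have "degree (G mod D) < degree D" if "G mod D \<noteq> 0"
    using degree_mod_less[OF D(1), of G] that by simp
  ultimately have "G mod D = 0" using min D(3) by (meson not_le)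
  hence "G = D * (G div D)" by (metis add_0_right mult_div_mod_eq)
  hence "is_unit D \<or> is_unit (G div D)" using irr by (rule Factorial_Ring.irreducibleD[rotated])
  thus False
  proof
    assume "is_unit D"
    then obtain c where "D = [:c:]" by (auto simp: is_unit_poly_iff)
    moreover from this have "c \<noteq> 0" using D(1) by auto
    ultimately show False using D(2) by (simp add: e_def a.map_poly_pCons)
  next
    assume "is_unit (G div D)"
    hence "degree (G div D) = 0" by (auto simp: is_unit_poly_iff)
    moreover have "G div D \<noteq> 0" using \<open>G = D * (G div D)\<close> degG by auto
    ultimately have "degree D = 4"
      using \<open>G = D * (G div D)\<close> D(1) degG degree_mult_eq[of D "G div D"] by simp
    moreover have "d \<le> degree p"
      using min[of "fract_poly p"] \<open>p \<noteq> 0\<close> p(1) e_fract[of p] by (simp add: degree_map_poly)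
    ultimately show False using p(2) D(3) by simp
  qed
qed

lemma ev_eq_0_iff:
  fixes t :: "'k::{field,factorial_ring_gcd,semiring_gcd_mult_normalize}"
  assumes "CHAR('k) = 2" "t \<noteq> 0"
  shows "ev t p = 0 \<longleftrightarrow> quartic t dvd p"
proof
  interpret v: ring_map "ev t" by (rule ring_map_ev)
  show "ev t p = 0" if "quartic t dvd p" using that by (auto simp: v.mult ev_quartic elim!: dvdE)
  assume 0: "ev t p = 0"
  obtain q r where qr: "p = quartic t * q + r" "r = 0 \<or> degree r < degree (quartic t)"
    using monic_division[OF lead_coeff_quartic] .
  have "ev t r = 0" using 0 by (simp add: qr v.simps ev_quartic)
  hence "r = 0" using qr(2) ev_eq_0_imp_eq_0[OF assms, of r] by (auto simp: degree_quartic)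
  thus "quartic t dvd p" by (simp add: qr)
qed

section \<open>Syzygies and wedge products at a point of the quartic in characteristic 2\<close>

locale quartic_point =
  fixes x y z t :: "'f::field"
  assumes char2: "(1::'f) + 1 = 0"
    and quartic: "z ^ 4 + x * y * z\<^sup>2 + (x ^ 3 + y ^ 3) * z + t * x\<^sup>2 * y\<^sup>2 = 0"
    and x_nz: "x \<noteq> 0" and y_nz: "y \<noteq> 0"
begin

lemma add_self: "a + a = (0::'f)"
  using char2 by (metis distrib_left mult.right_neutral mult_zero_right)

lemma add_self_left: "a + (a + b) = (b::'f)"
  by (simp add: add_self flip: add.assoc)

lemma add_eq_0_iff: "a + b = 0 \<longleftrightarrow> a = (b::'f)"
  by (metis add_self add_left_cancel)

lemmas char2_simps = add_self add_self_left algebra_simps numeral_eq_Suc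

text \<open>The triples \<open>(a1, b1, c1)\<close>, \<open>(a2, b2, c2)\<close> and
  \<open>(c2, c1, J)\<close> are sections of \<open>F^* E_l\<close> twisted by 7, for
  \<open>k = t + l^2\<close>. The columns \<open>(b1, b2, c1)\<close> and \<open>(c1, c2, J)\<close>
  are syzygies for \<open>E_k\<close>, and this is why wedging with the three sections lands in
  \<open>E_k\<close>.\<close>

definition J :: 'f where "J = x ^ 3 + y ^ 3"
definition c1 :: "'f \<Rightarrow> 'f" where "c1 k = x * z\<^sup>2 + y\<^sup>2 * z + k * x\<^sup>2 * y"
definition c2 :: "'f \<Rightarrow> 'f" where "c2 k = y * z\<^sup>2 + x\<^sup>2 * z + k * x * y\<^sup>2"
definition b1 :: 'f where "b1 = y * z\<^sup>2 + x\<^sup>2 * z"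
definition b2 :: "'f \<Rightarrow> 'f" where "b2 k = z ^ 3 + (1 + k) * x * y * z + (t + k\<^sup>2) * x ^ 3"
definition a1 :: "'f \<Rightarrow> 'f" where "a1 k = z ^ 3 + (1 + k) * x * y * z + (t + k\<^sup>2) * y ^ 3"
definition a2 :: 'f where "a2 = x * z\<^sup>2 + y\<^sup>2 * z"

lemmas sect_defs = J_def c1_def c2_def b1_def b2_def a1_def a2_def

abbreviation Q :: 'f where
  "Q \<equiv> z ^ 4 + x * y * z\<^sup>2 + (x ^ 3 + y ^ 3) * z + t * x\<^sup>2 * y\<^sup>2"

text \<open>In each use \<open>h\<close> is the cofactor of the quartic in \<open>a - b\<close>;
  what remains is a polynomial identity, settled by expanding and cancelling equal terms in
  pairs.\<close>

lemma eqI_mod_quartic: "a = b" if "a = b + h * Q"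
  using that by (simp only: quartic mult_zero_right add_0_right)

text \<open>This and \<open>wedge23\<close> are \<open>x^4\<close> times wedge products of two of
  the sections. The factor \<open>t + k^2\<close> is the successor of \<open>k\<close> in the
  \<open>lam\<close> orbit, so the sections degenerate when the orbit returns to 0.\<close>

lemma wedge13: "b1 * J + c1 k * c1 k = (t + k\<^sup>2) * x ^ 4 * y\<^sup>2"
  by (rule eqI_mod_quartic[where h = "x\<^sup>2"]) (simp add: sect_defs char2_simps)

lemma wedge23: "b2 k * J + c1 k * c2 k = (t + k\<^sup>2) * x ^ 6"
  by (rule eqI_mod_quartic[where h = "x * y"]) (simp add: sect_defs char2_simps)

lemma section1: "a1 k * x ^ 4 + b1 * y ^ 4 + c1 k * (z ^ 4 + m * x\<^sup>2 * y\<^sup>2) = 0"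
  if "m = k + t"
  by (rule eqI_mod_quartic[where h = "x\<^sup>2*y*k + x\<^sup>2*y + x*z\<^sup>2 + y\<^sup>2*z"])
     (simp add: sect_defs char2_simps that)

lemma section2: "a2 * x ^ 4 + b2 k * y ^ 4 + c2 k * (z ^ 4 + m * x\<^sup>2 * y\<^sup>2) = 0"
  if "m = k + t"
  by (rule eqI_mod_quartic[where h = "x\<^sup>2*z + x*y\<^sup>2*k + x*y\<^sup>2 + y*z\<^sup>2"])
     (simp add: sect_defs char2_simps that)

lemma section3: "c2 k * x ^ 4 + c1 k * y ^ 4 + J * (z ^ 4 + m * x\<^sup>2 * y\<^sup>2) = 0"
  if "m = k + t"
  by (rule eqI_mod_quartic[where h = "x ^ 3 + y ^ 3"])
     (simp add: sect_defs char2_simps that)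

lemma relation_c: "x\<^sup>2 * c1 k + y\<^sup>2 * c2 k + (z\<^sup>2 + k * x * y) * J = 0"
  by (simp add: sect_defs char2_simps)

lemma relation_b: "x\<^sup>2 * b1 + y\<^sup>2 * b2 k + (z\<^sup>2 + k * x * y) * c1 k = 0"
  by (rule eqI_mod_quartic[where h = x]) (simp add: sect_defs char2_simps)

text \<open>
  \<open>(a, b, c)\<close> is a syzygy of \<open>F\<^sup>*E\<^sub>\<lambda>\<close>, where \<open>E\<^sub>\<lambda> = Syz(x\<^sup>2, y\<^sup>2, z\<^sup>2 + \<lambda> x y)\<close> and \<open>m = \<lambda>\<^sup>2\<close>.
  Its wedge products with the three sections \<open>(a\<^sub>i, b\<^sub>i, c\<^sub>i)\<close> of \<open>F\<^sup>*E\<^sub>\<lambda>(7)\<close> form a syzygy of \<open>E\<^sub>k\<close>.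
\<close>

context
  fixes m k a b c
  assumes k: "m = k + t" and rel: "a * x ^ 4 + b * y ^ 4 + c * (z ^ 4 + m * x\<^sup>2 * y\<^sup>2) = 0"
begin

text \<open>Both sides are \<open>x^4 y^4\<close> times the wedge product of the two syzygies.
  Equality lets the quotient by \<open>x^4\<close> on one chart be read as a quotient by
  \<open>y^4\<close> on the other.\<close>

lemma wedge_swap:
  assumes "a' * x ^ 4 + b' * y ^ 4 + c' * (z ^ 4 + m * x\<^sup>2 * y\<^sup>2) = 0"
  shows "y ^ 4 * (b * c' + b' * c) = x ^ 4 * (a * c' + a' * c)"
proof -
  define D where "D = z ^ 4 + m * x\<^sup>2 * y\<^sup>2"
  have "y ^ 4 * (b * c' + b' * c) + x ^ 4 * (a * c' + a' * c) =
    c' * (a * x ^ 4 + b * y ^ 4 + c * D) + c * (a' * x ^ 4 + b' * y ^ 4 + c' * D)"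
    by (simp add: algebra_simps add_self add_self_left)
  also have "\<dots> = 0" using rel assms by (simp add: D_def)
  finally show ?thesis by (simp add: add_eq_0_iff)
qed

lemmas wedge_swaps = wedge_swap[OF section1[OF k]] wedge_swap[OF section2[OF k]]
  wedge_swap[OF section3[OF k]]

lemma wedge_relation:
  "x\<^sup>2 * (b * c1 k + b1 * c) + y\<^sup>2 * (b * c2 k + b2 k * c)
     + (z\<^sup>2 + k * x * y) * (b * J + c1 k * c) = 0"
proof -
  define D where "D = z\<^sup>2 + k * x * y"
  have "x\<^sup>2 * (b * c1 k + b1 * c) + y\<^sup>2 * (b * c2 k + b2 k * c) + D * (b * J + c1 k * c)
    = b * (x\<^sup>2 * c1 k + y\<^sup>2 * c2 k + D * J) + c * (x\<^sup>2 * b1 + y\<^sup>2 * b2 k + D * c1 k)"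
    by (simp add: algebra_simps)
  thus ?thesis using relation_c relation_b by (simp add: D_def)
qed

text \<open>Cramer's rule for \<open>b\<close> and \<open>c\<close> in the second and third
  components, whose determinant is the quantity of \<open>wedge23\<close>.\<close>

lemma wedge_injective:
  assumes "b * c2 k + b2 k * c = 0" "b * J + c1 k * c = 0" "t + k\<^sup>2 \<noteq> 0" "J \<noteq> 0"
  shows "a = 0 \<and> b = 0 \<and> c = 0"
proof -
  have "c * (b2 k * J + c1 k * c2 k) =
     J * (b * c2 k + b2 k * c) + c2 k * (b * J + c1 k * c)"
    by (simp add: algebra_simps add_self add_self_left)
  hence "c * ((t + k\<^sup>2) * x ^ 6) = 0" using assms(1,2) by (simp add: wedge23)
  hence "c = 0" using assms(3) x_nz by simp
  moreover from this have "b = 0" using assms(2,4) by simp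
  ultimately show ?thesis using rel x_nz by simp
qed

end

end

text \<open>
  \<open>Rx\<close> and \<open>Ry\<close> play the role of the coordinate rings of the charts \<open>D(x)\<close> and \<open>D(y)\<close>:
  a first cohomology class vanishes iff it is a sum of sections over the two charts.
\<close>

locale two_charts = quartic_point x y z t for x y z t :: "'f::field" +
  fixes Rx Ry :: "'f set"
  assumes add_Rx: "a \<in> Rx \<Longrightarrow> b \<in> Rx \<Longrightarrow> a + b \<in> Rx"
    and mult_Rx: "a \<in> Rx \<Longrightarrow> b \<in> Rx \<Longrightarrow> a * b \<in> Rx"
    and one_Rx: "1 \<in> Rx" and gen_Rx: "x \<in> Rx" "y \<in> Rx" "z \<in> Rx" "t \<in> Rx"
    and inverse_Rx: "1 / x \<in> Rx"
    and add_Ry: "a \<in> Ry \<Longrightarrow> b \<in> Ry \<Longrightarrow> a + b \<in> Ry"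
    and mult_Ry: "a \<in> Ry \<Longrightarrow> b \<in> Ry \<Longrightarrow> a * b \<in> Ry"
    and one_Ry: "1 \<in> Ry" and gen_Ry: "x \<in> Ry" "y \<in> Ry" "z \<in> Ry" "t \<in> Ry"
    and inverse_Ry: "1 / y \<in> Ry"
begin

lemma zero_Rx: "0 \<in> Rx" and zero_Ry: "0 \<in> Ry"
  using add_Rx[OF one_Rx one_Rx] add_Ry[OF one_Ry one_Ry] by (simp_all only: char2)

lemma power_Rx: "a \<in> Rx \<Longrightarrow> a ^ n \<in> Rx"
  by (induction n) (auto intro: one_Rx mult_Rx)

lemma power_Ry: "a \<in> Ry \<Longrightarrow> a ^ n \<in> Ry"
  by (induction n) (auto intro: one_Ry mult_Ry)

lemma divide_Rx: "a \<in> Rx \<Longrightarrow> a / x ^ n \<in> Rx"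
  using mult_Rx[OF _ power_Rx[OF inverse_Rx], of a n] by (simp add: power_divide)

lemma divide_Ry: "a \<in> Ry \<Longrightarrow> a / y ^ n \<in> Ry"
  using mult_Ry[OF _ power_Ry[OF inverse_Ry], of a n] by (simp add: power_divide)

lemmas Rx_intros = add_Rx mult_Rx one_Rx zero_Rx gen_Rx power_Rx divide_Rx
lemmas Ry_intros = add_Ry mult_Ry one_Ry zero_Ry gen_Ry power_Ry divide_Ry

lemma sect_Rx: "J \<in> Rx" "b1 \<in> Rx" "a2 \<in> Rx"
  "k \<in> Rx \<Longrightarrow> c1 k \<in> Rx" "k \<in> Rx \<Longrightarrow> c2 k \<in> Rx"
  "k \<in> Rx \<Longrightarrow> b2 k \<in> Rx" "k \<in> Rx \<Longrightarrow> a1 k \<in> Rx"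
  unfolding sect_defs by (intro Rx_intros | assumption)+

lemma sect_Ry: "J \<in> Ry" "b1 \<in> Ry" "a2 \<in> Ry"
  "k \<in> Ry \<Longrightarrow> c1 k \<in> Ry" "k \<in> Ry \<Longrightarrow> c2 k \<in> Ry"
  "k \<in> Ry \<Longrightarrow> b2 k \<in> Ry" "k \<in> Ry \<Longrightarrow> a1 k \<in> Ry"
  unfolding sect_defs by (intro Ry_intros | assumption)+

text \<open>Vanishing of the Cech class of \<open>(a, b, c)\<close> in the syzygy bundle of
  \<open>(V, Y, D)\<close>; in characteristic 2 a coboundary is a sum instead of a
  difference.\<close>

definition splits :: "'f \<Rightarrow> 'f \<Rightarrow> 'f \<Rightarrow> 'f \<Rightarrow> 'f \<Rightarrow> 'f \<Rightarrow> bool" where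
  "splits V Y D a b c \<longleftrightarrow> (\<exists>p q r p' q' r'.
     p \<in> Rx \<and> q \<in> Rx \<and> r \<in> Rx \<and> p' \<in> Ry \<and> q' \<in> Ry \<and> r' \<in> Ry \<and>
     p * V + q * Y + r * D = 0 \<and> p' * V + q' * Y + r' * D = 0 \<and>
     a = p + p' \<and> b = q + q' \<and> c = r + r')"

lemma splitsI:
  assumes "p \<in> Rx" "q \<in> Rx" "r \<in> Rx" "p' \<in> Ry" "q' \<in> Ry" "r' \<in> Ry"
    "p * V + q * Y + r * D = 0" "p' * V + q' * Y + r' * D = 0"
    "a = p + p'" "b = q + q'" "c = r + r'"
  shows "splits V Y D a b c"
  unfolding splits_def by (intro exI conjI) (rule assms)+

lemma splitsE:
  assumes "splits V Y D a b c"
  obtains p q r p' q' r' where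
    "p \<in> Rx" "q \<in> Rx" "r \<in> Rx" "p' \<in> Ry" "q' \<in> Ry" "r' \<in> Ry"
    "p * V + q * Y + r * D = 0" "p' * V + q' * Y + r' * D = 0"
    "a = p + p'" "b = q + q'" "c = r + r'"
  using assms unfolding splits_def by (elim exE conjE)

lemma splits_add:
  assumes "splits V Y D a b c" "splits V Y D a' b' c'"
  shows "splits V Y D (a + a') (b + b') (c + c')"
  using assms(1)
proof (rule splitsE)
  fix p q r p' q' r'
  assume 1: "p \<in> Rx" "q \<in> Rx" "r \<in> Rx" "p' \<in> Ry" "q' \<in> Ry" "r' \<in> Ry"
    "p * V + q * Y + r * D = 0" "p' * V + q' * Y + r' * D = 0"
    "a = p + p'" "b = q + q'" "c = r + r'"
  show ?thesis using assms(2)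
  proof (rule splitsE)
    fix u v w u' v' w'
    assume 2: "u \<in> Rx" "v \<in> Rx" "w \<in> Rx" "u' \<in> Ry" "v' \<in> Ry" "w' \<in> Ry"
      "u * V + v * Y + w * D = 0" "u' * V + v' * Y + w' * D = 0"
      "a' = u + u'" "b' = v + v'" "c' = w + w'"
    have "(p + u) * V + (q + v) * Y + (r + w) * D = (p * V + q * Y + r * D) + (u * V + v * Y + w * D)"
      "(p' + u') * V + (q' + v') * Y + (r' + w') * D
        = (p' * V + q' * Y + r' * D) + (u' * V + v' * Y + w' * D)"
      by (simp_all only: distrib_right add_ac)
    hence "(p + u) * V + (q + v) * Y + (r + w) * D = 0"
      "(p' + u') * V + (q' + v') * Y + (r' + w') * D = 0"
      by (simp_all only: 1 2 add_0_right)
    thus ?thesis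
      by (intro splitsI[of "p + u" "q + v" "r + w" "p' + u'" "q' + v'" "r' + w'"]
            add_Rx add_Ry 1(1-6) 2(1-6)) (simp_all only: 1(9-) 2(9-) add_ac)
  qed
qed

lemma splits_x: "splits V Y D a b c"
  if "a \<in> Rx" "b \<in> Rx" "c \<in> Rx" "a * V + b * Y + c * D = 0"
  by (rule splitsI[of a b c 0 0 0]) (use that zero_Ry in simp_all)

lemma splits_y: "splits V Y D a b c"
  if "a \<in> Ry" "b \<in> Ry" "c \<in> Ry" "a * V + b * Y + c * D = 0"
  by (rule splitsI[of 0 0 0 a b c]) (use that zero_Rx in simp_all)

text \<open>The map on \<open>H^1\<close> induced by \<open>F^* E_l -> E_k\<close>. Over
  \<open>Rx\<close> one divides by \<open>x^4\<close>; over \<open>Ry\<close> the relations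
  \<open>wedge_swaps\<close> turn the same quotient into one by \<open>y^4\<close>.\<close>

lemma splits_wedge:
  assumes k: "m = k + t" "k \<in> Rx" "k \<in> Ry"
    and sp: "splits (x ^ 4) (y ^ 4) (z ^ 4 + m * x\<^sup>2 * y\<^sup>2) a b c"
  shows "splits (x\<^sup>2) (y\<^sup>2) (z\<^sup>2 + k * x * y)
    ((b * c1 k + b1 * c) / x ^ 4) ((b * c2 k + b2 k * c) / x ^ 4) ((b * J + c1 k * c) / x ^ 4)"
proof -
  obtain p q r p' q' r' where 1: "p \<in> Rx" "q \<in> Rx" "r \<in> Rx" "p' \<in> Ry" "q' \<in> Ry" "r' \<in> Ry"
     and rel: "p * x ^ 4 + q * y ^ 4 + r * (z ^ 4 + m * x\<^sup>2 * y\<^sup>2) = 0"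
     and rel': "p' * x ^ 4 + q' * y ^ 4 + r' * (z ^ 4 + m * x\<^sup>2 * y\<^sup>2) = 0"
     and eq: "a = p + p'" "b = q + q'" "c = r + r'"
    using sp by (rule splitsE)
  have quot: "u / x ^ 4 = v / y ^ 4" if "y ^ 4 * u = x ^ 4 * v" for u v
    using that x_nz y_nz by (simp add: field_simps)
  have rel0: "u / x ^ 4 * x\<^sup>2 + v / x ^ 4 * y\<^sup>2 + w / x ^ 4 * (z\<^sup>2 + k * x * y) = 0"
    if "x\<^sup>2 * u + y\<^sup>2 * v + (z\<^sup>2 + k * x * y) * w = 0" for u v w
  proof -
    have "u / x ^ 4 * x\<^sup>2 + v / x ^ 4 * y\<^sup>2 + w / x ^ 4 * (z\<^sup>2 + k * x * y)
      = (x\<^sup>2 * u + y\<^sup>2 * v + (z\<^sup>2 + k * x * y) * w) / x ^ 4"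
      by (simp add: add_divide_distrib mult.commute)
    thus ?thesis using that by simp
  qed
  have "splits (x\<^sup>2) (y\<^sup>2) (z\<^sup>2 + k * x * y)
    ((q * c1 k + b1 * r) / x ^ 4) ((q * c2 k + b2 k * r) / x ^ 4) ((q * J + c1 k * r) / x ^ 4)"
    by (rule splits_x[OF _ _ _ rel0[OF wedge_relation[OF k(1) rel]]])
       (intro Rx_intros sect_Rx 1 k)+
  moreover have "splits (x\<^sup>2) (y\<^sup>2) (z\<^sup>2 + k * x * y)
    ((q' * c1 k + b1 * r') / x ^ 4) ((q' * c2 k + b2 k * r') / x ^ 4) ((q' * J + c1 k * r') / x ^ 4)"
    by (rule splits_y[OF _ _ _ rel0[OF wedge_relation[OF k(1) rel']]];
        subst quot[OF wedge_swaps(1)[OF k(1) rel']] quot[OF wedge_swaps(2)[OF k(1) rel']]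
          quot[OF wedge_swaps(3)[OF k(1) rel']])
       (intro Ry_intros sect_Ry 1 k)+
  ultimately have "splits (x\<^sup>2) (y\<^sup>2) (z\<^sup>2 + k * x * y)
    ((q * c1 k + b1 * r) / x ^ 4 + (q' * c1 k + b1 * r') / x ^ 4)
    ((q * c2 k + b2 k * r) / x ^ 4 + (q' * c2 k + b2 k * r') / x ^ 4)
    ((q * J + c1 k * r) / x ^ 4 + (q' * J + c1 k * r') / x ^ 4)"
    by (rule splits_add)
  moreover have "(q * s + s' * r) / x ^ 4 + (q' * s + s' * r') / x ^ 4 = (b * s + s' * c) / x ^ 4"
    for s s' unfolding eq add_divide_distrib[symmetric] by (simp add: algebra_simps)
  ultimately show ?thesis by (simp only:)
qed

text \<open>The triple \<open>(c y^3 z^3 / x^4, c z^3 / y, 0)\<close> is the connecting image of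
  \<open>c f\<close> for \<open>F^* E_0\<close>, and the membership equation writes it as a sum over
  the charts. Its wedge products with the three sections are \<open>c z^3 / (x^4 y)\<close> times
  \<open>c1\<close>, \<open>c2\<close>, \<open>J\<close>.\<close>

lemma splits_start:
  assumes "t \<in> Rx" "t \<in> Ry" "c \<in> Rx" "c \<in> Ry" "{u, v, w} \<subseteq> Rx" "{u, v, w} \<subseteq> Ry"
    and eq: "c * y ^ 3 * z ^ 3 = u * x ^ 4 + v * y ^ 4 + w * z ^ 4"
  shows "splits (x\<^sup>2) (y\<^sup>2) (z\<^sup>2 + t * x * y) (c * (z ^ 3 / (x ^ 4 * y)) * c1 t)
     (c * (z ^ 3 / (x ^ 4 * y)) * c2 t) (c * (z ^ 3 / (x ^ 4 * y)) * J)"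
proof -
  have 1: "splits (x ^ 4) (y ^ 4) (z ^ 4 + 0 * x\<^sup>2 * y\<^sup>2) (u + c * y ^ 3 * z ^ 3 / x ^ 4) v w"
  proof (rule splits_x)
    have "(u + c * y ^ 3 * z ^ 3 / x ^ 4) * x ^ 4 + v * y ^ 4 + w * (z ^ 4 + 0 * x\<^sup>2 * y\<^sup>2)
      = (u * x ^ 4 + v * y ^ 4 + w * z ^ 4) + c * y ^ 3 * z ^ 3"
      using x_nz by (simp add: algebra_simps)
    thus "(u + c * y ^ 3 * z ^ 3 / x ^ 4) * x ^ 4 + v * y ^ 4 + w * (z ^ 4 + 0 * x\<^sup>2 * y\<^sup>2) = 0"
      by (simp only: eq add_self)
  qed (use assms in \<open>auto intro!: Rx_intros\<close>)
  have 2: "splits (x ^ 4) (y ^ 4) (z ^ 4 + 0 * x\<^sup>2 * y\<^sup>2) u (v + c * z ^ 3 / y) w"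
  proof (rule splits_y)
    have "u * x ^ 4 + (v + c * z ^ 3 / y) * y ^ 4 + w * (z ^ 4 + 0 * x\<^sup>2 * y\<^sup>2)
      = (u * x ^ 4 + v * y ^ 4 + w * z ^ 4) + c * y ^ 3 * z ^ 3"
      using y_nz by (simp add: algebra_simps power4_eq_xxxx power3_eq_cube)
    thus "u * x ^ 4 + (v + c * z ^ 3 / y) * y ^ 4 + w * (z ^ 4 + 0 * x\<^sup>2 * y\<^sup>2) = 0"
      by (simp only: eq add_self)
  qed (use assms divide_Ry[of "c * z ^ 3" 1] in \<open>auto intro!: Ry_intros\<close>)
  have "u + c * y ^ 3 * z ^ 3 / x ^ 4 + u = c * y ^ 3 * z ^ 3 / x ^ 4"
    "v + (v + c * z ^ 3 / y) = c * z ^ 3 / y" "w + w = 0"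
    by (simp_all add: algebra_simps add_self add_self_left)
  with splits_add[OF 1 2]
  have "splits (x ^ 4) (y ^ 4) (z ^ 4 + 0 * x\<^sup>2 * y\<^sup>2) (c * y ^ 3 * z ^ 3 / x ^ 4) (c * z ^ 3 / y) 0"
    by simp
  from splits_wedge[OF _ assms(1,2) this] show ?thesis
    by (simp add: add_self field_simps)
qed

text \<open>Both terms have degree -2. Up to coboundaries, this two-parameter family of multipliers
  of \<open>(c1, c2, J)\<close> is stable under a Frobenius step.\<close>

abbreviation eta :: "'f \<Rightarrow> 'f \<Rightarrow> 'f" where
  "eta A B \<equiv> A / (x * y) + B * (z ^ 3 / (x ^ 4 * y))"

text \<open>The Frobenius image of the section, wedged with the three sections, is
  \<open>k x y\<close> times the section of \<open>E_k\<close> plus \<open>(t + k^2) J\<close> times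
  the Koszul syzygy \<open>(y^2, x^2, 0)\<close>.\<close>

lemma wedge_square:
  assumes "k = t + l\<^sup>2"
  shows "(c2 l)\<^sup>2 * c1 k + b1 * J\<^sup>2 = x ^ 4 * (k * x * y * c1 k + (t + k\<^sup>2) * J * y\<^sup>2)"
    and "(c2 l)\<^sup>2 * c2 k + b2 k * J\<^sup>2 = x ^ 4 * (k * x * y * c2 k + (t + k\<^sup>2) * J * x\<^sup>2)"
    and "(c2 l)\<^sup>2 * J + c1 k * J\<^sup>2 = x ^ 4 * (k * x * y * J)"
proof -
  have l: "l\<^sup>2 = k + t" by (simp add: assms algebra_simps add_self add_self_left)
  have "(c2 l)\<^sup>2 = y\<^sup>2 * z ^ 4 + x ^ 4 * z\<^sup>2 + l\<^sup>2 * x\<^sup>2 * y ^ 4"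
    by (simp add: c2_def char2_simps)
  note sq = this[unfolded l]
  show "(c2 l)\<^sup>2 * c1 k + b1 * J\<^sup>2 = x ^ 4 * (k * x * y * c1 k + (t + k\<^sup>2) * J * y\<^sup>2)"
    unfolding sq
    by (rule eqI_mod_quartic[where
          h = "x^5 + x^2*y^3*k + x^2*y^3 + x*y^2*z^2 + y^4*z"]) (simp add: sect_defs char2_simps)
  show "(c2 l)\<^sup>2 * c2 k + b2 k * J\<^sup>2 = x ^ 4 * (k * x * y * c2 k + (t + k\<^sup>2) * J * x\<^sup>2)"
    unfolding sq
    by (rule eqI_mod_quartic[where
          h = "x^4*y + x^2*y^2*z + x*y^4*k + x*y^4 + y^3*z^2"]) (simp add: sect_defs char2_simps)
  show "(c2 l)\<^sup>2 * J + c1 k * J\<^sup>2 = x ^ 4 * (k * x * y * J)"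
    unfolding sq
    by (rule eqI_mod_quartic[where h = "x^3*y^2 + y^5"]) (simp add: sect_defs char2_simps)
qed

lemma z6_cube: "z ^ 6 + x ^ 3 * z ^ 3 = y * (y\<^sup>2 * z ^ 3 + x * z ^ 4 + t * x\<^sup>2 * y * z\<^sup>2)"
  by (rule eqI_mod_quartic[where h = "z\<^sup>2"]) (simp add: char2_simps)

definition rest :: 'f where
  "rest = y ^ 4 * z ^ 3 + x * y ^ 5 * z + (1 + t) * x\<^sup>2 * J * z\<^sup>2 + t * x ^ 3 * y * J"

lemma J_z6: "J * z ^ 6 = x ^ 6 * z ^ 3 + x ^ 7 * y * z + y\<^sup>2 * rest"
  by (rule eqI_mod_quartic[where h = "x^4*y + x^3*z^2 + x*y^4 + y^3*z^2"])
     (simp add: rest_def sect_defs char2_simps)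

lemma square_add: "(a + b)\<^sup>2 = a\<^sup>2 + (b\<^sup>2 :: 'f)"
  by (simp add: char2_simps)

text \<open>Summands with a pole in \<open>x\<close> alone or in \<open>y\<close> alone live on one
  chart and will be absorbed. What survives is \<open>1/(xy)\<close>, \<open>z^3/(x^4 y)\<close> and
  \<open>z^3/(x^2 y^2) + z/(xy)\<close>.\<close>

lemma eta_multiples:
  "(1 / (x * y))\<^sup>2 * (x * y) = 1 / (x * y)"
  "(z ^ 3 / (x ^ 4 * y))\<^sup>2 * (x * y)
     = z ^ 3 / (x ^ 4 * y) + (y\<^sup>2 * z ^ 3 + x * z ^ 4 + t * x\<^sup>2 * y * z\<^sup>2) / x ^ 7"
  "(1 / (x * y))\<^sup>2 * J = y / x\<^sup>2 + x / y\<^sup>2"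
  "(z ^ 3 / (x ^ 4 * y))\<^sup>2 * J = z ^ 3 / (x\<^sup>2 * y\<^sup>2) + z / (x * y) + rest / x ^ 8"
proof -
  show "(1 / (x * y))\<^sup>2 * (x * y) = 1 / (x * y)"
    using x_nz y_nz by (simp add: power2_eq_square)
  have "(z ^ 3 / (x ^ 4 * y))\<^sup>2 * (x * y) = z ^ 6 / (x ^ 7 * y)"
    using x_nz y_nz by (simp add: field_simps numeral_eq_Suc)
  also have "z ^ 6 = x ^ 3 * z ^ 3 + y * (y\<^sup>2 * z ^ 3 + x * z ^ 4 + t * x\<^sup>2 * y * z\<^sup>2)"
    using z6_cube by (metis add_self_left add.commute)
  also have "\<dots> / (x ^ 7 * y) =
      z ^ 3 / (x ^ 4 * y) + (y\<^sup>2 * z ^ 3 + x * z ^ 4 + t * x\<^sup>2 * y * z\<^sup>2) / x ^ 7"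
    using x_nz y_nz by (simp add: add_divide_distrib) (simp add: field_simps numeral_eq_Suc)
  finally show "(z ^ 3 / (x ^ 4 * y))\<^sup>2 * (x * y)
     = z ^ 3 / (x ^ 4 * y) + (y\<^sup>2 * z ^ 3 + x * z ^ 4 + t * x\<^sup>2 * y * z\<^sup>2) / x ^ 7" .
  show "(1 / (x * y))\<^sup>2 * J = y / x\<^sup>2 + x / y\<^sup>2"
    using x_nz y_nz by (simp add: J_def field_simps numeral_eq_Suc)
  have "(z ^ 3 / (x ^ 4 * y))\<^sup>2 * J = (J * z ^ 6) / (x ^ 8 * y\<^sup>2)"
    using x_nz y_nz by (simp add: field_simps numeral_eq_Suc)
  also have "\<dots> = z ^ 3 / (x\<^sup>2 * y\<^sup>2) + z / (x * y) + rest / x ^ 8"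
    unfolding J_z6 using x_nz y_nz
    by (simp add: add_divide_distrib) (simp add: field_simps numeral_eq_Suc)
  finally show "(z ^ 3 / (x ^ 4 * y))\<^sup>2 * J
    = z ^ 3 / (x\<^sup>2 * y\<^sup>2) + z / (x * y) + rest / x ^ 8" .
qed

text \<open>Up to one-chart terms \<open>g\<close> is \<open>z^3/(x^2 y^2) + z/(xy)\<close>. The
  three equations say that this multiple of the Koszul syzygy \<open>(y^2, x^2, 0)\<close> is
  cohomologous to \<open>(k + 1)/(xy)\<close> times \<open>(c1, c2, J)\<close>; the corrections are
  multiples of \<open>(D, 0, x^2)\<close> over one chart and of \<open>(0, D, y^2)\<close> over the
  other.\<close>

lemma koszul_core:
  fixes k
  defines "D \<equiv> z\<^sup>2 + k * x * y"
  defines "g \<equiv> z ^ 3 / (x\<^sup>2 * y\<^sup>2) + z / (x * y) + (k + 1) * (D / x ^ 3 + (z\<^sup>2 / y ^ 3 + k * x / y\<^sup>2))"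
  shows "(k + 1) / (x * y) * c1 k + g * y\<^sup>2 + (z / x\<^sup>2 + (k + 1) * y\<^sup>2 / x ^ 3) * D = 0"
    and "(k + 1) / (x * y) * c2 k + g * x\<^sup>2 + (z / y\<^sup>2 + (k + 1) * x\<^sup>2 / y ^ 3) * D = 0"
    and "(k + 1) / (x * y) * J + (z / x\<^sup>2 + (k + 1) * y\<^sup>2 / x ^ 3) * x\<^sup>2
           + (z / y\<^sup>2 + (k + 1) * x\<^sup>2 / y ^ 3) * y\<^sup>2 = 0"
proof -
  have gen: "(u * a + v * b + w * c) * m = (u * m) * a + (v * m) * b + (w * m) * c"
    for u v w a b c m :: 'f by (simp add: algebra_simps)
  have mult: "a = 0" if "a * (x ^ 3 * y ^ 3) = 0" for a using that x_nz y_nz by simp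
  have g: "g * (x ^ 3 * y ^ 3) = z ^ 3 * x * y + z * x\<^sup>2 * y\<^sup>2
      + (k + 1) * (D * y ^ 3 + z\<^sup>2 * x ^ 3 + k * x ^ 4 * y)"
    unfolding g_def using x_nz y_nz
    by (simp add: distrib_right distrib_left) (simp add: field_simps numeral_eq_Suc)
  have zx: "(z / x\<^sup>2 + (k + 1) * y\<^sup>2 / x ^ 3) * (x ^ 3 * y ^ 3) = z * x * y ^ 3 + (k + 1) * y ^ 5"
    using x_nz y_nz
    by (simp add: distrib_right) (simp add: field_simps numeral_eq_Suc)
  have zy: "(z / y\<^sup>2 + (k + 1) * x\<^sup>2 / y ^ 3) * (x ^ 3 * y ^ 3) = z * y * x ^ 3 + (k + 1) * x ^ 5"
    using x_nz y_nz
    by (simp add: distrib_right) (simp add: field_simps numeral_eq_Suc)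
  have kk: "(k + 1) / (x * y) * (x ^ 3 * y ^ 3) = (k + 1) * x\<^sup>2 * y\<^sup>2"
    using x_nz y_nz by (simp add: field_simps numeral_eq_Suc)
  have "((k + 1) / (x * y) * c1 k + g * y\<^sup>2 + (z / x\<^sup>2 + (k + 1) * y\<^sup>2 / x ^ 3) * D) * (x ^ 3 * y ^ 3)
    = ((k + 1) / (x * y) * (x ^ 3 * y ^ 3)) * c1 k + (g * (x ^ 3 * y ^ 3)) * y\<^sup>2
      + ((z / x\<^sup>2 + (k + 1) * y\<^sup>2 / x ^ 3) * (x ^ 3 * y ^ 3)) * D"
    by (rule gen)
  also have "\<dots> = 0" unfolding g zx kk by (simp add: c1_def D_def char2_simps)
  finally show "(k + 1) / (x * y) * c1 k + g * y\<^sup>2 + (z / x\<^sup>2 + (k + 1) * y\<^sup>2 / x ^ 3) * D = 0"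
    by (rule mult)
  have "((k + 1) / (x * y) * c2 k + g * x\<^sup>2 + (z / y\<^sup>2 + (k + 1) * x\<^sup>2 / y ^ 3) * D) * (x ^ 3 * y ^ 3)
    = ((k + 1) / (x * y) * (x ^ 3 * y ^ 3)) * c2 k + (g * (x ^ 3 * y ^ 3)) * x\<^sup>2
      + ((z / y\<^sup>2 + (k + 1) * x\<^sup>2 / y ^ 3) * (x ^ 3 * y ^ 3)) * D"
    by (rule gen)
  also have "\<dots> = 0" unfolding g zy kk by (simp add: c2_def D_def char2_simps)
  finally show "(k + 1) / (x * y) * c2 k + g * x\<^sup>2 + (z / y\<^sup>2 + (k + 1) * x\<^sup>2 / y ^ 3) * D = 0"
    by (rule mult)
  have "((k + 1) / (x * y) * J + (z / x\<^sup>2 + (k + 1) * y\<^sup>2 / x ^ 3) * x\<^sup>2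
           + (z / y\<^sup>2 + (k + 1) * x\<^sup>2 / y ^ 3) * y\<^sup>2) * (x ^ 3 * y ^ 3)
    = ((k + 1) / (x * y) * (x ^ 3 * y ^ 3)) * J
      + ((z / x\<^sup>2 + (k + 1) * y\<^sup>2 / x ^ 3) * (x ^ 3 * y ^ 3)) * x\<^sup>2
      + ((z / y\<^sup>2 + (k + 1) * x\<^sup>2 / y ^ 3) * (x ^ 3 * y ^ 3)) * y\<^sup>2"
    by (rule gen)
  also have "\<dots> = 0" unfolding zx zy kk by (simp add: J_def char2_simps)
  finally show "(k + 1) / (x * y) * J + (z / x\<^sup>2 + (k + 1) * y\<^sup>2 / x ^ 3) * x\<^sup>2
           + (z / y\<^sup>2 + (k + 1) * x\<^sup>2 / y ^ 3) * y\<^sup>2 = 0" by (rule mult)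
qed

text \<open>After \<open>wedge_square\<close> the Koszul part feeds \<open>B^2\<close> into
  \<open>A'\<close> through \<open>koszul_core\<close>, while \<open>B'\<close> arises from
  \<open>B^2\<close> by the factor \<open>k\<close> alone. So a nonzero \<open>B\<close> stays
  nonzero as long as \<open>k\<close> does.\<close>

lemma splits_step:
  assumes k: "k = t + l\<^sup>2" "k \<in> Rx" "k \<in> Ry"
    and mem: "A \<in> Rx" "A \<in> Ry" "B \<in> Rx" "B \<in> Ry" "c \<in> Rx" "c \<in> Ry"
    and sp: "splits (x ^ 4) (y ^ 4) ((z\<^sup>2 + l * x * y)\<^sup>2)
      (c * (eta A B)\<^sup>2 * (c1 l)\<^sup>2) (c * (eta A B)\<^sup>2 * (c2 l)\<^sup>2) (c * (eta A B)\<^sup>2 * J\<^sup>2)"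
  defines "A' \<equiv> k * A\<^sup>2 + (t + k\<^sup>2) * (k + 1) * B\<^sup>2" and "B' \<equiv> k * B\<^sup>2"
  shows "splits (x\<^sup>2) (y\<^sup>2) (z\<^sup>2 + k * x * y)
    (c * eta A' B' * c1 k) (c * eta A' B' * c2 k) (c * eta A' B' * J)"
proof -
  define D where "D = z\<^sup>2 + k * x * y"
  define \<theta> where "\<theta> = t + k\<^sup>2"
  define e where "e = 1 / (x * y)"
  define f where "f = z ^ 3 / (x ^ 4 * y)"
  define r where "r = (y\<^sup>2 * z ^ 3 + x * z ^ 4 + t * x\<^sup>2 * y * z\<^sup>2) / x ^ 7"
  define q where "q = y / x\<^sup>2"
  define q' where "q' = x / y\<^sup>2"
  define n where "n = z ^ 3 / (x\<^sup>2 * y\<^sup>2) + z / (x * y)"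
  define \<rho> where "\<rho> = rest / x ^ 8"
  define m where "m = z / x\<^sup>2 + (k + 1) * y\<^sup>2 / x ^ 3"
  define m' where "m' = z / y\<^sup>2 + (k + 1) * x\<^sup>2 / y ^ 3"
  define d where "d = D / x ^ 3"
  define d' where "d' = z\<^sup>2 / y ^ 3 + k * x / y\<^sup>2"
  have l: "l\<^sup>2 = k + t" by (simp add: k algebra_simps add_self add_self_left)
  have D2: "(z\<^sup>2 + l * x * y)\<^sup>2 = z ^ 4 + l\<^sup>2 * x\<^sup>2 * y\<^sup>2"
    by (simp add: square_add power_mult_distrib flip: power_mult)
  have wedge: "splits (x\<^sup>2) (y\<^sup>2) D
     (c * (eta A B)\<^sup>2 * (k * x * y * c1 k + \<theta> * J * y\<^sup>2))
     (c * (eta A B)\<^sup>2 * (k * x * y * c2 k + \<theta> * J * x\<^sup>2))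
     (c * (eta A B)\<^sup>2 * (k * x * y * J))"
  proof -
    have "(c * (eta A B)\<^sup>2 * (c2 l)\<^sup>2 * s + s' * (c * (eta A B)\<^sup>2 * J\<^sup>2)) / x ^ 4
      = c * (eta A B)\<^sup>2 * w" if "(c2 l)\<^sup>2 * s + s' * J\<^sup>2 = x ^ 4 * w" for s s' w
    proof -
      have "c * (eta A B)\<^sup>2 * (c2 l)\<^sup>2 * s + s' * (c * (eta A B)\<^sup>2 * J\<^sup>2)
        = c * (eta A B)\<^sup>2 * ((c2 l)\<^sup>2 * s + s' * J\<^sup>2)"
        by (simp only: distrib_left distrib_right mult_ac)
      thus ?thesis using x_nz that by simp
    qed
    note eqs = this[OF wedge_square(1)[OF k(1)]] this[OF wedge_square(2)[OF k(1)]]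
      this[OF wedge_square(3)[OF k(1)]]
    show ?thesis
      using splits_wedge[OF l k(2,3) sp[unfolded D2]] unfolding eqs \<theta>_def D_def .
  qed
  have sq: "(eta A B)\<^sup>2 * (k * x * y * s + \<theta> * J * s')
     = k * (A\<^sup>2 * e + B\<^sup>2 * (f + r)) * s + \<theta> * (A\<^sup>2 * (q + q') + B\<^sup>2 * (n + \<rho>)) * s'" for s s'
  proof -
    have "eta A B = A * e + B * f" by (simp add: e_def f_def)
    hence "(eta A B)\<^sup>2 = A\<^sup>2 * e\<^sup>2 + B\<^sup>2 * f\<^sup>2" by (simp add: square_add power_mult_distrib)
    hence "(eta A B)\<^sup>2 * (k * x * y * s + \<theta> * J * s')
      = k * (A\<^sup>2 * (e\<^sup>2 * (x * y)) + B\<^sup>2 * (f\<^sup>2 * (x * y))) * s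
        + \<theta> * (A\<^sup>2 * (e\<^sup>2 * J) + B\<^sup>2 * (f\<^sup>2 * J)) * s'"
      by (simp add: algebra_simps)
    thus ?thesis using eta_multiples
      by (simp only: e_def f_def r_def q_def q'_def n_def \<rho>_def)
  qed
  define P where "P = c * (A\<^sup>2 * \<theta> * q + B\<^sup>2 * \<theta> * \<rho> + B\<^sup>2 * \<theta> * (k + 1) * d)"
  define P' where "P' = c * (A\<^sup>2 * \<theta> * q' + B\<^sup>2 * \<theta> * (k + 1) * d')"
  define M where "M = c * B\<^sup>2 * \<theta> * m"
  define M' where "M' = c * B\<^sup>2 * \<theta> * m'"
  define N where "N = c * B\<^sup>2 * k * r"
  have memx: "P \<in> Rx" "M \<in> Rx" "N \<in> Rx" "D \<in> Rx"
    unfolding P_def M_def N_def \<theta>_def q_def \<rho>_def rest_def d_def m_def r_def D_def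
    by (intro Rx_intros k mem sect_Rx)+
  have memy: "P' \<in> Ry" "M' \<in> Ry" "D \<in> Ry"
    unfolding P'_def M'_def \<theta>_def q'_def d'_def m'_def D_def
    by (intro Ry_intros k mem)+
  \<comment> \<open>One-chart corrections: \<open>P\<close> and \<open>M\<close> multiply Koszul
    syzygies, \<open>N\<close> multiplies the section \<open>(c1, c2, J)\<close> itself.\<close>
  have spx: "splits (x\<^sup>2) (y\<^sup>2) D (P * y\<^sup>2 + M * D + N * c1 k) (P * x\<^sup>2 + N * c2 k) (M * x\<^sup>2 + N * J)"
  proof (rule splits_x)
    have "(P * y\<^sup>2 + M * D + N * c1 k) * x\<^sup>2 + (P * x\<^sup>2 + N * c2 k) * y\<^sup>2 + (M * x\<^sup>2 + N * J) * D
      = N * (x\<^sup>2 * c1 k + y\<^sup>2 * c2 k + D * J)"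
      by (simp add: algebra_simps add_self add_self_left)
    thus "(P * y\<^sup>2 + M * D + N * c1 k) * x\<^sup>2 + (P * x\<^sup>2 + N * c2 k) * y\<^sup>2 + (M * x\<^sup>2 + N * J) * D = 0"
      using relation_c by (simp add: D_def)
  qed (intro Rx_intros memx sect_Rx k)+
  have spy: "splits (x\<^sup>2) (y\<^sup>2) D (P' * y\<^sup>2) (P' * x\<^sup>2 + M' * D) (M' * y\<^sup>2)"
  proof (rule splits_y)
    show "P' * y\<^sup>2 * x\<^sup>2 + (P' * x\<^sup>2 + M' * D) * y\<^sup>2 + M' * y\<^sup>2 * D = 0"
      by (simp add: algebra_simps add_self add_self_left)
  qed (intro Ry_intros memy)+
  have target: "c * eta A' B' * s = c * (eta A B)\<^sup>2 * (k * x * y * s + \<theta> * J * s')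
      + ((P * s' + M * w + N * s) + (P' * s' + M' * w'))"
    if core: "(k + 1) * e * s + (n + (k + 1) * (d + d')) * s' + m * w + m' * w' = 0" for s s' w w'
  proof -
    have "eta A' B' = A' * e + B' * f" by (simp add: e_def f_def)
    hence "c * eta A' B' * s = c * (eta A B)\<^sup>2 * (k * x * y * s + \<theta> * J * s')
      + ((P * s' + M * w + N * s) + (P' * s' + M' * w'))
      + c * \<theta> * B\<^sup>2 * ((k + 1) * e * s + (n + (k + 1) * (d + d')) * s' + m * w + m' * w')"
      unfolding mult.assoc[of c "(eta A B)\<^sup>2"] sq
        A'_def B'_def \<theta>_def[symmetric] P_def P'_def M_def M'_def N_def
      by (simp add: algebra_simps add_self add_self_left)
    thus ?thesis using core by simp
  qed
  have ek: "(k + 1) * e = (k + 1) / (x * y)" by (simp add: e_def)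
  have g: "n + (k + 1) * (d + d') = z ^ 3 / (x\<^sup>2 * y\<^sup>2) + z / (x * y)
      + (k + 1) * ((z\<^sup>2 + k * x * y) / x ^ 3 + (z\<^sup>2 / y ^ 3 + k * x / y\<^sup>2))"
    by (simp only: n_def d_def d'_def D_def)
  have "c * eta A' B' * c1 k = c * (eta A B)\<^sup>2 * (k * x * y * c1 k + \<theta> * J * y\<^sup>2)
      + ((P * y\<^sup>2 + M * D + N * c1 k) + (P' * y\<^sup>2 + M' * 0))"
    by (rule target) (use koszul_core(1)[of k] in
      \<open>simp only: ek g m_def m'_def D_def mult_zero_right add_0_right\<close>)
  moreover have "c * eta A' B' * c2 k = c * (eta A B)\<^sup>2 * (k * x * y * c2 k + \<theta> * J * x\<^sup>2)
      + ((P * x\<^sup>2 + M * 0 + N * c2 k) + (P' * x\<^sup>2 + M' * D))"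
    by (rule target) (use koszul_core(2)[of k] in
      \<open>simp only: ek g m_def m'_def D_def mult_zero_right add_0_right\<close>)
  moreover have "c * eta A' B' * J = c * (eta A B)\<^sup>2 * (k * x * y * J + \<theta> * J * 0)
      + ((P * 0 + M * x\<^sup>2 + N * J) + (P' * 0 + M' * y\<^sup>2))"
    by (rule target) (use koszul_core(3)[of k] in
      \<open>simp only: ek g m_def m'_def D_def mult_zero_right add_0_right\<close>)
  ultimately show ?thesis
    using splits_add[OF wedge splits_add[OF spx spy]] by (simp add: D_def)
qed

lemma z6: "z ^ 6 = J * z ^ 3 + (1 + t) * x\<^sup>2 * y\<^sup>2 * z\<^sup>2 + x * y * J * z + t * x ^ 3 * y ^ 3"
  by (rule eqI_mod_quartic[where h = "z\<^sup>2 + x * y"]) (simp add: J_def char2_simps)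

definition rest' :: 'f where
  "rest' = x ^ 6 * rest + y ^ 4 * (x ^ 6 * z ^ 3 + x ^ 7 * y * z + y\<^sup>2 * rest)
     + J * ((1 + t)\<^sup>2 * x ^ 4 * y\<^sup>2 * z ^ 4 + x\<^sup>2 * J\<^sup>2 * z\<^sup>2 + t\<^sup>2 * x ^ 6 * y ^ 4)"

lemma J_z12: "J * z ^ 12 = x ^ 12 * z ^ 3 + x ^ 13 * y * z + y\<^sup>2 * rest'"
proof -
  have "z ^ 12 = (z ^ 6)\<^sup>2" by simp
  also have "\<dots> = J\<^sup>2 * z ^ 6 + (1 + t)\<^sup>2 * x ^ 4 * y ^ 4 * z ^ 4 + x\<^sup>2 * y\<^sup>2 * J\<^sup>2 * z\<^sup>2
      + t\<^sup>2 * x ^ 6 * y ^ 6"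
    by (subst z6) (simp only: square_add power_mult_distrib flip: power_mult, simp)
  finally have "J * z ^ 12 = J\<^sup>2 * (J * z ^ 6) + J * ((1 + t)\<^sup>2 * x ^ 4 * y ^ 4 * z ^ 4
      + x\<^sup>2 * y\<^sup>2 * J\<^sup>2 * z\<^sup>2 + t\<^sup>2 * x ^ 6 * y ^ 6)"
    by (simp only: distrib_left mult_ac add_ac)
  moreover have "J\<^sup>2 * (J * z ^ 6) = (x ^ 6 + y ^ 6) * (x ^ 6 * z ^ 3 + x ^ 7 * y * z + y\<^sup>2 * rest)"
    unfolding J_z6 by (simp add: J_def square_add flip: power_mult)
  ultimately show ?thesis by (simp add: rest'_def algebra_simps numeral_eq_Suc)
qed

text \<open>The fourth power against \<open>J x^2 y^2\<close> leaves the same class as the square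
  against \<open>J\<close>, only with another one-chart remainder.\<close>

lemma eta_multiples':
  "(1 / (x * y)) ^ 4 * (J * x\<^sup>2 * y\<^sup>2) = y / x\<^sup>2 + x / y\<^sup>2"
  "(z ^ 3 / (x ^ 4 * y)) ^ 4 * (J * x\<^sup>2 * y\<^sup>2)
     = z ^ 3 / (x\<^sup>2 * y\<^sup>2) + z / (x * y) + rest' / x ^ 14"
proof -
  show "(1 / (x * y)) ^ 4 * (J * x\<^sup>2 * y\<^sup>2) = y / x\<^sup>2 + x / y\<^sup>2"
    using x_nz y_nz by (simp add: J_def field_simps numeral_eq_Suc)
  have "(z ^ 3 / (x ^ 4 * y)) ^ 4 * (J * x\<^sup>2 * y\<^sup>2) = (J * z ^ 12) / (x ^ 14 * y\<^sup>2)"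
    using x_nz y_nz by (simp add: field_simps numeral_eq_Suc)
  also have "\<dots> = z ^ 3 / (x\<^sup>2 * y\<^sup>2) + z / (x * y) + rest' / x ^ 14"
    unfolding J_z12 using x_nz y_nz
    by (simp add: add_divide_distrib) (simp add: field_simps numeral_eq_Suc)
  finally show "(z ^ 3 / (x ^ 4 * y)) ^ 4 * (J * x\<^sup>2 * y\<^sup>2)
    = z ^ 3 / (x\<^sup>2 * y\<^sup>2) + z / (x * y) + rest' / x ^ 14" .
qed

text \<open>The syzygy that destabilises the Frobenius pullback once \<open>k\<^sup>2 = t\<close>.\<close>

lemma destabilising_relation:
  assumes "k = t + l\<^sup>2" "k\<^sup>2 = t"
  shows "a2 * x ^ 8 + b1 * y ^ 8 + J * (z\<^sup>2 + l * x * y) ^ 4 = 0"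
    and "(c2 l) ^ 4 * J + b1 * J ^ 4 = x ^ 8 * (t * (J * x\<^sup>2 * y\<^sup>2))"
proof -
  have "(z\<^sup>2 + l * x * y)\<^sup>2 = z ^ 4 + l\<^sup>2 * x\<^sup>2 * y\<^sup>2"
    by (simp add: square_add power_mult_distrib flip: power_mult)
  also have "\<dots> = x * y * z\<^sup>2 + J * z + k * x\<^sup>2 * y\<^sup>2"
    by (rule eqI_mod_quartic[where h = 1]) (simp add: J_def assms(1) char2_simps)
  finally have "((z\<^sup>2 + l * x * y)\<^sup>2)\<^sup>2 = (x * y * z\<^sup>2 + J * z + k * x\<^sup>2 * y\<^sup>2)\<^sup>2"
    by (simp only:)
  also have "\<dots> = x\<^sup>2 * y\<^sup>2 * z ^ 4 + J\<^sup>2 * z\<^sup>2 + t * x ^ 4 * y ^ 4"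
    by (simp only: square_add power_mult_distrib assms(2) flip: power_mult) simp
  finally have D4: "(z\<^sup>2 + l * x * y) ^ 4 = x\<^sup>2 * y\<^sup>2 * z ^ 4 + J\<^sup>2 * z\<^sup>2 + t * x ^ 4 * y ^ 4"
    by (simp flip: power_mult)
  show "a2 * x ^ 8 + b1 * y ^ 8 + J * (z\<^sup>2 + l * x * y) ^ 4 = 0"
    unfolding D4
    by (rule eqI_mod_quartic[where h = "J * x\<^sup>2 * y\<^sup>2"]) (simp add: sect_defs char2_simps)
  have 1: "(c2 l)\<^sup>2 = J * c1 k + k * x ^ 5 * y"
  proof -
    have "(c2 l)\<^sup>2 = y\<^sup>2 * z ^ 4 + x ^ 4 * z\<^sup>2 + l\<^sup>2 * x\<^sup>2 * y ^ 4"
      by (simp add: c2_def square_add power_mult_distrib flip: power_mult)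
    also have "\<dots> = J * c1 k + k * x ^ 5 * y"
      by (rule eqI_mod_quartic[where h = "y\<^sup>2"]) (simp add: sect_defs assms(1) char2_simps)
    finally show ?thesis .
  qed
  have 2: "(c1 k)\<^sup>2 = b1 * J"
    using wedge13[of k] assms(2) by (simp add: add_self power2_eq_square add_eq_0_iff)
  have "(c2 l) ^ 4 = ((c2 l)\<^sup>2)\<^sup>2" by simp
  also have "\<dots> = J\<^sup>2 * (b1 * J) + t * x ^ 10 * y\<^sup>2"
    by (simp only: 1 2 square_add power_mult_distrib assms(2) flip: power_mult) simp
  finally have "(c2 l) ^ 4 = J\<^sup>2 * (b1 * J) + t * x ^ 10 * y\<^sup>2" .
  thus "(c2 l) ^ 4 * J + b1 * J ^ 4 = x ^ 8 * (t * (J * x\<^sup>2 * y\<^sup>2))"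
    by (simp only:) (simp add: char2_simps)
qed

text \<open>Wedging with the syzygy \<open>(a2, b1, J)\<close> maps the second Frobenius pullback to
  a line bundle, so the splitting becomes membership of a single element in \<open>Rx + Ry\<close>.
  The \<open>A\<close> part contributes one-chart terms only.\<close>

lemma splits_end:
  assumes k: "k = t + l\<^sup>2" "k\<^sup>2 = t"
    and mem: "A \<in> Rx" "A \<in> Ry" "B \<in> Rx" "B \<in> Ry" "c \<in> Rx" "c \<in> Ry"
    and sp: "splits (x ^ 8) (y ^ 8) ((z\<^sup>2 + l * x * y) ^ 4)
      (c * (eta A B) ^ 4 * (c1 l) ^ 4) (c * (eta A B) ^ 4 * (c2 l) ^ 4) (c * (eta A B) ^ 4 * J ^ 4)"
  shows "\<exists>u\<in>Rx. \<exists>v\<in>Ry. c * t * B ^ 4 * (z ^ 3 / (x\<^sup>2 * y\<^sup>2) + z / (x * y)) = u + v"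
proof -
  obtain p q r p' q' r' where mem': "p \<in> Rx" "q \<in> Rx" "r \<in> Rx" "p' \<in> Ry" "q' \<in> Ry" "r' \<in> Ry"
     and rel: "p * x ^ 8 + q * y ^ 8 + r * (z\<^sup>2 + l * x * y) ^ 4 = 0"
     and rel': "p' * x ^ 8 + q' * y ^ 8 + r' * (z\<^sup>2 + l * x * y) ^ 4 = 0"
     and eq: "c * (eta A B) ^ 4 * (c1 l) ^ 4 = p + p'" "c * (eta A B) ^ 4 * (c2 l) ^ 4 = q + q'"
       "c * (eta A B) ^ 4 * J ^ 4 = r + r'"
    using sp by (rule splitsE)
  define D where "D = (z\<^sup>2 + l * x * y) ^ 4"
  have "y ^ 8 * (q' * J + b1 * r') + x ^ 8 * (p' * J + a2 * r') =
    J * (p' * x ^ 8 + q' * y ^ 8 + r' * D) + r' * (a2 * x ^ 8 + b1 * y ^ 8 + J * D)"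
    by (simp add: algebra_simps add_self add_self_left)
  also have "\<dots> = 0" using rel' destabilising_relation(1)[OF k] by (simp add: D_def)
  finally have "y ^ 8 * (q' * J + b1 * r') = x ^ 8 * (p' * J + a2 * r')"
    by (simp only: add_eq_0_iff)
  hence swap: "(q' * J + b1 * r') / x ^ 8 = (p' * J + a2 * r') / y ^ 8"
    using x_nz y_nz by (simp add: frac_eq_eq mult.commute)
  define e where "e = 1 / (x * y)"
  define f where "f = z ^ 3 / (x ^ 4 * y)"
  have "eta A B ^ 4 = ((A * e + B * f)\<^sup>2)\<^sup>2" by (simp add: e_def f_def)
  also have "\<dots> = A ^ 4 * e ^ 4 + B ^ 4 * f ^ 4"
    by (simp only: square_add power_mult_distrib flip: power_mult) simp
  finally have eta4: "eta A B ^ 4 = A ^ 4 * e ^ 4 + B ^ 4 * f ^ 4" .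
  have "(q * J + b1 * r) / x ^ 8 + (q' * J + b1 * r') / x ^ 8
    = ((q + q') * J + b1 * (r + r')) / x ^ 8"
    unfolding add_divide_distrib[symmetric] by (simp add: algebra_simps)
  also have "\<dots> = c * (eta A B) ^ 4 * ((c2 l) ^ 4 * J + b1 * J ^ 4) / x ^ 8"
    unfolding eq[symmetric] by (simp only: distrib_left mult_ac)
  also have "\<dots> = c * t * ((eta A B) ^ 4 * (J * x\<^sup>2 * y\<^sup>2))"
    unfolding destabilising_relation(2)[OF k] using x_nz by simp
  also have "\<dots> = c * t * (A ^ 4 * (e ^ 4 * (J * x\<^sup>2 * y\<^sup>2)) + B ^ 4 * (f ^ 4 * (J * x\<^sup>2 * y\<^sup>2)))"
    unfolding eta4 by (simp only: distrib_left distrib_right mult_ac)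
  also have "\<dots> = c * t * B ^ 4 * (z ^ 3 / (x\<^sup>2 * y\<^sup>2) + z / (x * y))
     + (c * t * A ^ 4 * (y / x\<^sup>2) + c * t * B ^ 4 * (rest' / x ^ 14)) + c * t * A ^ 4 * (x / y\<^sup>2)"
    unfolding e_def f_def eta_multiples' by (simp only: distrib_left add_ac mult_ac)
  finally have sum: "(q * J + b1 * r) / x ^ 8 + (p' * J + a2 * r') / y ^ 8
    = c * t * B ^ 4 * (z ^ 3 / (x\<^sup>2 * y\<^sup>2) + z / (x * y))
     + (c * t * A ^ 4 * (y / x\<^sup>2) + c * t * B ^ 4 * (rest' / x ^ 14)) + c * t * A ^ 4 * (x / y\<^sup>2)"
    unfolding swap .
  have "s = (u + v) + (u' + v')" if "u + u' = s + v + v'" for s u v u' v' :: 'f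
  proof -
    have "(u + v) + (u' + v') = (u + u') + v + v'" by (simp add: algebra_simps)
    also have "\<dots> = s" unfolding that by (simp add: add_self add_self_left algebra_simps)
    finally show ?thesis by (rule sym)
  qed
  note this[OF sum]
  moreover have "(q * J + b1 * r) / x ^ 8
      + (c * t * A ^ 4 * (y / x\<^sup>2) + c * t * B ^ 4 * (rest' / x ^ 14)) \<in> Rx"
    unfolding rest'_def rest_def by (intro Rx_intros sect_Rx mem mem')
  moreover have "(p' * J + a2 * r') / y ^ 8 + c * t * A ^ 4 * (x / y\<^sup>2) \<in> Ry"
    by (intro Ry_intros sect_Ry mem mem')
  ultimately show ?thesis by blast
qed

end

context quartic_point
begin

lemma square_add: "(a + b)\<^sup>2 = a\<^sup>2 + (b\<^sup>2 :: 'f)"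
  by (simp add: char2_simps)

text \<open>Makes every identity of the locale available for the \<open>2^n\<close>-th powers of
  \<open>x\<close>, \<open>y\<close>, \<open>z\<close>, \<open>t\<close>.\<close>

lemma frobenius_square: "quartic_point (x\<^sup>2) (y\<^sup>2) (z\<^sup>2) (t\<^sup>2)"
proof
  have "(z\<^sup>2) ^ 4 + x\<^sup>2 * y\<^sup>2 * (z\<^sup>2)\<^sup>2 + ((x\<^sup>2) ^ 3 + (y\<^sup>2) ^ 3) * z\<^sup>2 + t\<^sup>2 * (x\<^sup>2)\<^sup>2 * (y\<^sup>2)\<^sup>2
    = Q\<^sup>2"
    by (simp add: square_add power_mult_distrib flip: power_mult)
  thus "(z\<^sup>2) ^ 4 + x\<^sup>2 * y\<^sup>2 * (z\<^sup>2)\<^sup>2 + ((x\<^sup>2) ^ 3 + (y\<^sup>2) ^ 3) * z\<^sup>2 + t\<^sup>2 * (x\<^sup>2)\<^sup>2 * (y\<^sup>2)\<^sup>2 = 0"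
    by (simp only: quartic) simp
qed (use char2 x_nz y_nz in simp_all)

end

subsection \<open>Total degree\<close>

text \<open>The arguments are the exponents of \<open>x\<close>, \<open>y\<close>, \<open>z\<close>
  in this order, whereas \<open>z\<close> is the outermost variable of the nesting.\<close>

definition coeff3 :: "'a::zero poly poly poly \<Rightarrow> nat \<Rightarrow> nat \<Rightarrow> nat \<Rightarrow> 'a" where
  "coeff3 p i j l = coeff (coeff (coeff p l) j) i"

lemma poly3_eqI: "(\<And>i j l. coeff3 p i j l = coeff3 q i j l) \<Longrightarrow> p = q"
  by (intro poly_eqI) (simp add: coeff3_def)

lemma coeff3_0 [simp]: "coeff3 0 i j l = 0"
  and coeff3_add [simp]: "coeff3 (p + q) i j l = coeff3 p i j l + coeff3 q i j l"
  for p q :: "'a::comm_ring_1 poly poly poly"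
  by (simp_all add: coeff3_def)

lemma coeff3_diff [simp]: "coeff3 (p - q) i j l = coeff3 p i j l - coeff3 q i j l"
  for p q :: "'a::comm_ring_1 poly poly poly"
  by (simp add: coeff3_def)

lemma coeff3_cst_mult [simp]: "coeff3 (cst c * p) i j l = c * coeff3 p i j l"
  by (simp add: coeff3_def cst_def)

lemma coeff3_map3: "f 0 = 0 \<Longrightarrow> coeff3 (map3 f p) i j l = f (coeff3 p i j l)"
  by (simp add: coeff3_def map3_def coeff_map_poly)

lemma coeff3_mult: "coeff3 (p * q) i j l =
  (\<Sum>l'\<le>l. \<Sum>j'\<le>j. \<Sum>i'\<le>i. coeff3 p i' j' l' * coeff3 q (i - i') (j - j') (l - l'))"
  for p q :: "'a::comm_ring_1 poly poly poly"
  by (simp add: coeff3_def coeff_mult coeff_sum)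

definition mon3 :: "nat \<Rightarrow> nat \<Rightarrow> nat \<Rightarrow> 'a::comm_ring_1 poly poly poly" where
  "mon3 i j l = px ^ i * py ^ j * pz ^ l"

lemma mono_mult: "mon3 i j l * mon3 i' j' l' = mon3 (i + i') (j + j') (l + l')"
  by (simp add: mon3_def power_add mult_ac)

lemma mono_eq: "mon3 i j l = monom (monom (monom (1::'a::comm_ring_1) i) j) l"
proof -
  have "px ^ i = [:[:monom (1::'a) i:]:]" for i
  proof (induction i)
    case 0
    show ?case by (simp add: one_pCons monom_0)
  qed (simp add: px_def monom_Suc)
  moreover have "py ^ j = [:monom (1::'a poly) j:]" for j
  proof (induction j)
    case 0
    show ?case by (simp add: one_pCons monom_0)
  qed (simp add: py_def monom_Suc)
  moreover have "pz ^ l = monom (1::'a poly poly) l" for l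
  proof (induction l)
    case 0
    show ?case by (simp add: one_pCons monom_0)
  qed (simp add: pz_def monom_Suc)
  ultimately show ?thesis by (simp add: mon3_def smult_monom)
qed

lemma coeff3_mono_mult:
  "coeff3 (mon3 a b c * p) i j l =
     (if a \<le> i \<and> b \<le> j \<and> c \<le> l then coeff3 p (i - a) (j - b) (l - c) else 0)"
  by (auto simp: coeff3_def mono_eq coeff_monom_mult)

lemma coeff3_mono: "coeff3 (mon3 a b c) i j l = (if a = i \<and> b = j \<and> c = l then 1 else 0)"
  by (auto simp: coeff3_def mono_eq)

lemma px_power: "px ^ n = mon3 n 0 0" and py_power: "py ^ n = mon3 0 n 0"
  and pz_power: "pz ^ n = mon3 0 0 n"
  by (simp_all add: mon3_def)

lemma quartic_mono: "quartic t = mon3 0 0 4 + mon3 1 1 2 + mon3 3 0 1 + mon3 0 3 1 + cst t * mon3 2 2 0"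
  by (simp add: quartic_def mon3_def algebra_simps)

definition tdeg_le :: "'a::zero poly poly poly \<Rightarrow> nat \<Rightarrow> bool" where
  "tdeg_le p d \<longleftrightarrow> (\<forall>i j l. coeff3 p i j l \<noteq> 0 \<longrightarrow> i + j + l \<le> d)"

lemma tdeg_le_add: "tdeg_le p d \<Longrightarrow> tdeg_le q d \<Longrightarrow> tdeg_le (p + q) d"
  for p q :: "'a::comm_ring_1 poly poly poly"
  unfolding tdeg_le_def coeff3_add by (metis add.right_neutral)

lemma tdeg_le_diff: "tdeg_le p d \<Longrightarrow> tdeg_le q d \<Longrightarrow> tdeg_le (p - q) d"
  for p q :: "'a::comm_ring_1 poly poly poly"
  unfolding tdeg_le_def coeff3_diff by (metis diff_0_right)

lemma tdeg_le_mult: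
  fixes p q :: "'a::comm_ring_1 poly poly poly"
  assumes "tdeg_le p d" "tdeg_le q e"
  shows "tdeg_le (p * q) (d + e)"
  unfolding tdeg_le_def
proof (intro allI impI)
  fix i j l assume "coeff3 (p * q) i j l \<noteq> 0"
  then obtain l' where l: "l' \<in> {..l}"
    and 1: "(\<Sum>j'\<le>j. \<Sum>i'\<le>i. coeff3 p i' j' l' * coeff3 q (i - i') (j - j') (l - l')) \<noteq> 0"
    unfolding coeff3_mult by (rule sum.not_neutral_contains_not_neutral)
  from 1 obtain j' where j: "j' \<in> {..j}"
    and 2: "(\<Sum>i'\<le>i. coeff3 p i' j' l' * coeff3 q (i - i') (j - j') (l - l')) \<noteq> 0"
    by (rule sum.not_neutral_contains_not_neutral)
  from 2 obtain i' where i: "i' \<in> {..i}" and "coeff3 p i' j' l' * coeff3 q (i - i') (j - j') (l - l') \<noteq> 0"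
    by (rule sum.not_neutral_contains_not_neutral)
  hence "coeff3 p i' j' l' \<noteq> 0" "coeff3 q (i - i') (j - j') (l - l') \<noteq> 0" by auto
  hence "i' + j' + l' \<le> d" "(i - i') + (j - j') + (l - l') \<le> e"
    using assms unfolding tdeg_le_def by blast+
  thus "i + j + l \<le> d + e" using i j l by simp
qed

lemma tdeg_le_mono: "a + b + c \<le> d \<Longrightarrow> tdeg_le (mon3 a b c) d"
  by (auto simp: tdeg_le_def coeff3_mono)

lemma tdeg_le_cst_mult: "tdeg_le p d \<Longrightarrow> tdeg_le (cst c * p) d"
  unfolding tdeg_le_def coeff3_cst_mult by (metis mult_zero_right)

lemma tdeg_le_mono_mult: "tdeg_le p e \<Longrightarrow> a + b + c + e \<le> d \<Longrightarrow> tdeg_le (mon3 a b c * p) d"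
  for p :: "'a::comm_ring_1 poly poly poly"
  using tdeg_le_mult[OF tdeg_le_mono[of a b c "d - e"], of p e] by auto

lemma tdeg_le_weaken: "tdeg_le p d \<Longrightarrow> d \<le> e \<Longrightarrow> tdeg_le p e"
  unfolding tdeg_le_def using order_trans by blast

lemma tdeg_le_exists: "\<exists>d. tdeg_le p d" for p :: "'a::comm_ring_1 poly poly poly"
proof -
  have poly1: "\<exists>d. \<forall>i. coeff q i \<noteq> 0 \<longrightarrow> i \<le> d" for q :: "'b::zero poly"
    by (intro exI[of _ "degree q"]) (auto intro: le_degree)
  have poly2: "\<exists>d. \<forall>i j. coeff (coeff q j) i \<noteq> 0 \<longrightarrow> i + j \<le> d" for q :: "'a poly poly"
  proof -
    define m where "m = (\<Sum>j\<le>degree q. degree (coeff q j))"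
    have "i + j \<le> m + degree q" if "coeff (coeff q j) i \<noteq> 0" for i j
    proof -
      have "j \<le> degree q" using that by (intro le_degree) auto
      moreover have "i \<le> degree (coeff q j)" using that by (rule le_degree)
      moreover have "degree (coeff q j) \<le> m"
        unfolding m_def using \<open>j \<le> degree q\<close> by (intro member_le_sum) auto
      ultimately show ?thesis by linarith
    qed
    thus ?thesis by blast
  qed
  then obtain D where D: "\<And>q i j. coeff (coeff q j) i \<noteq> (0::'a) \<longrightarrow> i + j \<le> D q" by metis
  define m where "m = (\<Sum>l\<le>degree p. D (coeff p l))"
  have "i + j + l \<le> m + degree p" if "coeff3 p i j l \<noteq> 0" for i j l
  proof -
    have "l \<le> degree p" using that by (intro le_degree) (auto simp: coeff3_def)
    moreover have "i + j \<le> D (coeff p l)" using that D by (simp add: coeff3_def)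
    moreover have "D (coeff p l) \<le> m"
      unfolding m_def using \<open>l \<le> degree p\<close> by (intro member_le_sum) auto
    ultimately show ?thesis by linarith
  qed
  thus ?thesis unfolding tdeg_le_def by blast
qed

lemma tdeg_le_quartic: "tdeg_le (quartic t) 4"
  unfolding quartic_mono by (intro tdeg_le_add tdeg_le_cst_mult tdeg_le_mono) simp_all

text \<open>Division by the quartic does not raise the total degree, because its leading power
  \<open>z^4\<close> already has the full total degree 4.\<close>

lemma quartic_normal_form:
  fixes p :: "'a::comm_ring_1 poly poly poly"
  assumes "tdeg_le p d"
  shows "\<exists>q r. p = quartic t * q + r \<and> degree r < 4 \<and> tdeg_le r d"
  using assms
proof (induction "degree p" arbitrary: p rule: less_induct)
  case (less p)
  show ?case
  proof (cases "degree p < 4")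
    case True
    thus ?thesis using less.prems by (intro exI[of _ 0] exI[of _ p]) auto
  next
    case False
    define n where "n = degree p"
    define m where "m = monom (lead_coeff p) (n - 4)"
    have n: "n \<ge> 4" using False by (simp add: n_def)
    have c: "coeff3 m i j l = (if l = n - 4 then coeff3 p i j n else 0)" for i j l
      by (simp add: m_def coeff3_def n_def)
    define p' where "p' = p - quartic t * m"
    have "tdeg_le (quartic t * m) d"
    proof (cases "p = 0")
      case True
      thus ?thesis by (simp add: m_def tdeg_le_def)
    next
      case False
      have md: "i + j + l + 4 \<le> d" if "coeff3 m i j l \<noteq> 0" for i j l
      proof -
        have "l = n - 4" "coeff3 p i j n \<noteq> 0" using that by (auto simp: c split: if_splits)
        hence "i + j + n \<le> d" using less.prems by (auto simp: tdeg_le_def)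
        thus ?thesis using n \<open>l = n - 4\<close> by linarith
      qed
      have "\<exists>i j. coeff3 m i j (n - 4) \<noteq> 0"
        using False by (intro exI[of _ "degree (lead_coeff (lead_coeff p))"]
            exI[of _ "degree (lead_coeff p)"]) (simp add: c, simp add: coeff3_def n_def)
      hence "4 \<le> d" using md by fastforce
      hence "tdeg_le m (d - 4)" using md unfolding tdeg_le_def by fastforce
      thus ?thesis using tdeg_le_mult[OF tdeg_le_quartic, of m "d - 4" t] \<open>4 \<le> d\<close> by simp
    qed
    hence td: "tdeg_le p' d" unfolding p'_def by (intro tdeg_le_diff less.prems)
    have "degree p' < n"
    proof -
      have "degree (quartic t * m) \<le> n"
        using degree_mult_le[of "quartic t" m] degree_monom_le[of "lead_coeff p" "n - 4"] n
        by (simp add: degree_quartic m_def)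
      hence "degree p' \<le> n" unfolding p'_def by (intro degree_diff_le) (simp_all add: n_def)
      moreover have "coeff (quartic t * m) n = lead_coeff (quartic t) * coeff m (n - 4)"
      proof -
        have "coeff (m * quartic t) n = lead_coeff p * coeff (quartic t) 4"
          using n by (simp add: m_def coeff_monom_mult)
        thus ?thesis using lead_coeff_quartic[of t] by (simp add: m_def degree_quartic mult.commute)
      qed
      hence "coeff p' n = 0" using lead_coeff_quartic[of t] by (simp add: p'_def n_def m_def)
      moreover have "degree p' \<noteq> n"
      proof
        assume "degree p' = n"
        with \<open>coeff p' n = 0\<close> have "p' = 0" by (metis leading_coeff_0_iff)
        with \<open>degree p' = n\<close> n show False by simp
      qed
      ultimately show ?thesis by simp
    qed
    then obtain q r where "p' = quartic t * q + r" "degree r < 4" "tdeg_le r d"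
      using less.hyps[OF _ td] unfolding n_def by blast
    thus ?thesis unfolding p'_def
      by (intro exI[of _ "q + m"] exI[of _ r]) (simp add: algebra_simps)
  qed
qed

lemma divide_px_power:
  fixes p :: "'a::comm_ring_1 poly poly poly"
  assumes zero: "\<And>i j l. i < n \<Longrightarrow> coeff3 p i j l = 0" and "tdeg_le p d"
  obtains q where "p = px ^ n * q" "tdeg_le q (d - n)"
proof -
  define q where "q = map_poly (map_poly (poly_shift n)) p"
  have c: "coeff3 q i j l = coeff3 p (i + n) j l" for i j l
    by (simp add: q_def coeff3_def coeff_map_poly coeff_poly_shift)
  have "p = px ^ n * q"
    by (rule poly3_eqI) (auto simp: px_power coeff3_mono_mult c zero not_le)
  moreover have "tdeg_le q (d - n)"
  proof -
    have "i + j + l \<le> d - n" if "coeff3 p (i + n) j l \<noteq> 0" for i j l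
    proof -
      have "i + n + j + l \<le> d" using assms(2) that unfolding tdeg_le_def by blast
      thus ?thesis by linarith
    qed
    thus ?thesis unfolding tdeg_le_def c by blast
  qed
  ultimately show thesis using that by blast
qed

text \<open>Monomials divisible by \<open>x^n\<close> go to \<open>a\<close>, of the others those
  divisible by \<open>y^n\<close> to \<open>b\<close>, the rest to \<open>c\<close>. Nothing
  cancels, which gives the degree bounds.\<close>

lemma monomial_ideal_decompose:
  fixes p :: "'a::comm_ring_1 poly poly poly"
  assumes zero: "\<And>i j l. i < n \<Longrightarrow> j < n \<Longrightarrow> l < n \<Longrightarrow> coeff3 p i j l = 0" and "tdeg_le p d"
  obtains a b c where "p = a * px ^ n + b * py ^ n + c * pz ^ n"
    "tdeg_le a (d - n)" "tdeg_le b (d - n)" "tdeg_le c (d - n)"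
proof -
  define a where "a = map_poly (map_poly (poly_shift n)) p"
  define b where "b = map_poly (poly_shift n) (map_poly (map_poly (poly_cutoff n)) p)"
  define c where "c = poly_shift n (map_poly (poly_cutoff n) (map_poly (map_poly (poly_cutoff n)) p))"
  have ca: "coeff3 a i j l = coeff3 p (i + n) j l" for i j l
    by (simp add: a_def coeff3_def coeff_map_poly coeff_poly_shift)
  have cb: "coeff3 b i j l = (if i < n then coeff3 p i (j + n) l else 0)" for i j l
    by (simp add: b_def coeff3_def coeff_map_poly coeff_poly_shift coeff_poly_cutoff)
  have cc: "coeff3 c i j l = (if i < n \<and> j < n then coeff3 p i j (l + n) else 0)" for i j l
    by (simp add: c_def coeff3_def coeff_map_poly coeff_poly_shift coeff_poly_cutoff)
  have "p = a * px ^ n + b * py ^ n + c * pz ^ n"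
    by (rule poly3_eqI)
       (auto simp: px_power py_power pz_power mult.commute[of _ "mon3 _ _ _"] coeff3_mono_mult
          ca cb cc zero not_le not_less)
  moreover have key: "i + j + l \<le> d" if "coeff3 p i j l \<noteq> 0" for i j l
    using assms(2) that unfolding tdeg_le_def by blast
  have "tdeg_le a (d - n)" "tdeg_le b (d - n)" "tdeg_le c (d - n)"
    unfolding tdeg_le_def ca cb cc
    by (intro allI impI, drule key, linarith)
       (intro allI impI, simp split: if_splits, drule key, linarith)+
  ultimately show thesis using that by blast
qed

subsection \<open>Syzygies of low degree\<close>

text \<open>The orbit of 0 under \<open>l \<mapsto> t + l^2\<close>, the change of parameter in one
  wedge map.\<close>

primrec lam :: "'a::comm_ring_1 \<Rightarrow> nat \<Rightarrow> 'a" where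
  "lam t 0 = 0"
| "lam t (Suc n) = t + (lam t n)\<^sup>2"

context
  fixes t :: "'k::{field,factorial_ring_gcd,semiring_gcd_mult_normalize}"
  assumes char: "CHAR('k) = 2" and t: "t \<noteq> 0"
begin

interpretation v: ring_map "ev t" by (rule ring_map_ev)

lemma ev_char2: "(1 :: 'k big) + 1 = 0"
proof -
  have "ev t (1 + 1) = 0" using char2_add_self[of "1 :: 'k poly poly poly"] char by (simp add: v.zero)
  thus ?thesis by (simp only: v.add v.one)
qed

lemma ev_nz: "ev t p = 0 \<Longrightarrow> degree p < 4 \<Longrightarrow> p = 0"
  by (rule ev_eq_0_imp_eq_0[OF char t])

lemma ev_gens_nz: "ev t px \<noteq> 0" "ev t py \<noteq> 0"
proof -
  have "degree (px :: 'k poly poly poly) < 4" "degree (py :: 'k poly poly poly) < 4"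
    "px \<noteq> (0 :: 'k poly poly poly)" "py \<noteq> (0 :: 'k poly poly poly)"
    by (simp_all add: px_def py_def)
  thus "ev t px \<noteq> 0" "ev t py \<noteq> 0" using ev_nz by blast+
qed

lemma quartic_point_ev: "quartic_point (ev t px) (ev t py) (ev t pz) (ev t (cst t))"
proof
  have "ev t (pz ^ 4 + px * py * pz\<^sup>2 + (px ^ 3 + py ^ 3) * pz + cst t * px\<^sup>2 * py\<^sup>2) = 0"
    using ev_quartic[of t] unfolding quartic_def .
  thus "ev t pz ^ 4 + ev t px * ev t py * (ev t pz)\<^sup>2 + (ev t px ^ 3 + ev t py ^ 3) * ev t pz
    + ev t (cst t) * (ev t px)\<^sup>2 * (ev t py)\<^sup>2 = 0"
    by (simp only: v.simps)
qed (fact ev_char2 ev_gens_nz)+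

lemma quartic_point_power:
  "quartic_point (ev t px ^ 2 ^ n) (ev t py ^ 2 ^ n) (ev t pz ^ 2 ^ n) (ev t (cst t) ^ 2 ^ n)"
proof (induction n)
  case 0
  show ?case using quartic_point_ev by simp
next
  case (Suc n)
  have "w ^ 2 ^ Suc n = (w ^ 2 ^ n)\<^sup>2" for w :: "'k big"
    by (metis mult.commute power_Suc power_mult)
  thus ?case using quartic_point.frobenius_square[OF Suc.IH] by simp
qed

lemma frobenius_add: "(a + b) ^ 2 ^ n = a ^ 2 ^ n + (b :: 'k big) ^ 2 ^ n"
proof (induction n)
  case (Suc n)
  have "w ^ 2 ^ Suc n = (w ^ 2 ^ n)\<^sup>2" for w :: "'k big"
    by (metis mult.commute power_Suc power_mult)
  thus ?case using Suc.IH quartic_point.square_add[OF quartic_point_ev] by simp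
qed simp

text \<open>A filtration instead of a grading: only upper bounds for degrees are used.\<close>

definition Rd :: "nat \<Rightarrow> 'k big set" where
  "Rd d = {ev t p | p. tdeg_le p d}"

lemma Rd_I: "tdeg_le p d \<Longrightarrow> a = ev t p \<Longrightarrow> a \<in> Rd d"
  unfolding Rd_def by blast

lemma Rd_E:
  assumes "a \<in> Rd d"
  obtains p where "a = ev t p" "tdeg_le p d"
  using assms unfolding Rd_def by blast

lemma Rd_add:
  assumes "a \<in> Rd d" "b \<in> Rd d"
  shows "a + b \<in> Rd d"
proof -
  obtain p where p: "a = ev t p" "tdeg_le p d" using assms(1) by (rule Rd_E)
  obtain q where q: "b = ev t q" "tdeg_le q d" using assms(2) by (rule Rd_E)
  show ?thesis by (rule Rd_I[OF tdeg_le_add[OF p(2) q(2)]]) (simp only: p q v.add)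
qed

lemma Rd_mult:
  assumes "a \<in> Rd d" "b \<in> Rd e" "d + e = f"
  shows "a * b \<in> Rd f"
proof -
  obtain p where p: "a = ev t p" "tdeg_le p d" using assms(1) by (rule Rd_E)
  obtain q where q: "b = ev t q" "tdeg_le q e" using assms(2) by (rule Rd_E)
  have "tdeg_le (p * q) f" using tdeg_le_mult[OF p(2) q(2)] assms(3) by simp
  thus ?thesis by (rule Rd_I) (simp only: p q v.mult)
qed

lemma Rd_gens: "ev t px ^ i \<in> Rd i" "ev t py ^ i \<in> Rd i" "ev t pz ^ i \<in> Rd i"
  by (rule Rd_I[OF tdeg_le_mono[of i 0 0]] Rd_I[OF tdeg_le_mono[of 0 i 0]]
        Rd_I[OF tdeg_le_mono[of 0 0 i]]; simp add: mon3_def v.power)+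

lemma Rd_cst: "ev t (cst c) \<in> Rd 0"
  by (rule Rd_I[OF tdeg_le_cst_mult[OF tdeg_le_mono[of 0 0 0]]]) (simp_all add: mon3_def)

text \<open>\<open>x^n, y^n\<close> is a regular sequence: the coordinate ring is free over
  \<open>K[x, y]\<close> on \<open>1, z, z^2, z^3\<close>, so the equation already holds between
  normal forms and is read off coefficientwise. Normal forms keep the degree bound.\<close>

lemma Rd_cancel:
  assumes u: "u \<in> Rd d" and w: "w \<in> Rd e" and eq: "ev t py ^ n * u = ev t px ^ n * w"
  obtains u' where "u = ev t px ^ n * u'" "u' \<in> Rd (d - n)"
proof -
  obtain U0 W0 where 0: "u = ev t U0" "tdeg_le U0 d" "w = ev t W0" "tdeg_le W0 e"
    using Rd_E[OF u] Rd_E[OF w] by metis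
  obtain q U where U: "U0 = quartic t * q + U" "degree U < 4" "tdeg_le U d"
    using quartic_normal_form[OF 0(2)] by blast
  obtain q' W where W: "W0 = quartic t * q' + W" "degree W < 4" "tdeg_le W e"
    using quartic_normal_form[OF 0(4)] by blast
  have eU: "u = ev t U" and eW: "w = ev t W" by (simp_all add: 0 U W v.simps ev_quartic)
  have degx: "degree (px ^ n * p) < 4" and degy: "degree (py ^ n * p) < 4"
    if "degree p < 4" for p :: "'k poly poly poly"
  proof -
    have "degree (px :: 'k poly poly poly) = 0" "degree (py :: 'k poly poly poly) = 0"
      by (simp_all add: px_def py_def)
    thus "degree (px ^ n * p) < 4" "degree (py ^ n * p) < 4"
      using that degree_power_le[of "px :: 'k poly poly poly" n] degree_power_le[of "py :: 'k poly poly poly" n]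
        degree_mult_le[of "px ^ n" p] degree_mult_le[of "py ^ n" p] by simp_all
  qed
  have "py ^ n * U - px ^ n * W = 0"
  proof (rule ev_nz)
    show "degree (py ^ n * U - px ^ n * W) < 4"
      using degree_diff_less[OF degy degx] U W by blast
    show "ev t (py ^ n * U - px ^ n * W) = 0"
      using eq by (simp add: v.simps flip: eU eW)
  qed
  hence UW: "py ^ n * U = px ^ n * W" by simp
  have "coeff3 U i j l = 0" if "i < n" for i j l
  proof -
    have "coeff3 U i j l = coeff3 (py ^ n * U) i (j + n) l"
      by (simp add: py_power coeff3_mono_mult)
    also have "\<dots> = 0" unfolding UW using that by (simp add: px_power coeff3_mono_mult)
    finally show ?thesis .
  qed
  then obtain U' where "U = px ^ n * U'" "tdeg_le U' (d - n)"
    using divide_px_power[OF _ U(3)] by blast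
  thus thesis by (intro that[of "ev t U'"] Rd_I[of U']) (simp_all only: eU v.mult v.power)
qed

text \<open>For \<open>q = 2^n\<close> this expresses that the \<open>n\<close>-th Frobenius
  pullback of \<open>E_l(3)\<close> has no nonzero global sections.\<close>

definition NR :: "nat \<Rightarrow> 'k \<Rightarrow> bool" where
  "NR q l \<longleftrightarrow> (\<forall>a\<in>Rd q. \<forall>b\<in>Rd q. \<forall>c\<in>Rd q.
     a * ev t px ^ (2 * q) + b * ev t py ^ (2 * q)
       + c * ((ev t pz)\<^sup>2 + ev t (cst l) * ev t px * ev t py) ^ q = 0 \<longrightarrow> a = 0 \<and> b = 0 \<and> c = 0)"

text \<open>The relation has total degree 3, too small for the quartic to interfere, so it holds in
  the polynomial ring. Linear coefficients are too small for the Koszul syzygies of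
  \<open>x^2, y^2, z^2 + l x y\<close>.\<close>

lemma NR_one: "NR 1 l"
  unfolding NR_def
proof (intro ballI impI)
  fix a b c assume mem: "a \<in> Rd 1" "b \<in> Rd 1" "c \<in> Rd 1"
    and eq: "a * ev t px ^ (2 * 1) + b * ev t py ^ (2 * 1)
       + c * ((ev t pz)\<^sup>2 + ev t (cst l) * ev t px * ev t py) ^ 1 = 0"
  obtain A B C where ABC: "a = ev t A" "b = ev t B" "c = ev t C" and td: "tdeg_le A 1" "tdeg_le B 1" "tdeg_le C 1"
    using Rd_E[OF mem(1)] Rd_E[OF mem(2)] Rd_E[OF mem(3)] by metis
  define p where "p = mon3 2 0 0 * A + mon3 0 2 0 * B + (mon3 0 0 2 * C + cst l * (mon3 1 1 0 * C))"
  have tp: "tdeg_le p 3"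
    unfolding p_def
    by (rule tdeg_le_add tdeg_le_cst_mult tdeg_le_mono_mult td | simp)+
  have "ev t p = 0" using eq by (simp add: p_def ABC mon3_def v.simps algebra_simps power2_eq_square)
  moreover have "degree p < 4"
  proof -
    have "coeff p n = 0" if "n \<ge> 4" for n
    proof (intro poly_eqI)
      fix j i
      show "coeff (coeff (coeff p n) j) i = coeff (coeff 0 j) i"
        using tp that unfolding tdeg_le_def coeff3_def by fastforce
    qed
    hence "degree p \<le> 3" by (intro degree_le) auto
    thus ?thesis by simp
  qed
  ultimately have p0: "p = 0" by (rule ev_nz)
  have small: "i + j + k \<le> 1" if "coeff3 A i j k \<noteq> 0 \<or> coeff3 B i j k \<noteq> 0 \<or> coeff3 C i j k \<noteq> 0" for i j k
    using that td by (auto simp: tdeg_le_def)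
  have c: "coeff3 p i j k = 0" for i j k by (simp add: p0)
  have C0: "C = 0"
  proof (rule poly3_eqI)
    fix i j k
    show "coeff3 C i j k = coeff3 0 i j k"
    proof (rule ccontr)
      assume nz: "coeff3 C i j k \<noteq> coeff3 0 i j k"
      hence s: "i + j + k \<le> 1" using small[of i j k] by simp
      have "coeff3 A (i - 2) j (k + 2) = 0" "coeff3 B i (j - 2) (k + 2) = 0"
        "coeff3 C (i - 1) (j - 1) (k + 2) = 0"
        using small by fastforce+
      moreover have "\<not> (1 \<le> i \<and> 1 \<le> j)" using s by linarith
      ultimately have "coeff3 C i j k = 0" using c[of i j "k + 2"]
        by (auto simp: p_def coeff3_mono_mult split: if_splits)
      thus False using nz by simp
    qed
  qed
  have A0: "A = 0"
  proof (rule poly3_eqI)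
    fix i j k
    have "coeff3 B (i + 2) (j - 2) k = 0" using small by fastforce
    thus "coeff3 A i j k = coeff3 0 i j k"
      using c[of "i + 2" j k] by (auto simp: p_def C0 coeff3_mono_mult split: if_splits)
  qed
  have "B = 0"
  proof (rule poly3_eqI)
    fix i j k
    show "coeff3 B i j k = coeff3 0 i j k"
      using c[of i "j + 2" k] by (auto simp: p_def C0 A0 coeff3_mono_mult split: if_splits)
  qed
  thus "a = 0 \<and> b = 0 \<and> c = 0" by (simp add: ABC A0 C0 v.zero)
qed

text \<open>Wedging turns coefficients of degree \<open>2q\<close> into
  \<open>2q + 3q - 4q = q\<close>, where \<open>3q\<close> comes from the sections and
  \<open>4q\<close> from dividing by the fourth power of \<open>x^q\<close>. The wedge map is
  injective because \<open>t + k^2\<close> and \<open>J\<close> are nonzero.\<close>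

lemma NR_double:
  assumes NR: "NR (2 ^ n) k" and k: "k = t + l\<^sup>2" and nz: "t + k\<^sup>2 \<noteq> 0"
  shows "NR (2 ^ Suc n) l"
  unfolding NR_def
proof (intro ballI impI)
  define q :: nat where "q = 2 ^ n"
  define x y z u where "x = ev t px ^ q" and "y = ev t py ^ q" and "z = ev t pz ^ q"
    and "u = ev t (cst t) ^ q"
  define K where "K = ev t (cst k) ^ q"
  define m where "m = ev t (cst l) ^ (2 * q)"
  interpret p: quartic_point x y z u
    unfolding x_def y_def z_def u_def q_def by (rule quartic_point_power)
  interpret c: ring_map "cst :: 'k \<Rightarrow> _" by (rule ring_map_cst)
  fix a b c assume mem: "a \<in> Rd (2 ^ Suc n)" "b \<in> Rd (2 ^ Suc n)" "c \<in> Rd (2 ^ Suc n)"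
    and eq: "a * ev t px ^ (2 * 2 ^ Suc n) + b * ev t py ^ (2 * 2 ^ Suc n)
       + c * ((ev t pz)\<^sup>2 + ev t (cst l) * ev t px * ev t py) ^ 2 ^ Suc n = 0"
  have pw: "ev t p ^ (2 * 2 ^ Suc n) = (ev t p ^ q) ^ 4" for p
    by (simp add: q_def mult.commute flip: power_mult)
  have D: "((ev t pz)\<^sup>2 + ev t (cst l) * ev t px * ev t py) ^ 2 ^ Suc n = z ^ 4 + m * x\<^sup>2 * y\<^sup>2"
    unfolding frobenius_add
    by (simp add: x_def y_def z_def m_def q_def power_mult_distrib mult.commute flip: power_mult)
  have rel: "a * x ^ 4 + b * y ^ 4 + c * (z ^ 4 + m * x\<^sup>2 * y\<^sup>2) = 0"
    using eq unfolding pw D by (simp add: x_def y_def)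
  have Ku: "K = u + m"
    by (simp add: K_def k c.simps v.simps q_def frobenius_add u_def m_def flip: power_mult)
  hence mK: "m = K + u" by (simp add: p.add_self_left p.add_self add_ac)
  note swaps = p.wedge_swaps[OF mK rel]
  have cst_mem: "K \<in> Rd 0" "u \<in> Rd 0" "1 \<in> Rd 0"
    using Rd_cst[of "k ^ q"] Rd_cst[of "t ^ q"] Rd_cst[of 1]
    by (simp_all add: K_def u_def c.simps v.simps)
  have gens: "x ^ i \<in> Rd (i * q)" "y ^ i \<in> Rd (i * q)" "z ^ i \<in> Rd (i * q)" for i
    using Rd_gens[of "i * q"] by (simp_all add: x_def y_def z_def mult.commute flip: power_mult)
  have gens1: "x \<in> Rd q" "y \<in> Rd q" "z \<in> Rd q" using gens[of 1] by simp_all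
  have "K\<^sup>2 \<in> Rd 0" unfolding power2_eq_square by (rule Rd_mult[OF cst_mem(1) cst_mem(1)]) simp
  note Rd_simps = Rd_add gens gens1 cst_mem this Rd_mult
  have sect: "p.c1 K \<in> Rd (3 * q)" "p.c2 K \<in> Rd (3 * q)" "p.J \<in> Rd (3 * q)"
    "p.b1 \<in> Rd (3 * q)" "p.b2 K \<in> Rd (3 * q)" "p.a1 K \<in> Rd (3 * q)" "p.a2 \<in> Rd (3 * q)"
    unfolding p.sect_defs by (rule Rd_simps | simp)+
  have mem': "a \<in> Rd (2 * q)" "b \<in> Rd (2 * q)" "c \<in> Rd (2 * q)" using mem by (simp_all add: q_def)
  have wedge: "\<exists>w\<in>Rd q. b * s + s' * c = x ^ 4 * w"
    if s: "s \<in> Rd (3 * q)" "s' \<in> Rd (3 * q)" "s'' \<in> Rd (3 * q)"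
      and swap: "y ^ 4 * (b * s + s' * c) = x ^ 4 * (a * s + s'' * c)" for s s' s''
  proof -
    have 1: "b * s + s' * c \<in> Rd (5 * q)" "a * s + s'' * c \<in> Rd (5 * q)"
      by (rule Rd_add Rd_mult mem' s | simp)+
    have "ev t py ^ (4 * q) * (b * s + s' * c) = ev t px ^ (4 * q) * (a * s + s'' * c)"
      using swap by (simp add: x_def y_def mult.commute flip: power_mult)
    from Rd_cancel[OF 1 this] obtain w where
      "b * s + s' * c = ev t px ^ (4 * q) * w" "w \<in> Rd (5 * q - 4 * q)" by blast
    thus ?thesis by (intro bexI[of _ w]) (simp_all add: x_def mult.commute flip: power_mult)
  qed
  obtain w1 where w1: "w1 \<in> Rd q" "b * p.c1 K + p.b1 * c = x ^ 4 * w1"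
    using wedge[OF _ _ _ swaps(1)] sect by blast
  obtain w2 where w2: "w2 \<in> Rd q" "b * p.c2 K + p.b2 K * c = x ^ 4 * w2"
    using wedge[OF _ _ _ swaps(2)] sect by blast
  obtain w3 where w3: "w3 \<in> Rd q" "b * p.J + p.c1 K * c = x ^ 4 * w3"
    using wedge[OF _ _ _ swaps(3)] sect by blast
  have "x ^ 4 * (w1 * x\<^sup>2 + w2 * y\<^sup>2 + w3 * (z\<^sup>2 + K * x * y)) = 0"
    using p.wedge_relation[OF mK rel] unfolding w1(2) w2(2) w3(2) by (simp add: algebra_simps)
  hence "w1 * x\<^sup>2 + w2 * y\<^sup>2 + w3 * (z\<^sup>2 + K * x * y) = 0" using p.x_nz by simp
  moreover have "((ev t pz)\<^sup>2 + ev t (cst k) * ev t px * ev t py) ^ 2 ^ n = z\<^sup>2 + K * x * y"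
    unfolding frobenius_add
    by (simp add: x_def y_def z_def K_def q_def power_mult_distrib mult.commute flip: power_mult)
  ultimately have "w1 = 0 \<and> w2 = 0 \<and> w3 = 0"
    using NR w1(1) w2(1) w3(1) unfolding NR_def
    by (simp add: x_def y_def q_def mult.commute flip: power_mult)
  moreover have "u + K\<^sup>2 \<noteq> 0"
  proof -
    have "u + K\<^sup>2 = ev t (cst ((t + k\<^sup>2) ^ 2 ^ n))"
      by (simp add: c.simps v.simps frobenius_add u_def K_def q_def mult.commute flip: power_mult)
    moreover have "cst ((t + k\<^sup>2) ^ 2 ^ n) \<noteq> 0" "degree (cst ((t + k\<^sup>2) ^ 2 ^ n)) < 4"
      using nz by (simp_all add: cst_def)
    ultimately show ?thesis using ev_nz by metis
  qed
  moreover have "p.J \<noteq> 0"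
  proof -
    have "p.J = x ^ 3 + y ^ 3" by (rule p.J_def)
    also have "\<dots> = ev t ((px ^ 3 + py ^ 3) ^ q)"
      by (simp add: x_def y_def v.simps q_def frobenius_add mult.commute flip: power_mult)
    finally have "p.J = ev t ((px ^ 3 + py ^ 3) ^ q)" .
    moreover have "degree ((px ^ 3 + py ^ 3) ^ q :: 'k poly poly poly) = 0"
    proof -
      have "px ^ 3 + py ^ 3 = ([: [:[:0, 1:]:] ^ 3 + [:0, 1:] ^ 3 :] :: 'k poly poly poly)"
        by (simp add: px_def py_def power3_eq_cube)
      thus ?thesis using degree_power_le[of "px ^ 3 + py ^ 3 :: 'k poly poly poly" q] by simp
    qed
    moreover have "coeff3 (px ^ 3 + py ^ 3) 3 0 0 = (1::'k)"
      by (simp add: px_power py_power coeff3_mono)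
    hence "px ^ 3 + py ^ 3 \<noteq> (0 :: 'k poly poly poly)" by (metis coeff3_0 one_neq_zero)
    hence "(px ^ 3 + py ^ 3 :: 'k poly poly poly) ^ q \<noteq> 0" by simp
    ultimately show ?thesis using ev_nz[of "(px ^ 3 + py ^ 3) ^ q"] by (metis zero_less_numeral)
  qed
  ultimately show "a = 0 \<and> b = 0 \<and> c = 0"
    using p.wedge_injective[OF mK rel] w2(2) w3(2) by simp
qed

text \<open>Each doubling trades one Frobenius for one step along the \<open>lam\<close> orbit, so
  the induction has to run over all starting indices.\<close>

lemma NR_iterate:
  assumes "\<And>i. i \<ge> 1 \<Longrightarrow> lam t i \<noteq> 0"
  shows "NR (2 ^ n) (lam t i)"
proof (induction n arbitrary: i)
  case 0
  show ?case using NR_one by simp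
next
  case (Suc n)
  show ?case
  proof (rule NR_double[OF Suc.IH[of "Suc i"]])
    show "t + (lam t (Suc i))\<^sup>2 \<noteq> 0" using assms[of "Suc (Suc i)"] by simp
  qed simp
qed

text \<open>This is the start \<open>lam t 0 = 0\<close> of the orbit, where the third form is a
  pure power of \<open>z\<close>.\<close>

lemma no_low_syzygy:
  assumes "\<And>i. i \<ge> 1 \<Longrightarrow> lam t i \<noteq> 0"
    and "tdeg_le a (2 ^ n)" "tdeg_le b (2 ^ n)" "tdeg_le c (2 ^ n)"
    and dvd: "quartic t dvd a * px ^ (2 * 2 ^ n) + b * py ^ (2 * 2 ^ n) + c * pz ^ (2 * 2 ^ n)"
  shows "quartic t dvd a" "quartic t dvd b" "quartic t dvd c"
proof -
  have NR: "NR (2 ^ n) 0" using NR_iterate[OF assms(1), of n 0] by simp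
  have mem: "ev t a \<in> Rd (2 ^ n)" "ev t b \<in> Rd (2 ^ n)" "ev t c \<in> Rd (2 ^ n)"
    using assms(2-4) by (auto intro: Rd_I)
  have "ev t (cst 0) = 0" by (simp add: cst_def v.zero)
  hence D: "((ev t pz)\<^sup>2 + ev t (cst 0) * ev t px * ev t py) ^ 2 ^ n = ev t pz ^ (2 * 2 ^ n)"
    by (simp add: power_mult)
  have "ev t a * ev t px ^ (2 * 2 ^ n) + ev t b * ev t py ^ (2 * 2 ^ n)
      + ev t c * ((ev t pz)\<^sup>2 + ev t (cst 0) * ev t px * ev t py) ^ 2 ^ n = 0"
    using dvd unfolding D ev_eq_0_iff[OF char t, symmetric] by (simp only: v.simps)
  hence "ev t a = 0 \<and> ev t b = 0 \<and> ev t c = 0" using NR mem unfolding NR_def by blast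
  thus "quartic t dvd a" "quartic t dvd b" "quartic t dvd c"
    using ev_eq_0_iff[OF char t] by blast+
qed

end

subsection \<open>Duality\<close>

lemma separating_functional:
  fixes scale :: "'a::field \<Rightarrow> 'b::ab_group_add \<Rightarrow> 'b"
  assumes "vector_space scale" and U: "module.subspace scale U" and w: "w \<notin> U"
  obtains g where "\<And>u v. g (u + v) = g u + g v" "\<And>c u. g (scale c u) = c * g u"
    "\<And>u. u \<in> U \<Longrightarrow> g u = 0" "g w = (1::'a)"
proof -
  interpret vs: vector_space scale by fact
  interpret pr: vector_space_pair scale "(*) :: 'a \<Rightarrow> 'a \<Rightarrow> 'a"
    by unfold_locales (simp_all add: algebra_simps)
  obtain B where B: "B \<subseteq> U" "vs.independent B" "U \<subseteq> vs.span B"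
    using vs.maximal_independent_subset[of U] by blast
  have "vs.span B \<subseteq> U" using B(1) U by (rule vs.span_minimal)
  hence "w \<notin> vs.span B" using w by blast
  hence "vs.independent (insert w B)" using B(2) by (simp add: vs.independent_insertI)
  from pr.linear_independent_extend[OF this, of "\<lambda>b. if b = w then 1 else 0"]
  obtain g where g: "Vector_Spaces.linear scale (*) g" "\<forall>b\<in>insert w B. g b = (if b = w then 1 else 0)"
    by blast
  interpret g: Vector_Spaces.linear scale "(*)" g by fact
  have "g b = 0" if "b \<in> B" for b using g(2) B(1) w that by auto
  hence "g u = 0" if "u \<in> vs.span B" for u
    using pr.linear_eq_0_on_span[OF g(1) _ that] \<open>\<And>b. b \<in> B \<Longrightarrow> g b = 0\<close> by blast
  note span0 = this
  show thesis
  proof (rule that[of g])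
    show "g u = 0" if "u \<in> U" for u using span0 that B(3) by blast
    show "g w = 1" using g(2) by simp
  qed (rule g.add g.scale)+
qed

text \<open>With the quartic among the generators, this is the preimage in \<open>K[x, y, z]\<close>
  of the ideal \<open>(x^n, y^n, z^n)\<close> of the coordinate ring.\<close>

definition frobenius_ideal :: "'a::comm_ring_1 \<Rightarrow> nat \<Rightarrow> 'a poly poly poly set" where
  "frobenius_ideal t n = {a * px ^ n + b * py ^ n + c * pz ^ n + d * quartic t | a b c d. True}"

lemma frobenius_idealI: "p = a * px ^ n + b * py ^ n + c * pz ^ n + d * quartic t \<Longrightarrow> p \<in> frobenius_ideal t n"
  unfolding frobenius_ideal_def by blast

lemma frobenius_ideal_add:
  assumes "p \<in> frobenius_ideal t n" "q \<in> frobenius_ideal t n"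
  shows "p + q \<in> frobenius_ideal t n"
proof -
  obtain a b c d where p: "p = a * px ^ n + b * py ^ n + c * pz ^ n + d * quartic t"
    using assms(1) unfolding frobenius_ideal_def by blast
  obtain a' b' c' d' where q: "q = a' * px ^ n + b' * py ^ n + c' * pz ^ n + d' * quartic t"
    using assms(2) unfolding frobenius_ideal_def by blast
  show ?thesis
    by (rule frobenius_idealI[of _ "a + a'" _ "b + b'" "c + c'" "d + d'"]) (simp add: p q algebra_simps)
qed

lemma frobenius_ideal_mult:
  assumes "p \<in> frobenius_ideal t n"
  shows "q * p \<in> frobenius_ideal t n"
proof -
  obtain a b c d where p: "p = a * px ^ n + b * py ^ n + c * pz ^ n + d * quartic t"
    using assms unfolding frobenius_ideal_def by blast
  show ?thesis
    by (rule frobenius_idealI[of _ "q * a" _ "q * b" "q * c" "q * d"]) (simp add: p algebra_simps)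
qed

lemma frobenius_ideal_gens:
  "px ^ n \<in> frobenius_ideal t n" "py ^ n \<in> frobenius_ideal t n" "pz ^ n \<in> frobenius_ideal t n"
  "quartic t \<in> frobenius_ideal t n"
  by (rule frobenius_idealI[of _ 1 _ 0 0 0] frobenius_idealI[of _ 0 _ 1 0 0]
        frobenius_idealI[of _ 0 _ 0 1 0] frobenius_idealI[of _ 0 _ 0 0 1]; simp)+

lemma mono_in_frobenius_ideal:
  assumes "n \<le> i \<or> n \<le> j \<or> n \<le> l"
  shows "mon3 i j l \<in> frobenius_ideal t n"
proof -
  have "mon3 i j l = mon3 (i - n) j l * px ^ n" if "n \<le> i" using that by (simp add: px_power mono_mult)
  moreover have "mon3 i j l = mon3 i (j - n) l * py ^ n" if "n \<le> j" using that by (simp add: py_power mono_mult)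
  moreover have "mon3 i j l = mon3 i j (l - n) * pz ^ n" if "n \<le> l" using that by (simp add: pz_power mono_mult)
  ultimately show ?thesis
    using assms frobenius_ideal_mult[OF frobenius_ideal_gens(1)]
      frobenius_ideal_mult[OF frobenius_ideal_gens(2)] frobenius_ideal_mult[OF frobenius_ideal_gens(3)] by metis
qed

lemma poly3_of_coeffs:
  fixes f :: "nat \<Rightarrow> nat \<Rightarrow> nat \<Rightarrow> 'a::comm_ring_1"
  assumes "\<And>i j l. f i j l \<noteq> 0 \<Longrightarrow> i < n \<and> j < n \<and> l < n"
  obtains p where "\<And>i j l. coeff3 p i j l = f i j l"
proof
  fix i j l
  have sum1: "(\<Sum>a<n. if a = i then g a else 0) = (if i < n then g i else 0)"
    and pull: "(\<Sum>a<n. if P then g a else 0) = (if P then \<Sum>a<n. g a else 0)"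
    for i P and g :: "nat \<Rightarrow> 'a" by simp_all
  have c: "coeff3 (cst (f a b c) * mon3 a b c) i j l =
    (if c = l then if b = j then if a = i then f a b c else 0 else 0 else 0)" for a b c
    by (simp add: coeff3_mono)
  have sum: "coeff3 (sum h A) i j l = (\<Sum>a\<in>A. coeff3 (h a) i j l)"
    for h :: "nat \<Rightarrow> 'a poly poly poly" and A
    by (simp add: coeff3_def coeff_sum)
  show "coeff3 (\<Sum>c<n. \<Sum>b<n. \<Sum>a<n. cst (f a b c) * mon3 a b c) i j l = f i j l"
    unfolding sum c pull sum1 using assms[of i j l] by auto
qed

lemma vector_space_cst: "vector_space (\<lambda>c p. cst c * p :: 'a::field poly poly poly)"
  by unfold_locales (simp_all add: ring_map.simps[OF ring_map_cst] algebra_simps)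

text \<open>
  \<open>K[x, y, z]/(x\<^sup>N, y\<^sup>N, z\<^sup>N)\<close> is Gorenstein: a functional vanishing on the ideal generated by the quartic
  is pairing with an element that the quartic annihilates.
\<close>

lemma frobenius_ideal_duality:
  fixes t :: "'a::field"
  defines "coef \<equiv> coeff3 :: 'a poly poly poly \<Rightarrow> _"
  assumes N: "N \<ge> 1" and notin: "mon3 i0 j0 l0 \<notin> frobenius_ideal t N"
    and deg: "i0 + j0 + l0 + d = 3 * (N - 1)"
  obtains v where "v \<noteq> 0" "tdeg_le v d"
    "\<And>i j l. coef v i j l \<noteq> 0 \<Longrightarrow> i < N \<and> j < N \<and> l < N"
    "\<And>i j l. i < N \<Longrightarrow> j < N \<Longrightarrow> l < N \<Longrightarrow> coef (quartic t * v) i j l = 0"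
proof -
  interpret vs: vector_space "\<lambda>c p. cst c * p :: 'a poly poly poly" by (rule vector_space_cst)
  have "0 \<in> frobenius_ideal t N" by (rule frobenius_idealI[of _ 0 _ 0 0 0]) simp
  hence "vs.subspace (frobenius_ideal t N)"
    by (intro vs.subspaceI frobenius_ideal_add frobenius_ideal_mult)
  from separating_functional[OF vector_space_cst this notin]
  obtain g :: "'a poly poly poly \<Rightarrow> 'a" where g: "\<And>u v. g (u + v) = g u + g v" "\<And>c u. g (cst c * u) = c * g u"
    "\<And>u. u \<in> frobenius_ideal t N \<Longrightarrow> g u = 0" "g (mon3 i0 j0 l0) = 1" by metis
  \<comment> \<open>The coefficient of \<open>v\<close> at an exponent of degree \<open>d\<close> is
    the value of \<open>g\<close> at the monomial completing it to the socle element
    \<open>(xyz)^(N - 1)\<close>.\<close>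
  define f where "f i j l = (if i < N \<and> j < N \<and> l < N \<and> i + j + l = d
      then g (mon3 (N - 1 - i) (N - 1 - j) (N - 1 - l)) else 0)" for i j l
  obtain v where v: "\<And>i j l. coeff3 v i j l = f i j l"
    by (rule poly3_of_coeffs[of f N]) (auto simp: f_def split: if_splits)
  have lt: "i0 < N" "j0 < N" "l0 < N" using notin mono_in_frobenius_ideal[of N i0 j0 l0 t] by force+
  have "coeff3 v (N - 1 - i0) (N - 1 - j0) (N - 1 - l0) = 1"
    using lt deg g(4) by (auto simp: v f_def)
  hence "v \<noteq> 0" by auto
  moreover have "tdeg_le v d" by (auto simp: tdeg_le_def v f_def split: if_splits)
  moreover have "i < N \<and> j < N \<and> l < N" if "coef v i j l \<noteq> 0" for i j l
    using that by (auto simp: coef_def v f_def split: if_splits)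
  moreover have "coef (quartic t * v) i j l = 0" if ijl: "i < N" "j < N" "l < N" for i j l
  proof -
    define u :: "'a poly poly poly" where "u = mon3 (N - 1 - i) (N - 1 - j) (N - 1 - l)"
    \<comment> \<open>Multiplying \<open>v\<close> by a monomial corresponds to multiplying the
      complementary monomial \<open>u\<close> by it. When the exponents leave the box, the product
      lies in the ideal, and \<open>g\<close> vanishes there too.\<close>
    have shift: "coeff3 (mon3 a b c * v) i j l = (if i + j + l = d + 4 then g (mon3 a b c * u) else 0)"
      if "a + b + c = 4" for a b c
    proof (cases "a \<le> i \<and> b \<le> j \<and> c \<le> l")
      case True
      have "mon3 a b c * u = mon3 (N - 1 - (i - a)) (N - 1 - (j - b)) (N - 1 - (l - c))"
        using True ijl by (simp add: u_def mono_mult add.commute)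
      moreover have "(i - a) + (j - b) + (l - c) = d \<longleftrightarrow> i + j + l = d + 4" using True that by linarith
      ultimately show ?thesis using True ijl by (auto simp: coeff3_mono_mult v f_def)
    next
      case False
      hence "N \<le> a + (N - 1 - i) \<or> N \<le> b + (N - 1 - j) \<or> N \<le> c + (N - 1 - l)" using ijl by linarith
      hence "g (mon3 a b c * u) = 0"
        unfolding u_def mono_mult by (intro g(3) mono_in_frobenius_ideal)
      thus ?thesis using False by (auto simp: coeff3_mono_mult)
    qed
    have "coeff3 (quartic t * v) i j l = (if i + j + l = d + 4 then g (quartic t * u) else 0)"
      unfolding quartic_mono distrib_right mult.assoc coeff3_add coeff3_cst_mult g
      by (simp add: shift)
    also have "g (quartic t * u) = 0"
      using g(3)[OF frobenius_ideal_mult[OF frobenius_ideal_gens(4)], of u] by (simp add: mult.commute)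
    finally show ?thesis by (simp add: coef_def)
  qed
  ultimately show thesis using that by blast
qed

lemma lam_ring_map: "ring_map f \<Longrightarrow> f (lam t n) = lam (f t) n"
  by (induction n) (simp_all add: ring_map.simps)

text \<open>Otherwise duality yields \<open>v \<noteq> 0\<close> with \<open>quartic t * v\<close>
  in \<open>(x^N, y^N, z^N)\<close>. The coefficients form a syzygy so low that the quartic divides
  each of them; cancelling it puts \<open>v\<close> itself into the monomial ideal, although all its
  exponents are below \<open>N\<close>.\<close>

lemma yz_power_in_frobenius_ideal:
  fixes t :: "'a::field"
  assumes char: "CHAR('a) = 2" and lam: "\<And>i. i \<ge> 1 \<Longrightarrow> lam t i \<noteq> 0"
  shows "py * (py * pz) ^ (3 * 2 ^ n) \<in> frobenius_ideal t (4 * 2 ^ n)"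
proof (rule ccontr)
  define q :: nat where "q = 2 ^ n"
  define N where "N = 4 * q"
  assume "py * (py * pz) ^ (3 * 2 ^ n) \<notin> frobenius_ideal t (4 * 2 ^ n)"
  hence notin: "mon3 0 (3 * q + 1) (3 * q) \<notin> frobenius_ideal t N"
    by (simp add: mon3_def power_mult_distrib N_def q_def mult_ac)
  have "3 * q + 1 < N" using notin mono_in_frobenius_ideal[of N 0 "3 * q + 1" "3 * q" t] by force
  \<comment> \<open>For \<open>q = 1\<close> one has \<open>3 * q + 1 = N\<close>, and the monomial
    is in the ideal for trivial reasons.\<close>
  hence q: "q \<ge> 2" by (simp add: N_def)
  obtain v where v: "v \<noteq> 0" "tdeg_le v (6 * q - 4)"
    "\<And>i j l. coeff3 v i j l \<noteq> 0 \<Longrightarrow> i < N \<and> j < N \<and> l < N"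
    "\<And>i j l. i < N \<Longrightarrow> j < N \<Longrightarrow> l < N \<Longrightarrow> coeff3 (quartic t * v) i j l = 0"
    by (rule frobenius_ideal_duality[OF _ notin, of "6 * q - 4"]) (use q in \<open>auto simp: N_def\<close>)
  have td: "tdeg_le (quartic t * v) (6 * q)"
    using tdeg_le_mult[OF tdeg_le_quartic v(2), of t] q by simp
  obtain a b c where abc: "quartic t * v = a * px ^ N + b * py ^ N + c * pz ^ N"
    "tdeg_le a (6 * q - N)" "tdeg_le b (6 * q - N)" "tdeg_le c (6 * q - N)"
    using monomial_ideal_decompose[OF v(4) td] by blast
  \<comment> \<open>Scalars are extended to the algebraic closure, which satisfies the class
    constraints of \<open>no_low_syzygy\<close>; \<open>e\<close> is injective, so nonzero data stay
    nonzero.\<close>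
  define e :: "'a \<Rightarrow> 'a alg_closure" where "e = to_ac"
  interpret e: ring_map e unfolding e_def by (rule ring_map_to_ac)
  have e: "ring_map e" by (rule e.ring_map_axioms)
  interpret m: ring_map "map3 e" by (rule ring_map_map3[OF e])
  have td3: "tdeg_le (map3 e p) (2 ^ Suc n)" if "tdeg_le p (6 * q - N)" for p
    using that unfolding tdeg_le_def by (auto simp: coeff3_map3 e.zero N_def q_def e_def)
  have char': "CHAR('a alg_closure) = 2" using char by simp
  have lam': "lam (e t) i \<noteq> 0" if "i \<ge> 1" for i
    using lam[OF that] unfolding lam_ring_map[OF e, symmetric] by (simp add: e_def)
  have et: "e t \<noteq> 0" using lam'[of 1] by simp
  have eq: "quartic (e t) * map3 e v = map3 e a * px ^ N + map3 e b * py ^ N + map3 e c * pz ^ N"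
    using arg_cong[OF abc(1), of "map3 e"] by (simp only: m.simps map3_quartic[OF e] map3_gens[OF e])
  have N': "N = 2 * 2 ^ Suc n" by (simp add: N_def q_def)
  have dvd: "quartic (e t) dvd map3 e a * px ^ (2 * 2 ^ Suc n) + map3 e b * py ^ (2 * 2 ^ Suc n)
      + map3 e c * pz ^ (2 * 2 ^ Suc n)"
    unfolding N'[symmetric] eq[symmetric] by simp
  note low = no_low_syzygy[OF char' et lam' td3[OF abc(2)] td3[OF abc(3)] td3[OF abc(4)] dvd]
  obtain a' b' c' where "map3 e a = quartic (e t) * a'" "map3 e b = quartic (e t) * b'"
    "map3 e c = quartic (e t) * c'"
  proof -
    have "quartic (e t) dvd map3 e a" "quartic (e t) dvd map3 e b" "quartic (e t) dvd map3 e c"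
      using low by simp_all
    thus thesis using that by (elim dvdE)
  qed
  hence "quartic (e t) * map3 e v = quartic (e t) * (a' * px ^ N + b' * py ^ N + c' * pz ^ N)"
    unfolding eq by (simp add: algebra_simps)
  moreover have "quartic (e t) \<noteq> 0" using degree_quartic[of "e t"] by auto
  ultimately have ev: "map3 e v = a' * px ^ N + b' * py ^ N + c' * pz ^ N" by simp
  have "v = 0"
  proof (rule poly3_eqI)
    fix i j l
    show "coeff3 v i j l = coeff3 0 i j l"
    proof (cases "i < N \<and> j < N \<and> l < N")
      case True
      hence "coeff3 (map3 e v) i j l = 0"
        by (simp add: ev px_power py_power pz_power mult.commute[of _ "mon3 _ _ _"] coeff3_mono_mult)
      thus ?thesis by (simp add: coeff3_map3 e.zero) (simp add: e_def)
    next
      case False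
      thus ?thesis using v(3)[of i j l] by auto
    qed
  qed
  thus False using v(1) by simp
qed

lemma quartic_division:
  obtains q r where "p = quartic t * q + r" "degree r < 4"
proof -
  obtain q r where "p = quartic t * q + r" "r = 0 \<or> degree r < degree (quartic t)"
    by (rule monic_division[OF lead_coeff_quartic])
  thus thesis using that[of q r] by (auto simp: degree_quartic)
qed

subsection \<open>Descent of the cohomology class\<close>

context
  fixes t :: "'k::{field,factorial_ring_gcd,semiring_gcd_mult_normalize}"
  assumes char: "CHAR('k) = 2" and t: "t \<noteq> 0"
begin

interpretation v: ring_map "ev t" by (rule ring_map_ev)
interpretation cs: ring_map "cst :: 'k \<Rightarrow> _" by (rule ring_map_cst)

text \<open>The coordinate ring localised at \<open>x\<close> and at \<open>y\<close>. Inverting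
  \<open>x\<close> also inverts its \<open>2^n\<close>-th powers, so the same two rings serve every
  level \<open>n\<close>.\<close>

definition Rx :: "'k big set" where "Rx = {ev t p / ev t px ^ n | p n. True}"
definition Ry :: "'k big set" where "Ry = {ev t p / ev t py ^ n | p n. True}"

lemma Rx_I: "a = ev t p / ev t px ^ n \<Longrightarrow> a \<in> Rx" unfolding Rx_def by blast
lemma Ry_I: "a = ev t p / ev t py ^ n \<Longrightarrow> a \<in> Ry" unfolding Ry_def by blast

lemma Rx_E:
  assumes "a \<in> Rx" obtains p n where "a = ev t p / ev t px ^ n"
  using assms unfolding Rx_def by blast

lemma Ry_E:
  assumes "a \<in> Ry" obtains p n where "a = ev t p / ev t py ^ n"
  using assms unfolding Ry_def by blast

lemma ev_in_Rx: "ev t p \<in> Rx" by (rule Rx_I[of _ p 0]) simp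
lemma ev_in_Ry: "ev t p \<in> Ry" by (rule Ry_I[of _ p 0]) simp

lemma Rx_add:
  assumes "a \<in> Rx" "b \<in> Rx" shows "a + b \<in> Rx"
proof -
  obtain p n where p: "a = ev t p / ev t px ^ n" using assms(1) by (rule Rx_E)
  obtain q m where q: "b = ev t q / ev t px ^ m" using assms(2) by (rule Rx_E)
  have "a + b = ev t (p * px ^ m + q * px ^ n) / ev t px ^ (n + m)"
    using ev_gens_nz[OF char t] by (simp add: p q v.simps add_frac_eq power_add)
  thus ?thesis by (rule Rx_I)
qed

lemma Rx_mult:
  assumes "a \<in> Rx" "b \<in> Rx" shows "a * b \<in> Rx"
proof -
  obtain p n where p: "a = ev t p / ev t px ^ n" using assms(1) by (rule Rx_E)
  obtain q m where q: "b = ev t q / ev t px ^ m" using assms(2) by (rule Rx_E)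
  have "a * b = ev t (p * q) / ev t px ^ (n + m)" by (simp add: p q v.simps power_add)
  thus ?thesis by (rule Rx_I)
qed

lemma Ry_add:
  assumes "a \<in> Ry" "b \<in> Ry" shows "a + b \<in> Ry"
proof -
  obtain p n where p: "a = ev t p / ev t py ^ n" using assms(1) by (rule Ry_E)
  obtain q m where q: "b = ev t q / ev t py ^ m" using assms(2) by (rule Ry_E)
  have "a + b = ev t (p * py ^ m + q * py ^ n) / ev t py ^ (n + m)"
    using ev_gens_nz[OF char t] by (simp add: p q v.simps add_frac_eq power_add)
  thus ?thesis by (rule Ry_I)
qed

lemma Ry_mult:
  assumes "a \<in> Ry" "b \<in> Ry" shows "a * b \<in> Ry"
proof -
  obtain p n where p: "a = ev t p / ev t py ^ n" using assms(1) by (rule Ry_E)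
  obtain q m where q: "b = ev t q / ev t py ^ m" using assms(2) by (rule Ry_E)
  have "a * b = ev t (p * q) / ev t py ^ (n + m)" by (simp add: p q v.simps power_add)
  thus ?thesis by (rule Ry_I)
qed

abbreviation "xq n \<equiv> ev t px ^ 2 ^ n"
abbreviation "yq n \<equiv> ev t py ^ 2 ^ n"
abbreviation "zq n \<equiv> ev t pz ^ 2 ^ n"
abbreviation "tq n \<equiv> ev t (cst t) ^ 2 ^ n"

lemma two_charts_power: "two_charts (xq n) (yq n) (zq n) (tq n) Rx Ry"
proof -
  have pow: "ev t p ^ m \<in> Rx" "ev t p ^ m \<in> Ry" for p m
    using ev_in_Rx[of "p ^ m"] ev_in_Ry[of "p ^ m"] by (simp_all only: v.power)
  have "1 / xq n \<in> Rx" by (rule Rx_I[of _ 1 "2 ^ n"]) (simp add: v.one)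
  moreover have "1 / yq n \<in> Ry" by (rule Ry_I[of _ 1 "2 ^ n"]) (simp add: v.one)
  moreover have "1 \<in> Rx" "1 \<in> Ry" using ev_in_Rx[of 1] ev_in_Ry[of 1] by (simp_all add: v.one)
  ultimately show ?thesis
    by (intro two_charts.intro two_charts_axioms.intro quartic_point_power[OF char t]
          Rx_add Rx_mult Ry_add Ry_mult pow)
qed

text \<open>\<open>c\<close> kills the \<open>n\<close>-th Frobenius pullback of some class
  \<open>eta A B * (c1, c2, J)\<close> at parameter \<open>lam t i\<close>. Of the two scalars only
  \<open>B \<noteq> 0\<close> is recorded, because \<open>A\<close> has no influence on the survival
  of the class.\<close>

definition descended :: "'k big \<Rightarrow> nat \<Rightarrow> nat \<Rightarrow> bool" where
  "descended c i n \<longleftrightarrow> (\<exists>A B. B \<noteq> 0 \<and>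
     (let k = ev t (cst (lam t i)) ^ 2 ^ n;
          e = ev t (cst A) ^ 2 ^ n / (xq n * yq n) + ev t (cst B) ^ 2 ^ n * (zq n ^ 3 / (xq n ^ 4 * yq n))
      in two_charts.splits Rx Ry ((xq n)\<^sup>2) ((yq n)\<^sup>2) ((zq n)\<^sup>2 + k * xq n * yq n)
           (c * e * quartic_point.c1 (xq n) (yq n) (zq n) k)
           (c * e * quartic_point.c2 (xq n) (yq n) (zq n) k)
           (c * e * quartic_point.J (xq n) (yq n))))"

lemma cst_pow: "ev t (cst a) ^ 2 ^ n \<in> Rx" "ev t (cst a) ^ 2 ^ n \<in> Ry"
  using ev_in_Rx[of "cst a ^ 2 ^ n"] ev_in_Ry[of "cst a ^ 2 ^ n"] by (simp_all only: v.power)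

text \<open>The class of \<open>f\<close> lives on \<open>F^* E_0\<close>; its first wedge image has
  parameter \<open>lam t 1 = t\<close> and scalars \<open>A = 0\<close>,
  \<open>B = 1\<close>.\<close>

lemma descended_start:
  assumes "cp * (py ^ 3 * pz ^ 3) ^ 2 ^ n \<in> frobenius_ideal t (4 * 2 ^ n)"
  shows "descended (ev t cp) 1 n"
proof -
  interpret two_charts "xq n" "yq n" "zq n" "tq n" Rx Ry by (rule two_charts_power)
  obtain a b c d where "cp * (py ^ 3 * pz ^ 3) ^ 2 ^ n
      = a * px ^ (4 * 2 ^ n) + b * py ^ (4 * 2 ^ n) + c * pz ^ (4 * 2 ^ n) + d * quartic t"
    using assms unfolding frobenius_ideal_def by blast
  from arg_cong[OF this, of "ev t"]
  have "ev t cp * yq n ^ 3 * zq n ^ 3 = ev t a * xq n ^ 4 + ev t b * yq n ^ 4 + ev t c * zq n ^ 4"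
    by (simp add: v.simps ev_quartic power_mult_distrib mult_ac flip: power_mult)
  note splits_start[OF cst_pow(1) cst_pow(2) ev_in_Rx ev_in_Ry _ _ this]
  moreover have "{ev t a, ev t b, ev t c} \<subseteq> Rx" "{ev t a, ev t b, ev t c} \<subseteq> Ry"
    using ev_in_Rx ev_in_Ry by auto
  moreover have "ev t (cst 0) ^ 2 ^ n = 0" "ev t (cst 1) ^ 2 ^ n = 1" "lam t 1 = t"
    by (simp_all add: v.simps cs.simps)
  ultimately show ?thesis
    unfolding descended_def Let_def by - (rule exI[of _ 0], rule exI[of _ 1], simp add: power_0_left)
qed

text \<open>All data at level \<open>n + 1\<close> are squares of those at level \<open>n\<close>,
  so \<open>splits_step\<close> spends one Frobenius power to advance the index by one.\<close>

lemma descended_step: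
  assumes S: "descended c i (Suc n)" and c: "c \<in> Rx" "c \<in> Ry" and nz: "lam t (Suc i) \<noteq> 0"
  shows "descended c (Suc i) n"
proof -
  interpret two_charts "xq n" "yq n" "zq n" "tq n" Rx Ry by (rule two_charts_power)
  define l k where "l = lam t i" and "k = lam t (Suc i)"
  define l' k' where "l' = ev t (cst l) ^ 2 ^ n" and "k' = ev t (cst k) ^ 2 ^ n"
  have k: "k = t + l\<^sup>2" by (simp add: k_def l_def)
  have frob: "(a + b) ^ 2 ^ n = a ^ 2 ^ n + b ^ 2 ^ n" for a b :: "'k big"
    by (rule frobenius_add[OF char t])
  have dbl: "w ^ 2 ^ Suc n = (w ^ 2 ^ n)\<^sup>2" for w :: "'k big"
    by (metis mult.commute power_Suc power_mult)
  obtain A B where B: "B \<noteq> 0" and sp: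
    "splits ((xq (Suc n))\<^sup>2) ((yq (Suc n))\<^sup>2) ((zq (Suc n))\<^sup>2 + ev t (cst l) ^ 2 ^ Suc n * xq (Suc n) * yq (Suc n))
      (c * (ev t (cst A) ^ 2 ^ Suc n / (xq (Suc n) * yq (Suc n))
          + ev t (cst B) ^ 2 ^ Suc n * (zq (Suc n) ^ 3 / (xq (Suc n) ^ 4 * yq (Suc n))))
        * quartic_point.c1 (xq (Suc n)) (yq (Suc n)) (zq (Suc n)) (ev t (cst l) ^ 2 ^ Suc n))
      (c * (ev t (cst A) ^ 2 ^ Suc n / (xq (Suc n) * yq (Suc n))
          + ev t (cst B) ^ 2 ^ Suc n * (zq (Suc n) ^ 3 / (xq (Suc n) ^ 4 * yq (Suc n))))
        * quartic_point.c2 (xq (Suc n)) (yq (Suc n)) (zq (Suc n)) (ev t (cst l) ^ 2 ^ Suc n))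
      (c * (ev t (cst A) ^ 2 ^ Suc n / (xq (Suc n) * yq (Suc n))
          + ev t (cst B) ^ 2 ^ Suc n * (zq (Suc n) ^ 3 / (xq (Suc n) ^ 4 * yq (Suc n))))
        * quartic_point.J (xq (Suc n)) (yq (Suc n)))"
    using S unfolding descended_def Let_def l_def[symmetric] by blast
  define A' B' where "A' = ev t (cst A) ^ 2 ^ n" and "B' = ev t (cst B) ^ 2 ^ n"
  have J2: "quartic_point.J (xq (Suc n)) (yq (Suc n)) = J\<^sup>2"
    and c12: "quartic_point.c1 (xq (Suc n)) (yq (Suc n)) (zq (Suc n)) (ev t (cst l) ^ 2 ^ Suc n) = (c1 l')\<^sup>2"
    and c22: "quartic_point.c2 (xq (Suc n)) (yq (Suc n)) (zq (Suc n)) (ev t (cst l) ^ 2 ^ Suc n) = (c2 l')\<^sup>2"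
    unfolding dbl l'_def[symmetric]
      quartic_point.J_def[OF frobenius_square] quartic_point.c1_def[OF frobenius_square]
      quartic_point.c2_def[OF frobenius_square] J_def c1_def c2_def
    by (simp_all only: quartic_point.square_add[OF quartic_point_axioms] power_mult_distrib)
       (simp_all flip: power_mult)
  have eta2: "ev t (cst A) ^ 2 ^ Suc n / (xq (Suc n) * yq (Suc n))
          + ev t (cst B) ^ 2 ^ Suc n * (zq (Suc n) ^ 3 / (xq (Suc n) ^ 4 * yq (Suc n))) = (eta A' B')\<^sup>2"
    unfolding dbl A'_def[symmetric] B'_def[symmetric]
      quartic_point.square_add[OF quartic_point_axioms] power_mult_distrib power_divide
    by (simp flip: power_mult)
  have D2: "(zq (Suc n))\<^sup>2 + ev t (cst l) ^ 2 ^ Suc n * xq (Suc n) * yq (Suc n) = ((zq n)\<^sup>2 + l' * xq n * yq n)\<^sup>2"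
    unfolding dbl l'_def[symmetric]
      quartic_point.square_add[OF quartic_point_axioms] power_mult_distrib by simp
  have X4: "(xq (Suc n))\<^sup>2 = xq n ^ 4" "(yq (Suc n))\<^sup>2 = yq n ^ 4"
    unfolding dbl by (simp_all add: mult.commute flip: power_mult)
  have k': "k' = tq n + l'\<^sup>2"
    by (simp add: k'_def k cs.simps v.simps frob l'_def mult.commute flip: power_mult)
  have AB: "A' \<in> Rx" "A' \<in> Ry" "B' \<in> Rx" "B' \<in> Ry" "k' \<in> Rx" "k' \<in> Ry"
    unfolding A'_def B'_def k'_def by (rule cst_pow)+
  define A1 where "A1 = k * A\<^sup>2 + (t + k\<^sup>2) * (k + 1) * B\<^sup>2"
  define B1 where "B1 = k * B\<^sup>2"
  have A1: "ev t (cst A1) ^ 2 ^ n = k' * A'\<^sup>2 + (tq n + k'\<^sup>2) * (k' + 1) * B'\<^sup>2"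
    and B1: "ev t (cst B1) ^ 2 ^ n = k' * B'\<^sup>2"
    by (simp_all add: A1_def B1_def cs.simps v.simps frob power_mult_distrib A'_def B'_def k'_def
          mult.commute flip: power_mult)
  have "B1 \<noteq> 0" using B nz by (simp add: B1_def k_def del: lam.simps)
  moreover note splits_step[OF k' AB(5,6) AB(1-4) c sp[unfolded J2 c12 c22 eta2 D2 X4],
      folded A1 B1, unfolded k'_def k_def]
  ultimately show ?thesis unfolding descended_def Let_def by blast
qed

text \<open>Two Frobenius powers are spent at once. With \<open>k = lam t (i + 1)\<close>, the
  vanishing of \<open>lam t (i + 2)\<close> is the condition \<open>k^2 = t\<close> of
  \<open>splits_end\<close>; the scalar \<open>t B^4\<close> is a unit and is divided out.\<close>

lemma descended_end:
  assumes S: "descended c i (n + 2)" and c: "c \<in> Rx" "c \<in> Ry" and z: "lam t (i + 2) = 0"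
  shows "\<exists>u\<in>Rx. \<exists>w\<in>Ry. c * (zq n ^ 3 / ((xq n)\<^sup>2 * (yq n)\<^sup>2) + zq n / (xq n * yq n)) = u + w"
proof -
  interpret two_charts "xq n" "yq n" "zq n" "tq n" Rx Ry by (rule two_charts_power)
  define l k where "l = lam t i" and "k = lam t (Suc i)"
  define l' k' where "l' = ev t (cst l) ^ 2 ^ n" and "k' = ev t (cst k) ^ 2 ^ n"
  have k: "k = t + l\<^sup>2" by (simp add: k_def l_def)
  have tk: "t + k\<^sup>2 = 0" using z by (simp add: k_def)
  have frob: "(a + b) ^ 2 ^ n = a ^ 2 ^ n + b ^ 2 ^ n" for a b :: "'k big"
    by (rule frobenius_add[OF char t])
  have add4: "(a + b) ^ 4 = a ^ 4 + b ^ 4" for a b :: "'k big"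
    using frobenius_add[OF char t, of a b 2] by simp
  have dbl: "w ^ 2 ^ (n + 2) = (w ^ 2 ^ n) ^ 4" for w :: "'k big"
    by (simp add: power_add mult.commute flip: power_mult)
  obtain A B where B: "B \<noteq> 0" and sp:
    "splits ((xq (n + 2))\<^sup>2) ((yq (n + 2))\<^sup>2) ((zq (n + 2))\<^sup>2 + ev t (cst l) ^ 2 ^ (n + 2) * xq (n + 2) * yq (n + 2))
      (c * (ev t (cst A) ^ 2 ^ (n + 2) / (xq (n + 2) * yq (n + 2))
          + ev t (cst B) ^ 2 ^ (n + 2) * (zq (n + 2) ^ 3 / (xq (n + 2) ^ 4 * yq (n + 2))))
        * quartic_point.c1 (xq (n + 2)) (yq (n + 2)) (zq (n + 2)) (ev t (cst l) ^ 2 ^ (n + 2)))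
      (c * (ev t (cst A) ^ 2 ^ (n + 2) / (xq (n + 2) * yq (n + 2))
          + ev t (cst B) ^ 2 ^ (n + 2) * (zq (n + 2) ^ 3 / (xq (n + 2) ^ 4 * yq (n + 2))))
        * quartic_point.c2 (xq (n + 2)) (yq (n + 2)) (zq (n + 2)) (ev t (cst l) ^ 2 ^ (n + 2)))
      (c * (ev t (cst A) ^ 2 ^ (n + 2) / (xq (n + 2) * yq (n + 2))
          + ev t (cst B) ^ 2 ^ (n + 2) * (zq (n + 2) ^ 3 / (xq (n + 2) ^ 4 * yq (n + 2))))
        * quartic_point.J (xq (n + 2)) (yq (n + 2)))"
    using S unfolding descended_def Let_def l_def[symmetric] by blast
  define A' B' where "A' = ev t (cst A) ^ 2 ^ n" and "B' = ev t (cst B) ^ 2 ^ n"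
  note q2 = quartic_point_power[OF char t, of "n + 2"]
  have J4: "quartic_point.J (xq (n + 2)) (yq (n + 2)) = J ^ 4"
    and c14: "quartic_point.c1 (xq (n + 2)) (yq (n + 2)) (zq (n + 2)) (ev t (cst l) ^ 2 ^ (n + 2)) = (c1 l') ^ 4"
    and c24: "quartic_point.c2 (xq (n + 2)) (yq (n + 2)) (zq (n + 2)) (ev t (cst l) ^ 2 ^ (n + 2)) = (c2 l') ^ 4"
    unfolding quartic_point.J_def[OF q2] quartic_point.c1_def[OF q2]
      quartic_point.c2_def[OF q2] J_def c1_def c2_def
    unfolding dbl l'_def[symmetric]
    by (simp_all only: add4 power_mult_distrib) (simp_all flip: power_mult)
  have eta4: "ev t (cst A) ^ 2 ^ (n + 2) / (xq (n + 2) * yq (n + 2))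
          + ev t (cst B) ^ 2 ^ (n + 2) * (zq (n + 2) ^ 3 / (xq (n + 2) ^ 4 * yq (n + 2))) = (eta A' B') ^ 4"
    unfolding dbl A'_def[symmetric] B'_def[symmetric] add4 power_mult_distrib power_divide
    by (simp flip: power_mult)
  have D4: "(zq (n + 2))\<^sup>2 + ev t (cst l) ^ 2 ^ (n + 2) * xq (n + 2) * yq (n + 2) = ((zq n)\<^sup>2 + l' * xq n * yq n) ^ 4"
    unfolding dbl l'_def[symmetric] add4 power_mult_distrib by (simp flip: power_mult)
  have X8: "(xq (n + 2))\<^sup>2 = xq n ^ 8" "(yq (n + 2))\<^sup>2 = yq n ^ 8"
    unfolding dbl by (simp_all add: mult.commute flip: power_mult)
  have k': "k' = tq n + l'\<^sup>2"
    by (simp add: k'_def k cs.simps v.simps frob l'_def mult.commute flip: power_mult)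
  have "tq n + k'\<^sup>2 = ev t (cst (t + k\<^sup>2)) ^ 2 ^ n"
    by (simp add: k'_def cs.simps v.simps frob mult.commute flip: power_mult)
  hence "tq n + k'\<^sup>2 = 0" unfolding tk by (simp add: cs.simps v.simps)
  hence k2: "k'\<^sup>2 = tq n" by (simp add: add_eq_0_iff)
  have AB: "A' \<in> Rx" "A' \<in> Ry" "B' \<in> Rx" "B' \<in> Ry"
    unfolding A'_def B'_def by (rule cst_pow)+
  obtain u w where uw: "u \<in> Rx" "w \<in> Ry" "c * tq n * B' ^ 4
      * (zq n ^ 3 / ((xq n)\<^sup>2 * (yq n)\<^sup>2) + zq n / (xq n * yq n)) = u + w"
    using splits_end[OF k' k2 AB c sp[unfolded J4 c14 c24 eta4 D4 X8]] by blast
  define g where "g = cst (t * B ^ 4) ^ 2 ^ n"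
  define h where "h = ev t (cst (1 / (t * B ^ 4)) ^ 2 ^ n)"
  have "h * (tq n * B' ^ 4) = ev t (cst (1 / (t * B ^ 4) * (t * B ^ 4)) ^ 2 ^ n)"
    by (simp only: h_def B'_def cs.mult cs.power v.mult v.power power_mult_distrib)
       (simp add: mult.commute flip: power_mult)
  also have "\<dots> = 1" using t B by (simp add: cs.one v.one)
  finally have h: "h * (tq n * B' ^ 4) = 1" .
  have "c * (zq n ^ 3 / ((xq n)\<^sup>2 * (yq n)\<^sup>2) + zq n / (xq n * yq n))
    = (h * (tq n * B' ^ 4)) * (c * (zq n ^ 3 / ((xq n)\<^sup>2 * (yq n)\<^sup>2) + zq n / (xq n * yq n)))"
    unfolding h by simp
  also have "\<dots> = h * (c * tq n * B' ^ 4
      * (zq n ^ 3 / ((xq n)\<^sup>2 * (yq n)\<^sup>2) + zq n / (xq n * yq n)))"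
    by (simp only: mult_ac)
  also have "\<dots> = h * u + h * w" unfolding uw(3) by (rule distrib_left)
  finally show ?thesis
    using Rx_mult[OF _ uw(1), of h] Ry_mult[OF _ uw(2), of h] ev_in_Rx ev_in_Ry
    unfolding h_def by blast
qed

lemma descended_iterate:
  assumes S: "\<And>n. descended c 1 n" and c: "c \<in> Rx" "c \<in> Ry"
    and nz: "\<And>j. 1 \<le> j \<Longrightarrow> j \<le> i \<Longrightarrow> lam t j \<noteq> 0" and i: "i \<ge> 1"
  shows "descended c i n"
  using i nz
proof (induction i arbitrary: n rule: nat_induct_at_least)
  case base
  show ?case by (rule S)
next
  case (Suc i)
  show ?case by (rule descended_step[OF Suc.IH c]) (use Suc.prems in \<open>auto simp del: lam.simps\<close>)
qed

text \<open>The surviving class is represented by \<open>cp * W / (x^(2q) y^(2q))\<close>. A sum of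
  sections over the two charts has no monomial with negative exponents in both \<open>x\<close> and
  \<open>y\<close>. As \<open>cp\<close> is free of \<open>z\<close>, the product
  \<open>cp * W\<close> is still a normal form, so this can be read off its coefficients.\<close>

lemma coefficient_vanishes:
  assumes H: "\<And>n. [:cp:] * (py ^ 3 * pz ^ 3) ^ 2 ^ n \<in> frobenius_ideal t (4 * 2 ^ n)"
    and z: "lam t m = 0" "m \<ge> 3" "\<And>j. 1 \<le> j \<Longrightarrow> j < m \<Longrightarrow> lam t j \<noteq> 0"
    and W: "quartic t dvd (pz ^ 3 + px * py * pz) ^ 2 ^ n - W" "degree W < 4"
    and ij: "i < 2 * 2 ^ n" "j < 2 * 2 ^ n"
  shows "coeff (coeff (cp * coeff W 0) j) i = 0"
proof -
  define q :: nat where "q = 2 ^ n"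
  define C where "C = ev t [:cp:]"
  define X' Y' where "X' = ev t px" and "Y' = ev t py"
  have nz: "X' \<noteq> 0" "Y' \<noteq> 0" using ev_gens_nz[OF char t] by (simp_all add: X'_def Y'_def)
  \<comment> \<open>The last move goes from \<open>m - 2\<close> directly to the zero at
    \<open>m\<close>, and \<open>m \<ge> 3\<close> makes the index \<open>m - 2\<close> at least 1,
    where the descent starts.\<close>
  have D: "descended C (m - 2) (n + 2)"
    unfolding C_def
    by (rule descended_iterate[OF descended_start[OF H] ev_in_Rx ev_in_Ry]) (use z in auto)
  have "m - 2 + 2 = m" using z(2) by simp
  hence "lam t (m - 2 + 2) = 0" using z(1) by (simp only:)
  from descended_end[OF D _ _ this] obtain u w where uw: "u \<in> Rx" "w \<in> Ry"
    and eq: "C * (zq n ^ 3 / ((xq n)\<^sup>2 * (yq n)\<^sup>2) + zq n / (xq n * yq n)) = u + w"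
    using ev_in_Rx ev_in_Ry unfolding C_def by blast
  obtain p a where p: "u = ev t p / X' ^ a" using uw(1) unfolding X'_def by (rule Rx_E)
  obtain r b where r: "w = ev t r / Y' ^ b" using uw(2) unfolding Y'_def by (rule Ry_E)
  have "quartic t dvd (pz ^ 3 + px * py * pz) ^ 2 ^ n - W" by (rule W)
  hence "ev t ((pz ^ 3 + px * py * pz) ^ 2 ^ n) = ev t W"
    by (auto simp: v.mult v.diff ev_quartic right_minus_eq dest!: arg_cong[of _ _ "ev t"] elim!: dvdE)
  hence evW: "ev t W = zq n ^ 3 + xq n * yq n * zq n"
    by (simp add: v.simps frobenius_add[OF char t] power_mult_distrib mult.commute flip: power_mult)
  have "C * (ev t W / (X' ^ (2 * q) * Y' ^ (2 * q))) = ev t p / X' ^ a + ev t r / Y' ^ b"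
  proof -
    have "zq n ^ 3 / ((xq n)\<^sup>2 * (yq n)\<^sup>2) + zq n / (xq n * yq n) = ev t W / ((xq n)\<^sup>2 * (yq n)\<^sup>2)"
      unfolding evW using nz by (simp add: X'_def Y'_def add_divide_distrib power2_eq_square)
    thus ?thesis using eq by (simp add: p r X'_def Y'_def q_def mult.commute flip: power_mult)
  qed
  note frac = this
  have gen: "C * W * (A * B) = p * (P * (R * B)) + r * ((P * A) * R)"
    if "C * (W / (P * R)) = p / A + r / B" "P \<noteq> 0" "R \<noteq> 0" "A \<noteq> 0" "B \<noteq> 0"
    for C W P R A B p r :: "'k big"
  proof -
    have "C * W * (A * B) = C * (W / (P * R)) * (P * R) * (A * B)" using that(2,3) by simp
    also have "\<dots> = (p / A * A) * (P * (R * B)) + (r / B * B) * ((P * A) * R)"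
      unfolding that(1) by (simp only: distrib_left distrib_right mult_ac)
    finally show ?thesis using that(4,5) by simp
  qed
  have "C * ev t W * (X' ^ a * Y' ^ b) = ev t p * (X' ^ (2 * q) * (Y' ^ (2 * q) * Y' ^ b))
      + ev t r * ((X' ^ (2 * q) * X' ^ a) * Y' ^ (2 * q))"
    by (rule gen[OF frac]) (use nz in simp_all)
  hence main: "ev t ([:cp:] * W * mon3 a b 0) = ev t (p * mon3 (2 * q) (2 * q + b) 0 + r * mon3 (2 * q + a) (2 * q) 0)"
    by (simp only: C_def X'_def Y'_def mon3_def v.simps power_add power_0 mult_1_right)
  obtain p1 p0 where p0: "p = quartic t * p1 + p0" "degree p0 < 4"
    by (rule quartic_division)
  obtain r1 r0 where r0: "r = quartic t * r1 + r0" "degree r0 < 4"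
    by (rule quartic_division)
  have m0: "mon3 a b 0 = ([: monom (monom 1 a) b :] :: 'k poly poly poly)" for a b
    by (simp add: mono_eq monom_0)
  have deg: "degree (s * mon3 a b 0) < 4" if "degree s < 4" for s :: "'k poly poly poly" and a b
    using that degree_mult_le[of s "mon3 a b 0"] by (simp add: m0)
  define E where "E = p0 * mon3 (2 * q) (2 * q + b) 0 + r0 * mon3 (2 * q + a) (2 * q) 0"
  have "ev t E = ev t ([:cp:] * W * mon3 a b 0)"
    unfolding main E_def by (simp add: p0(1) r0(1) v.simps ev_quartic)
  hence "ev t ([:cp:] * W * mon3 a b 0 - E) = 0" by (simp add: v.diff)
  moreover have "degree ([:cp:] * W * mon3 a b 0 - E) < 4"
    unfolding E_def
    using W(2) p0(2) r0(2) degree_mult_le[of "[:cp:]" W]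
    by (intro degree_diff_less degree_add_less deg) simp_all
  ultimately have "[:cp:] * W * mon3 a b 0 - E = 0" by (rule ev_nz[OF char t])
  hence "[:cp:] * W * mon3 a b 0 = E" by simp
  hence "coeff3 ([:cp:] * W * mon3 a b 0) (i + a) (j + b) 0 = coeff3 E (i + a) (j + b) 0" by simp
  moreover have "coeff3 E (i + a) (j + b) 0 = 0"
    using ij by (simp add: E_def q_def mult.commute[of _ "mon3 _ _ _"] coeff3_mono_mult)
  moreover have "coeff3 ([:cp:] * W * mon3 a b 0) (i + a) (j + b) 0 = coeff3 ([:cp:] * W) i j 0"
    unfolding mult.commute[of "[:cp:] * W"] coeff3_mono_mult by simp
  ultimately have "coeff3 ([:cp:] * W) i j 0 = 0" by simp
  thus ?thesis by (simp add: coeff3_def)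
qed

end

subsection \<open>The Frobenius orbit of \<open>z\<^sup>3 + x y z\<close>\<close>

text \<open>The \<open>z\<close>-coefficients of the normal form of
  \<open>(z^3 + x y z)^(2^n)\<close>, by a recursion that commutes with specialising
  \<open>t\<close> and lets the degree in \<open>t\<close> be followed.\<close>

primrec wz :: "'a::comm_ring_1 \<Rightarrow> nat \<Rightarrow> 'a poly poly \<times> 'a poly poly \<times> 'a poly poly \<times> 'a poly poly" where
  "wz t 0 = (0, [:[:0, 1:]:] * [:0, 1:], 0, 1)"
| "wz t (Suc n) = (let (w0, w1, w2, w3) = wz t n; T = [:[:t:]:]; x = [:[:0, 1:]:]; y = [:0, 1:] in
     (w0\<^sup>2 + T * x\<^sup>2 * y\<^sup>2 * w2\<^sup>2 + T * x ^ 3 * y ^ 3 * w3\<^sup>2,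
      (x ^ 3 + y ^ 3) * w2\<^sup>2 + x * y * (x ^ 3 + y ^ 3) * w3\<^sup>2,
      w1\<^sup>2 + x * y * w2\<^sup>2 + (1 + T) * x\<^sup>2 * y\<^sup>2 * w3\<^sup>2,
      (x ^ 3 + y ^ 3) * w3\<^sup>2))"

lemma char2_square_add:
  assumes "CHAR('a::comm_ring_1) = 2"
  shows "(a + b)\<^sup>2 = a\<^sup>2 + (b :: 'a)\<^sup>2"
proof -
  have "(a + b)\<^sup>2 = a\<^sup>2 + b\<^sup>2 + (a * b + a * b)" by (simp add: power2_eq_square algebra_simps)
  thus ?thesis by (simp only: char2_add_self[OF assms] add_0_right)
qed

text \<open>Squaring is additive, so only \<open>z^4\<close> and \<open>z^6\<close> have to be
  reduced; the last summand is the multiple of the quartic used for that.\<close>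

lemma square_mod_quartic:
  fixes x y z t a b c d :: "'a::comm_ring_1"
  assumes two: "\<And>a. a + a = (0::'a)"
  defines "F \<equiv> z ^ 4 + x * y * z\<^sup>2 + (x ^ 3 + y ^ 3) * z + t * x\<^sup>2 * y\<^sup>2"
  shows "(a + b * z + c * z\<^sup>2 + d * z ^ 3)\<^sup>2 =
    (a\<^sup>2 + t * x\<^sup>2 * y\<^sup>2 * c\<^sup>2 + t * x ^ 3 * y ^ 3 * d\<^sup>2)
    + ((x ^ 3 + y ^ 3) * c\<^sup>2 + x * y * (x ^ 3 + y ^ 3) * d\<^sup>2) * z
    + (b\<^sup>2 + x * y * c\<^sup>2 + (1 + t) * x\<^sup>2 * y\<^sup>2 * d\<^sup>2) * z\<^sup>2
    + ((x ^ 3 + y ^ 3) * d\<^sup>2) * z ^ 3 + F * (c\<^sup>2 + d\<^sup>2 * (z\<^sup>2 + x * y))"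
proof -
  have two': "a + (a + b) = b" for a b :: 'a using two by (simp flip: add.assoc)
  show ?thesis unfolding F_def
    by (simp add: algebra_simps numeral_eq_Suc two two')
qed

lemma wz_correct:
  fixes t :: "'a::comm_ring_1"
  assumes char: "CHAR('a) = 2"
  shows "case wz t n of (w0, w1, w2, w3) \<Rightarrow>
     quartic t dvd (pz ^ 3 + px * py * pz) ^ 2 ^ n - [:w0, w1, w2, w3:]"
proof (induction n)
  case 0
  have "pz ^ 3 + px * py * pz = [:0, [:[:0, 1:]:] * [:0, 1:], 0, 1 :: 'a poly poly:]"
    by (simp add: px_def py_def pz_def power3_eq_cube)
  thus ?case unfolding wz.simps prod.case by (simp only: power_0 power_one_right diff_self dvd_0_right)
next
  case (Suc n)
  obtain w0 w1 w2 w3 where w: "wz t n = (w0, w1, w2, w3)" by (cases "wz t n")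
  define P where "P = (pz ^ 3 + px * py * pz :: 'a poly poly poly)"
  obtain h where h: "P ^ 2 ^ n - [:w0, w1, w2, w3:] = quartic t * h"
    using Suc.IH by (auto simp: w P_def)
  have split: "[:a, b, c, d:] = [:a:] + [:b:] * pz + [:c:] * pz\<^sup>2 + [:d:] * pz ^ 3" for a b c d :: "'a poly poly"
    by (simp add: pz_def numeral_eq_Suc)
  have two: "a + a = 0" for a :: "'a poly poly poly"
    by (rule char2_add_self) (simp add: char)
  define v0 v1 v2 v3 where
    "v0 = w0\<^sup>2 + [:[:t:]:] * [:[:0, 1:]:]\<^sup>2 * [:0, 1:]\<^sup>2 * w2\<^sup>2 + [:[:t:]:] * [:[:0, 1:]:] ^ 3 * [:0, 1:] ^ 3 * w3\<^sup>2"
    and "v1 = ([:[:0, 1:]:] ^ 3 + [:0, 1:] ^ 3) * w2\<^sup>2 + [:[:0, 1:]:] * [:0, 1:] * ([:[:0, 1:]:] ^ 3 + [:0, 1:] ^ 3) * w3\<^sup>2"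
    and "v2 = w1\<^sup>2 + [:[:0, 1:]:] * [:0, 1:] * w2\<^sup>2 + (1 + [:[:t:]:]) * [:[:0, 1:]:]\<^sup>2 * [:0, 1:]\<^sup>2 * w3\<^sup>2"
    and "v3 = ([:[:0, 1:]:] ^ 3 + [:0, 1:] ^ 3) * w3\<^sup>2"
  note v_defs = v0_def v1_def v2_def v3_def
  have v: "wz t (Suc n) = (v0, v1, v2, v3)"
    unfolding wz.simps w Let_def prod.case v_defs by (rule refl)
  interpret k: ring_map "\<lambda>w :: 'a poly poly. [:w:]"
    by standard (simp_all add: one_pCons)
  have "P ^ 2 ^ n = [:w0, w1, w2, w3:] + quartic t * h" using h by (simp add: algebra_simps)
  hence "P ^ 2 ^ Suc n = ([:w0, w1, w2, w3:] + quartic t * h)\<^sup>2"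
    by (metis mult.commute power_Suc power_mult)
  also have "\<dots> = [:w0, w1, w2, w3:]\<^sup>2 + (quartic t * h)\<^sup>2"
    by (rule char2_square_add) (simp add: char)
  also have "[:w0, w1, w2, w3:]\<^sup>2 = [:v0, v1, v2, v3:]
      + quartic t * ([:w2:]\<^sup>2 + [:w3:]\<^sup>2 * (pz\<^sup>2 + px * py))"
  proof -
    have V: "[:v0:] = [:w0:]\<^sup>2 + cst t * px\<^sup>2 * py\<^sup>2 * [:w2:]\<^sup>2 + cst t * px ^ 3 * py ^ 3 * [:w3:]\<^sup>2"
      "[:v1:] = (px ^ 3 + py ^ 3) * [:w2:]\<^sup>2 + px * py * (px ^ 3 + py ^ 3) * [:w3:]\<^sup>2"
      "[:v2:] = [:w1:]\<^sup>2 + px * py * [:w2:]\<^sup>2 + (1 + cst t) * px\<^sup>2 * py\<^sup>2 * [:w3:]\<^sup>2"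
      "[:v3:] = (px ^ 3 + py ^ 3) * [:w3:]\<^sup>2"
      unfolding v_defs px_def py_def cst_def by (simp_all only: k.simps)
    show ?thesis
      unfolding split[of w0 w1 w2 w3] split[of v0 v1 v2 v3]
      unfolding V quartic_def
      by (rule square_mod_quartic[OF two])
  qed
  finally have "P ^ 2 ^ Suc n - [:v0, v1, v2, v3:] =
      quartic t * ([:w2:]\<^sup>2 + [:w3:]\<^sup>2 * (pz\<^sup>2 + px * py)) + (quartic t * h)\<^sup>2" by simp
  moreover have "quartic t dvd \<dots>" by (intro dvd_add) (simp_all add: power2_eq_square)
  ultimately show ?case unfolding P_def[symmetric] v by simp
qed

lemma wz_map:
  assumes "ring_map f"
  shows "wz (f t) n = (case wz t n of (w0, w1, w2, w3) \<Rightarrow>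
    (map_poly (map_poly f) w0, map_poly (map_poly f) w1, map_poly (map_poly f) w2, map_poly (map_poly f) w3))"
proof -
  interpret f: ring_map f by fact
  interpret f1: ring_map "map_poly f" by (rule f.ring_map_map_poly)
  interpret f2: ring_map "map_poly (map_poly f)" by (rule f1.ring_map_map_poly)
  have xyt: "map_poly (map_poly f) [:[:0, 1:]:] = [:[:0, 1:]:]" "map_poly (map_poly f) [:0, 1:] = [:0, 1:]"
    "map_poly (map_poly f) [:[:t:]:] = [:[:f t:]:]"
    by (simp_all add: f.map_poly_pCons f1.map_poly_pCons f.simps f1.simps)
  show ?thesis
  proof (induction n)
    case 0
    show ?case by (simp only: wz.simps prod.case f2.zero f2.one f2.mult xyt)
  next
    case (Suc n)
    obtain w0 w1 w2 w3 where w: "wz t n = (w0, w1, w2, w3)" by (cases "wz t n")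
    show ?case
      unfolding wz.simps Suc.IH w
      by (simp only: Let_def prod.case f2.add f2.mult f2.power f2.one xyt)
  qed
qed

text \<open>Meant for polynomials in \<open>t, x, y\<close>: the innermost variable
  \<open>px\<close> now stands for \<open>t\<close>, while \<open>py\<close> and \<open>pz\<close>
  stand for \<open>x\<close> and \<open>y\<close>. So this bounds the degree in
  \<open>t\<close>.\<close>

definition tle :: "'a::zero poly poly poly \<Rightarrow> nat \<Rightarrow> bool" where
  "tle p d \<longleftrightarrow> (\<forall>i j l. coeff3 p i j l \<noteq> 0 \<longrightarrow> i \<le> d)"

lemma tle_add: "tle p d \<Longrightarrow> tle q d \<Longrightarrow> tle (p + q) d"
  for p q :: "'a::comm_ring_1 poly poly poly"
  unfolding tle_def coeff3_add by (metis add.right_neutral)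

lemma tle_weaken: "tle p d \<Longrightarrow> d \<le> e \<Longrightarrow> tle p e"
  unfolding tle_def using order_trans by blast

lemma tle_mult:
  fixes p q :: "'a::comm_ring_1 poly poly poly"
  assumes "tle p d" "tle q e" "d + e \<le> f"
  shows "tle (p * q) f"
  unfolding tle_def
proof (intro allI impI)
  fix i j l assume "coeff3 (p * q) i j l \<noteq> 0"
  then obtain l' where "(\<Sum>j'\<le>j. \<Sum>i'\<le>i. coeff3 p i' j' l' * coeff3 q (i - i') (j - j') (l - l')) \<noteq> 0"
    unfolding coeff3_mult by (rule sum.not_neutral_contains_not_neutral)
  then obtain j' where "(\<Sum>i'\<le>i. coeff3 p i' j' l' * coeff3 q (i - i') (j - j') (l - l')) \<noteq> 0"
    by (rule sum.not_neutral_contains_not_neutral)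
  then obtain i' where i: "i' \<in> {..i}" and "coeff3 p i' j' l' * coeff3 q (i - i') (j - j') (l - l') \<noteq> 0"
    by (rule sum.not_neutral_contains_not_neutral)
  hence "coeff3 p i' j' l' \<noteq> 0" "coeff3 q (i - i') (j - j') (l - l') \<noteq> 0" by auto
  hence "i' \<le> d" "i - i' \<le> e" using assms unfolding tle_def by blast+
  thus "i \<le> f" using i assms(3) by simp
qed

lemma tle_mono: "a \<le> d \<Longrightarrow> tle (mon3 a b c) d"
  by (auto simp: tle_def coeff3_mono)

lemma tle_simps:
  fixes x y t :: "'a::comm_ring_1 poly poly poly"
  defines "t \<equiv> px" and "x \<equiv> py" and "y \<equiv> pz"
  shows "tle t 1" "tle (x ^ n) 0" "tle (y ^ n) 0" "tle (x ^ n + y ^ n) 0" "tle (1 + t) 1"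
    "tle x 0" "tle y 0"
  using tle_mono[of 1 1 0 0] tle_mono[of 0 0 n 0] tle_mono[of 0 0 0 n]
    tle_add[OF tle_mono[of 0 0 n 0] tle_mono[of 0 0 0 n]]
    tle_add[OF tle_mono[of 0 1 0 0] tle_mono[of 1 1 0 0]]
    tle_mono[of 0 0 1 0] tle_mono[of 0 0 0 1]
  by (simp_all add: mon3_def t_def x_def y_def)

lemma tle_square: "tle p d \<Longrightarrow> 2 * d \<le> e \<Longrightarrow> tle (p\<^sup>2) e"
  for p :: "'a::comm_ring_1 poly poly poly"
  unfolding power2_eq_square by (rule tle_mult) auto

text \<open>The constant coefficient has the isolated leading \<open>t\<close>-term \<open>t\<^bsup>3q/4\<^esup> (x y)\<^bsup>3q/2\<^esup>\<close>, \<open>q = 2\<^sup>e\<close>.\<close>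

lemma wz_leading:
  assumes char: "CHAR('a::comm_ring_1) = 2"
  shows "\<exists>V w1 w2 w3. wz [:0, 1::'a:] (n + 2) =
      (mon3 (3 * 2 ^ n) (6 * 2 ^ n) (6 * 2 ^ n) + V, w1, w2, w3) \<and>
    tle V (3 * 2 ^ n - 1) \<and> tle w1 (2 * 2 ^ n) \<and> tle w2 (2 * 2 ^ n) \<and> tle w3 0"
proof (induction n)
  case 0
  define x y T where "x = (py :: 'a poly poly poly)" and "y = (pz :: 'a poly poly poly)"
    and "T = (px :: 'a poly poly poly)"
  have xyT: "[:[:0, 1:]:] = x" "[:0, 1:] = y" "[:[:[:0, 1:]:]:] = T"
    by (simp_all add: x_def y_def T_def px_def py_def pz_def)
  have two: "a + a = 0" for a :: "'a poly poly poly"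
    by (rule char2_add_self) (simp add: char)
  have two': "a + (a + b) = b" for a b :: "'a poly poly poly" using two by (simp flip: add.assoc)
  have 1: "wz [:0, 1:] 1 = (T * x ^ 3 * y ^ 3, x * y * (x ^ 3 + y ^ 3), T * x\<^sup>2 * y\<^sup>2, x ^ 3 + y ^ 3)"
    unfolding One_nat_def wz.simps xyT Let_def prod.case
    by (simp add: algebra_simps two two' power2_eq_square)
  have 2: "wz [:0, 1:] (0 + 2) =
     (mon3 (3 * 2 ^ 0) (6 * 2 ^ 0) (6 * 2 ^ 0) + (T\<^sup>2 * x ^ 6 * y ^ 6 + T * x ^ 3 * y ^ 3 * (x ^ 3 + y ^ 3)\<^sup>2),
      (x ^ 3 + y ^ 3) * (T * x\<^sup>2 * y\<^sup>2)\<^sup>2 + x * y * (x ^ 3 + y ^ 3) * (x ^ 3 + y ^ 3)\<^sup>2,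
      (x * y * (x ^ 3 + y ^ 3))\<^sup>2 + x * y * (T * x\<^sup>2 * y\<^sup>2)\<^sup>2 + (1 + T) * x\<^sup>2 * y\<^sup>2 * (x ^ 3 + y ^ 3)\<^sup>2,
      (x ^ 3 + y ^ 3) * (x ^ 3 + y ^ 3)\<^sup>2)"
  proof -
    \<comment> \<open>Source of the leading term: \<open>w2\<close> already carries a factor
      \<open>T\<close>, and the recursion multiplies its square by another one.\<close>
    have "mon3 (3 * 2 ^ 0) (6 * 2 ^ 0) (6 * 2 ^ 0) = T * x\<^sup>2 * y\<^sup>2 * (T * x\<^sup>2 * y\<^sup>2)\<^sup>2"
      by (simp add: mon3_def x_def y_def T_def numeral_eq_Suc mult_ac)
    moreover have "(T * x ^ 3 * y ^ 3)\<^sup>2 = T\<^sup>2 * x ^ 6 * y ^ 6"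
      by (simp add: power_mult_distrib flip: power_mult)
    moreover have "wz [:0, 1:] (0 + 2) = wz [:0, 1::'a:] (Suc 1)" by (simp only: numeral_2_eq_2 One_nat_def add_0)
    ultimately show ?thesis
      unfolding wz.simps(2) 1 xyT Let_def prod.case by (simp only: add_ac)
  qed
  note T = tle_mult tle_add tle_square tle_simps[where 'a = 'a, folded x_def y_def T_def]
  have cube: "tle (x ^ 3 + y ^ 3) 0" by (rule T(7))
  have Tx: "tle (T * x\<^sup>2 * y\<^sup>2) 1"
    by (rule tle_mult[OF tle_mult[OF T(4) T(5), of 1] T(6)]) simp_all
  have J2: "tle ((x ^ 3 + y ^ 3)\<^sup>2) 0" by (rule tle_square[OF cube]) simp
  have xy: "tle (x * y) 0" by (rule tle_mult[OF T(9,10)]) simp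
  have "tle (T\<^sup>2 * x ^ 6 * y ^ 6 + T * x ^ 3 * y ^ 3 * (x ^ 3 + y ^ 3)\<^sup>2) (3 * 2 ^ 0 - 1)"
    by (rule tle_add tle_mult[OF tle_mult[OF tle_square[OF T(4), of 2] T(5), of 2] T(6)]
          tle_mult[OF tle_mult[OF tle_mult[OF T(4) T(5), of 1] T(6), of 1] J2] | simp)+
  moreover have "tle ((x ^ 3 + y ^ 3) * (T * x\<^sup>2 * y\<^sup>2)\<^sup>2 + x * y * (x ^ 3 + y ^ 3) * (x ^ 3 + y ^ 3)\<^sup>2) (2 * 2 ^ 0)"
    by (rule tle_add tle_mult[OF cube tle_square[OF Tx, of 2]]
          tle_mult[OF tle_mult[OF xy cube, of 0] J2] | simp)+
  moreover have "tle ((x * y * (x ^ 3 + y ^ 3))\<^sup>2 + x * y * (T * x\<^sup>2 * y\<^sup>2)\<^sup>2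
      + (1 + T) * x\<^sup>2 * y\<^sup>2 * (x ^ 3 + y ^ 3)\<^sup>2) (2 * 2 ^ 0)"
    by (rule tle_add tle_square[OF tle_mult[OF xy cube, of 0]] tle_mult[OF xy tle_square[OF Tx, of 2]]
          tle_mult[OF tle_mult[OF tle_mult[OF T(8) T(5), of 1] T(6), of 1] J2] | simp)+
  moreover have "tle ((x ^ 3 + y ^ 3) * (x ^ 3 + y ^ 3)\<^sup>2) 0" by (rule tle_mult[OF cube J2]) simp
  ultimately show ?case using 2 by blast
next
  case (Suc n)
  define x y T where "x = (py :: 'a poly poly poly)" and "y = (pz :: 'a poly poly poly)"
    and "T = (px :: 'a poly poly poly)"
  have xyT: "[:[:0, 1:]:] = x" "[:0, 1:] = y" "[:[:[:0, 1:]:]:] = T"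
    by (simp_all add: x_def y_def T_def px_def py_def pz_def)
  define q :: nat where "q = 2 ^ n"
  have q: "q \<ge> 1" "(2::nat) ^ Suc n = 2 * q" by (simp_all add: q_def)
  obtain V w1 w2 w3 where w: "wz [:0, 1::'a:] (n + 2) = (mon3 (3 * q) (6 * q) (6 * q) + V, w1, w2, w3)"
    and le: "tle V (3 * q - 1)" "tle w1 (2 * q)" "tle w2 (2 * q)" "tle w3 0"
    using Suc.IH unfolding q_def by blast
  have two: "a + a = 0" for a :: "'a poly poly poly"
    by (rule char2_add_self) (simp add: char)
  have "(mon3 (3 * q) (6 * q) (6 * q) + V)\<^sup>2 = (mon3 (3 * q) (6 * q) (6 * q))\<^sup>2 + V\<^sup>2"
    by (rule char2_square_add) (simp add: char)
  also have "(mon3 (3 * q) (6 * q) (6 * q))\<^sup>2 = (mon3 (3 * (2 * q)) (6 * (2 * q)) (6 * (2 * q)) :: 'a poly poly poly)"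
    unfolding power2_eq_square mono_mult by (rule arg_cong3[where f = mon3]) simp_all
  finally have sq: "(mon3 (3 * q) (6 * q) (6 * q) + V)\<^sup>2 = mon3 (3 * (2 * q)) (6 * (2 * q)) (6 * (2 * q)) + V\<^sup>2" .
  have w': "wz [:0, 1:] (Suc n + 2) =
     (mon3 (3 * (2 * q)) (6 * (2 * q)) (6 * (2 * q))
        + (V\<^sup>2 + T * x\<^sup>2 * y\<^sup>2 * w2\<^sup>2 + T * x ^ 3 * y ^ 3 * w3\<^sup>2),
      (x ^ 3 + y ^ 3) * w2\<^sup>2 + x * y * (x ^ 3 + y ^ 3) * w3\<^sup>2,
      w1\<^sup>2 + x * y * w2\<^sup>2 + (1 + T) * x\<^sup>2 * y\<^sup>2 * w3\<^sup>2,
      (x ^ 3 + y ^ 3) * w3\<^sup>2)"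
    unfolding add_Suc wz.simps(2) w Let_def prod.case xyT sq by (simp only: add.assoc)
  note T = tle_simps[where 'a = 'a, folded x_def y_def T_def]
  have cube: "tle (x ^ 3 + y ^ 3) 0" by (rule T(4))
  have xy: "tle (x * y) 0" by (rule tle_mult[OF T(6,7)]) simp
  have Tx: "tle (T * x ^ i * y ^ i) 1" "tle ((1 + T) * x ^ i * y ^ i) 1" for i
    by (rule tle_mult[OF tle_mult[OF T(1) T(2), of 1] T(3)]
          tle_mult[OF tle_mult[OF T(5) T(2), of 1] T(3)]; simp)+
  have w3: "tle (w3\<^sup>2) 0" by (rule tle_square[OF le(4)]) simp
  have w2: "tle (w2\<^sup>2) (4 * q)" by (rule tle_square[OF le(3)]) simp
  have w1: "tle (w1\<^sup>2) (4 * q)" by (rule tle_square[OF le(2)]) simp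
  \<comment> \<open>Since \<open>4 * q + 1 \<le> 6 * q - 1\<close> for \<open>q \<ge> 1\<close>, the
    contribution of \<open>w2\<close> stays below the leading degree in \<open>t\<close>, which from
    here on simply doubles.\<close>
  have "tle (V\<^sup>2 + T * x\<^sup>2 * y\<^sup>2 * w2\<^sup>2 + T * x ^ 3 * y ^ 3 * w3\<^sup>2) (3 * (2 * q) - 1)"
    using q by (intro tle_add tle_square[OF le(1)] tle_mult[OF Tx(1) w2] tle_mult[OF Tx(1) w3]) linarith+
  moreover have "tle ((x ^ 3 + y ^ 3) * w2\<^sup>2 + x * y * (x ^ 3 + y ^ 3) * w3\<^sup>2) (2 * (2 * q))"
    by (intro tle_add tle_mult[OF cube w2] tle_mult[OF tle_mult[OF xy cube, of 0] w3]) simp_all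
  moreover have "tle (w1\<^sup>2 + x * y * w2\<^sup>2 + (1 + T) * x\<^sup>2 * y\<^sup>2 * w3\<^sup>2) (2 * (2 * q))"
    using q by (intro tle_add tle_weaken[OF w1] tle_mult[OF xy w2] tle_mult[OF Tx(2) w3]) linarith+
  moreover have "tle ((x ^ 3 + y ^ 3) * w3\<^sup>2) 0" by (rule tle_mult[OF cube w3]) simp
  ultimately show ?case using w' unfolding q(2) by blast
qed

text \<open>The top \<open>t\<close>-coefficient of \<open>c\<close> times the isolated leading term
  cannot cancel. A monomial \<open>x^i y^j\<close> of it yields exponents \<open>6 * 2^n + i\<close>
  and \<open>6 * 2^n + j\<close>, which are below \<open>8 * 2^n\<close> already for
  \<open>n = i + j\<close>.\<close>

lemma wz_multiple_nonzero:
  fixes c :: "'a::idom poly poly poly"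
  assumes char: "CHAR('a) = 2" and c: "c \<noteq> 0"
  shows "\<exists>e i j. i < 2 * 2 ^ e \<and> j < 2 * 2 ^ e \<and> coeff (coeff (c * fst (wz [:0, 1:] e)) j) i \<noteq> 0"
proof -
  define k where "k = (LEAST k. tle c k)"
  have "\<exists>k. tle c k"
  proof -
    obtain d where "tdeg_le c d" using tdeg_le_exists by blast
    hence "tle c d" unfolding tdeg_le_def tle_def by (meson add_leD1 order_trans)
    thus ?thesis ..
  qed
  hence k: "tle c k" unfolding k_def by (rule LeastI_ex)
  have "\<exists>i j. coeff3 c k i j \<noteq> 0"
  proof (rule ccontr)
    assume no: "\<not> (\<exists>i j. coeff3 c k i j \<noteq> 0)"
    have lt: "l < k" if "coeff3 c l i j \<noteq> 0" for l i j
      using that k no unfolding tle_def by (metis le_neq_implies_less)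
    show False
    proof (cases "k = 0")
      case True
      hence "coeff3 c l i j = 0" for l i j using lt by blast
      hence "c = 0" by (intro poly3_eqI) simp
      thus False using c by simp
    next
      case False
      hence "tle c (k - 1)" unfolding tle_def using lt by fastforce
      hence "k \<le> k - 1" unfolding k_def by (rule Least_le)
      thus False using False by simp
    qed
  qed
  then obtain i j where ij: "coeff3 c k i j \<noteq> 0" by blast
  define n where "n = i + j"
  obtain V w1 w2 w3 where V: "wz [:0, 1::'a:] (n + 2) = (mon3 (3 * 2 ^ n) (6 * 2 ^ n) (6 * 2 ^ n) + V, w1, w2, w3)"
    "tle V (3 * 2 ^ n - 1)"
    using wz_leading[OF char, of n] by blast
  have "tle (c * V) (k + (3 * 2 ^ n - 1))" by (rule tle_mult[OF k V(2)]) simp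
  moreover have "\<not> (3 * 2 ^ n + k \<le> k + (3 * 2 ^ n - 1))"
    using zero_less_power[of "2::nat" n] by linarith
  ultimately have "coeff3 (c * V) (3 * 2 ^ n + k) (6 * 2 ^ n + i) (6 * 2 ^ n + j) = 0"
    unfolding tle_def by blast
  moreover have "coeff3 (c * mon3 (3 * 2 ^ n) (6 * 2 ^ n) (6 * 2 ^ n)) (3 * 2 ^ n + k) (6 * 2 ^ n + i) (6 * 2 ^ n + j)
     = coeff3 c k i j"
    by (simp add: mult.commute[of c] coeff3_mono_mult)
  ultimately have "coeff3 (c * fst (wz [:0, 1:] (n + 2))) (3 * 2 ^ n + k) (6 * 2 ^ n + i) (6 * 2 ^ n + j) \<noteq> 0"
    using ij unfolding V(1) fst_conv distrib_left coeff3_add by simp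
  hence "coeff (coeff (c * fst (wz [:0, 1:] (n + 2))) (6 * 2 ^ n + j)) (6 * 2 ^ n + i) \<noteq> 0"
    unfolding coeff3_def by auto
  moreover have "n < 2 ^ n" "i \<le> n" "j \<le> n" "2 * 2 ^ (n + 2) = 8 * (2::nat) ^ n"
    by (simp_all add: n_def)
  hence "6 * 2 ^ n + i < 2 * 2 ^ (n + 2)" "6 * 2 ^ n + j < 2 * 2 ^ (n + 2)" by linarith+
  ultimately show ?thesis by blast
qed

subsection \<open>Linear dependence\<close>

lemma homogeneous_system_solvable:
  fixes f :: "'i \<Rightarrow> 'j \<Rightarrow> 'k::field"
  assumes "finite J" "finite I" "card J < card I"
  shows "\<exists>c. (\<exists>i\<in>I. c i \<noteq> 0) \<and> (\<forall>j\<in>J. (\<Sum>i\<in>I. c i * f i j) = 0)"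
  using assms
proof (induction J arbitrary: I f rule: finite_induct)
  case empty
  then obtain i where "i \<in> I" by fastforce
  thus ?case by (intro exI[of _ "\<lambda>_. 1"]) auto
next
  case (insert j0 J)
  show ?case
  proof (cases "\<forall>i\<in>I. f i j0 = 0")
    case True
    have "card J < card I" using insert by simp
    then obtain c where "\<exists>i\<in>I. c i \<noteq> 0" "\<forall>j\<in>J. (\<Sum>i\<in>I. c i * f i j) = 0"
      using insert.IH[OF insert.prems(1), of f] by blast
    thus ?thesis using True by (intro exI[of _ c]) auto
  next
    case False
    then obtain i0 where i0: "i0 \<in> I" "f i0 j0 \<noteq> 0" by blast
    define I' where "I' = I - {i0}"
    have I: "I = insert i0 I'" "i0 \<notin> I'" "finite I'" using i0 insert.prems by (auto simp: I'_def)
    define g where "g i j = f i j - f i j0 / f i0 j0 * f i0 j" for i j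
    have "card J < card I'" using insert.prems insert.hyps I by (simp add: I(1))
    then obtain c where c: "\<exists>i\<in>I'. c i \<noteq> 0" "\<forall>j\<in>J. (\<Sum>i\<in>I'. c i * g i j) = 0"
      using insert.IH[OF I(3), of g] by blast
    define c0 where "c0 = - (\<Sum>i\<in>I'. c i * (f i j0 / f i0 j0))"
    define c' where "c' i = (if i = i0 then c0 else c i)" for i
    have sum: "(\<Sum>i\<in>I. c' i * f i j) = (\<Sum>i\<in>I'. c i * g i j)" for j
    proof -
      have "(\<Sum>i\<in>I. c' i * f i j) = c0 * f i0 j + (\<Sum>i\<in>I'. c' i * f i j)"
        using I by (simp add: c'_def)
      also have "(\<Sum>i\<in>I'. c' i * f i j) = (\<Sum>i\<in>I'. c i * f i j)"
        using I by (intro sum.cong) (auto simp: c'_def)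
      also have "c0 * f i0 j = - (\<Sum>i\<in>I'. c i * (f i j0 / f i0 j0 * f i0 j))"
        by (simp add: c0_def sum_distrib_right mult.assoc)
      finally show ?thesis by (simp add: g_def algebra_simps sum_subtractf)
    qed
    have "(\<Sum>i\<in>I'. c i * g i j0) = 0" using i0(2) by (simp add: g_def)
    hence "\<forall>j\<in>insert j0 J. (\<Sum>i\<in>I. c' i * f i j) = 0" using c(2) by (simp add: sum)
    moreover have "\<exists>i\<in>I. c' i \<noteq> 0" using c(1) I by (auto simp: c'_def)
    ultimately show ?thesis by blast
  qed
qed

text \<open>Evaluation of a polynomial in three variables at \<open>w\<close> (innermost), \<open>v\<close>, \<open>u\<close>.\<close>

definition eval1 :: "'a::comm_ring_1 poly poly poly \<Rightarrow> 'a poly \<Rightarrow> 'a poly poly poly" where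
  "eval1 w p = poly (map_poly cst p) w"

definition eval2 :: "'a::comm_ring_1 poly poly poly \<Rightarrow> 'a poly poly poly \<Rightarrow> 'a poly poly \<Rightarrow> 'a poly poly poly" where
  "eval2 w v p = poly (map_poly (eval1 w) p) v"

definition eval3 :: "'a::comm_ring_1 poly poly poly \<Rightarrow> 'a poly poly poly \<Rightarrow> 'a poly poly poly \<Rightarrow>
    'a poly poly poly \<Rightarrow> 'a poly poly poly" where
  "eval3 w v u p = poly (map_poly (eval2 w v) p) u"

lemma ring_map_eval1: "ring_map (eval1 w)"
  unfolding eval1_def by (rule ring_map_comp[OF ring_map.ring_map_map_poly[OF ring_map_cst] ring_map_poly])

lemma ring_map_eval2: "ring_map (eval2 w v)"
  unfolding eval2_def by (rule ring_map_comp[OF ring_map.ring_map_map_poly[OF ring_map_eval1] ring_map_poly])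

lemma ring_map_eval3: "ring_map (eval3 w v u)"
  unfolding eval3_def by (rule ring_map_comp[OF ring_map.ring_map_map_poly[OF ring_map_eval2] ring_map_poly])

lemma eval3_mono: "eval3 w v u (cst c * mon3 i j l) = cst c * (w ^ i * v ^ j * u ^ l)"
proof -
  interpret c: ring_map cst by (rule ring_map_cst)
  interpret e1: ring_map "eval1 w" by (rule ring_map_eval1)
  interpret e2: ring_map "eval2 w v" by (rule ring_map_eval2)
  interpret e3: ring_map "eval3 w v u" by (rule ring_map_eval3)
  have 1: "eval1 w [:0, 1:] = w" "eval1 w [:c:] = cst c" for c
    by (simp_all add: eval1_def c.map_poly_pCons c.simps)
  have 2: "eval2 w v [:p:] = eval1 w p" "eval2 w v [:0, 1:] = v" for p
    by (simp_all add: eval2_def e1.map_poly_pCons e1.simps)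
  have 3: "eval3 w v u [:p:] = eval2 w v p" "eval3 w v u [:0, 1:] = u" for p
    by (simp_all add: eval3_def e2.map_poly_pCons e2.simps)
  have "eval3 w v u (cst c) = eval1 w [:c:]" by (simp only: cst_def 2 3)
  hence "eval3 w v u px = w" "eval3 w v u py = v" "eval3 w v u pz = u" "eval3 w v u (cst c) = cst c"
    by (simp_all only: px_def py_def pz_def 1 2 3)
  thus ?thesis by (simp add: mon3_def e3.simps)
qed

lemma tdeg_le_power: "tdeg_le p d \<Longrightarrow> tdeg_le (p ^ n) (n * d)"
  for p :: "'a::comm_ring_1 poly poly poly"
proof (induction n)
  case 0
  show ?case using tdeg_le_mono[of 0 0 0 0] by (simp add: mon3_def)
next
  case (Suc n)
  show ?case using tdeg_le_mult[OF Suc.prems Suc.IH[OF Suc.prems]] by simp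
qed

text \<open>A dimension count for a ring of dimension 2: the \<open>N^3\<close> monomials in
  \<open>w, v, u\<close> have normal forms of degree at most \<open>N * D\<close> with
  \<open>z\<close>-degree below 4, and these fill a space of dimension at most
  \<open>4 (N D + 1)^2\<close>.\<close>

lemma algebraic_dependence:
  fixes u v w :: "'a::field poly poly poly"
  shows "\<exists>G. G \<noteq> 0 \<and> quartic t dvd eval3 w v u G"
proof -
  obtain d1 d2 d3 where d: "tdeg_le w d1" "tdeg_le v d2" "tdeg_le u d3"
    using tdeg_le_exists by metis
  define D where "D = d1 + d2 + d3"
  \<comment> \<open>Chosen so that
    \<open>4 (N D + 1)^2 \<le> N^2 * 4 (D + 1)^2 < N^3\<close>.\<close>
  define N where "N = 4 * (D + 1)\<^sup>2 + 1"
  define I where "I = {..<N} \<times> {..<N} \<times> {..<N}"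
  define J :: "(nat \<times> nat \<times> nat) set" where "J = {..N * D} \<times> {..N * D} \<times> {..<4}"
  have "\<forall>i\<in>I. \<exists>q r. (case i of (i, j, l) \<Rightarrow> w ^ i * v ^ j * u ^ l) = quartic t * q + r \<and> degree r < 4 \<and> tdeg_le r (N * D)"
  proof (intro ballI, clarify)
    fix i j l assume "(i, j, l) \<in> I"
    hence "i \<le> N" "j \<le> N" "l \<le> N" by (auto simp: I_def)
    hence "i * d1 + j * d2 + l * d3 \<le> N * D"
      unfolding D_def distrib_left by (intro add_mono mult_le_mono1)
    moreover have "tdeg_le (w ^ i * v ^ j * u ^ l) (i * d1 + j * d2 + l * d3)"
      by (intro tdeg_le_mult tdeg_le_power d)
    ultimately have "tdeg_le (w ^ i * v ^ j * u ^ l) (N * D)" by (rule tdeg_le_weaken[rotated])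
    thus "\<exists>q r. w ^ i * v ^ j * u ^ l = quartic t * q + r \<and> degree r < 4 \<and> tdeg_le r (N * D)"
      by (rule quartic_normal_form)
  qed
  from bchoice[OF this] obtain q where "\<forall>i\<in>I. \<exists>r. (case i of (i, j, l) \<Rightarrow> w ^ i * v ^ j * u ^ l)
      = quartic t * q i + r \<and> degree r < 4 \<and> tdeg_le r (N * D)" by blast
  from bchoice[OF this] obtain r where r: "\<forall>i\<in>I. (case i of (i, j, l) \<Rightarrow> w ^ i * v ^ j * u ^ l)
      = quartic t * q i + r i \<and> degree (r i) < 4 \<and> tdeg_le (r i) (N * D)" by blast
  have "card J < card I"
  proof -
    have "N * D + 1 \<le> N * (D + 1)" by (simp add: N_def)
    hence "(N * D + 1)\<^sup>2 * 4 \<le> (N * (D + 1))\<^sup>2 * 4" by (intro mult_le_mono1 power_mono) auto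
    also have "\<dots> = N\<^sup>2 * (4 * (D + 1)\<^sup>2)" by (simp only: power_mult_distrib mult_ac)
    also have "\<dots> < N\<^sup>2 * N" by (simp add: N_def)
    finally show ?thesis by (simp add: I_def J_def card_cartesian_product power2_eq_square algebra_simps)
  qed
  moreover have "finite J" "finite I" by (simp_all add: I_def J_def)
  ultimately obtain c where c: "\<exists>i\<in>I. c i \<noteq> 0"
    "\<And>j. j \<in> J \<Longrightarrow> (\<Sum>i\<in>I. c i * (case j of (a, b, l) \<Rightarrow> coeff3 (r i) a b l)) = 0"
    using homogeneous_system_solvable[of J I "\<lambda>i j. case j of (a, b, l) \<Rightarrow> coeff3 (r i) a b l"] by blast
  define G where "G = (\<Sum>i\<in>I. case i of (i, j, l) \<Rightarrow> cst (c (i, j, l)) * mon3 i j l)"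
  interpret e3: ring_map "eval3 w v u" by (rule ring_map_eval3)
  have sum3: "coeff3 (sum h A) i j l = (\<Sum>a\<in>A. coeff3 (h a) i j l)"
    for h :: "_ \<Rightarrow> 'a poly poly poly" and A :: "(nat \<times> nat \<times> nat) set" and i j l
    by (simp add: coeff3_def coeff_sum)
  have "G \<noteq> 0"
  proof
    assume "G = 0"
    obtain i j l where ijl: "(i, j, l) \<in> I" "c (i, j, l) \<noteq> 0" using c(1) by auto
    have "coeff3 G i j l = (\<Sum>p\<in>I. if p = (i, j, l) then c p else 0)"
      unfolding G_def sum3 by (intro sum.cong) (auto simp: coeff3_mono split: if_splits)
    also have "\<dots> = c (i, j, l)" using ijl(1) \<open>finite I\<close> by simp
    finally show False using ijl(2) \<open>G = 0\<close> by simp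
  qed
  moreover have "quartic t dvd eval3 w v u G"
  proof -
    have "(\<Sum>i\<in>I. cst (c i) * r i) = 0"
    proof (rule poly3_eqI)
      fix a b l
      show "coeff3 (\<Sum>i\<in>I. cst (c i) * r i) a b l = coeff3 0 a b l"
      proof (cases "(a, b, l) \<in> J")
        case True
        thus ?thesis using c(2)[OF True] by (simp add: sum3)
      next
        case False
        have "coeff3 (r i) a b l = 0" if "i \<in> I" for i
        proof (rule ccontr)
          assume nz: "coeff3 (r i) a b l \<noteq> 0"
          hence "a + b + l \<le> N * D" using r that unfolding tdeg_le_def by blast
          moreover have "l \<le> degree (r i)" using nz by (intro le_degree) (auto simp: coeff3_def)
          hence "l < 4" using r that by fastforce
          ultimately show False using False by (simp add: J_def)
        qed
        thus ?thesis by (simp add: sum3)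
      qed
    qed
    hence "eval3 w v u G = quartic t * (\<Sum>i\<in>I. cst (c i) * q i)"
    proof -
      assume 0: "(\<Sum>i\<in>I. cst (c i) * r i) = 0"
      have "eval3 w v u G = (\<Sum>i\<in>I. cst (c i) * (quartic t * q i + r i))"
        unfolding G_def e3.sum by (intro sum.cong) (use r in \<open>auto simp: eval3_mono\<close>)
      also have "\<dots> = quartic t * (\<Sum>i\<in>I. cst (c i) * q i) + (\<Sum>i\<in>I. cst (c i) * r i)"
        by (simp add: distrib_left sum.distrib sum_distrib_left mult_ac)
      finally show ?thesis by (simp add: 0)
    qed
    thus ?thesis by simp
  qed
  ultimately show ?thesis by blast
qed

text \<open>
  The lowest coefficient of a dependence relation lies in the next larger prime; applied three times,
  this rules out chains of primes of length three.
\<close>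

lemma lowest_coefficient:
  fixes h :: "'a::comm_ring_1 \<Rightarrow> 'b::comm_ring_1"
  assumes h: "ring_map h" and "poly (map_poly h G) u \<in> P" "G \<noteq> 0" "u \<notin> P"
    and prime: "\<And>a b. a * b \<in> P \<Longrightarrow> a \<in> P \<or> b \<in> P"
    and sub: "\<And>a b. a + u * b \<in> P \<Longrightarrow> a \<in> P'"
  shows "\<exists>a. a \<noteq> 0 \<and> h a \<in> P'"
  using assms(2,3)
proof (induction G)
  case (pCons a G)
  interpret h: ring_map h by (rule h)
  have eq: "h a + u * poly (map_poly h G) u \<in> P" using pCons.prems by (simp add: h.map_poly_pCons)
  show ?case
  proof (cases "a = 0")
    case True
    hence "poly (map_poly h G) u \<in> P" using eq prime \<open>u \<notin> P\<close> by (auto simp: h.zero)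
    moreover have "G \<noteq> 0" using True pCons.prems by auto
    ultimately show ?thesis using pCons.IH by blast
  next
    case False
    thus ?thesis using sub[OF eq] by blast
  qed
qed simp

subsection \<open>Hilbert's basis theorem\<close>

definition is_ideal :: "'a::comm_ring_1 set \<Rightarrow> bool" where
  "is_ideal I \<longleftrightarrow> 0 \<in> I \<and> (\<forall>a\<in>I. \<forall>b\<in>I. a + b \<in> I) \<and> (\<forall>a\<in>I. \<forall>r. r * a \<in> I)"

text \<open>Finite generation is expressed by minimality among the ideals containing
  \<open>A\<close>, which avoids linear combinations.\<close>

definition noetherian_type :: "'a::comm_ring_1 itself \<Rightarrow> bool" where
  "noetherian_type _ \<longleftrightarrow> (\<forall>I :: 'a set. is_ideal I \<longrightarrow>
     (\<exists>A. finite A \<and> A \<subseteq> I \<and> (\<forall>J. is_ideal J \<longrightarrow> A \<subseteq> J \<longrightarrow> I \<subseteq> J)))"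

lemma is_idealD:
  assumes "is_ideal I"
  shows "0 \<in> I" "a \<in> I \<Longrightarrow> b \<in> I \<Longrightarrow> a + b \<in> I" "a \<in> I \<Longrightarrow> r * a \<in> I" "a \<in> I \<Longrightarrow> b \<in> I \<Longrightarrow> a - b \<in> I"
proof -
  show 1: "0 \<in> I" "a \<in> I \<Longrightarrow> b \<in> I \<Longrightarrow> a + b \<in> I" "a \<in> I \<Longrightarrow> r * a \<in> I" for a b r
    using assms by (auto simp: is_ideal_def)
  show "a \<in> I \<Longrightarrow> b \<in> I \<Longrightarrow> a - b \<in> I" using 1(2)[of a "- 1 * b"] 1(3)[of b "- 1"] by simp
qed

lemma noetherian_field: "noetherian_type TYPE('a::field)"
  unfolding noetherian_type_def
proof (intro allI impI)
  fix I :: "'a set" assume I: "is_ideal I"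
  show "\<exists>A. finite A \<and> A \<subseteq> I \<and> (\<forall>J. is_ideal J \<longrightarrow> A \<subseteq> J \<longrightarrow> I \<subseteq> J)"
  proof (cases "I \<subseteq> {0}")
    case True
    thus ?thesis by (intro exI[of _ "{}"]) (auto dest: is_idealD(1))
  next
    case False
    then obtain a where a: "a \<in> I" "a \<noteq> 0" by blast
    have "b \<in> J" if "is_ideal J" "a \<in> J" for J b
      using is_idealD(3)[OF that, of "b / a"] a(2) by simp
    thus ?thesis using a(1) by (intro exI[of _ "{a}"]) auto
  qed
qed

theorem hilbert_basis:
  assumes noeth: "noetherian_type TYPE('a::comm_ring_1)"
  shows "noetherian_type TYPE('a poly)"
  unfolding noetherian_type_def
proof (intro allI impI)
  fix I :: "'a poly set" assume I: "is_ideal I"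
  \<comment> \<open>Taking the coefficient at \<open>d\<close> of all elements of degree at most
    \<open>d\<close>, not only of degree \<open>d\<close>, makes this an ideal that grows with
    \<open>d\<close>.\<close>
  define lc where "lc K d = {c. \<exists>g\<in>K. degree g \<le> d \<and> coeff g d = c}" for K :: "'a poly set" and d
  have lc_ideal: "is_ideal (lc K d)" if "is_ideal K" for K d
    unfolding is_ideal_def
  proof (intro conjI ballI allI)
    show "0 \<in> lc K d" using is_idealD(1)[OF that] by (auto simp: lc_def intro!: bexI[of _ 0])
    show "a + b \<in> lc K d" if ab: "a \<in> lc K d" "b \<in> lc K d" for a b
    proof -
      obtain f g where "f \<in> K" "degree f \<le> d" "coeff f d = a" "g \<in> K" "degree g \<le> d" "coeff g d = b"
        using ab by (auto simp: lc_def)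
      thus ?thesis unfolding lc_def
        using is_idealD(2)[OF \<open>is_ideal K\<close>] by (auto intro!: bexI[of _ "f + g"] degree_add_le)
    qed
    show "r * a \<in> lc K d" if a: "a \<in> lc K d" for a r
    proof -
      obtain f where "f \<in> K" "degree f \<le> d" "coeff f d = a" using a by (auto simp: lc_def)
      thus ?thesis unfolding lc_def
        using is_idealD(3)[OF \<open>is_ideal K\<close>, of f "[:r:]"] degree_smult_le[of r f]
        by (auto intro!: bexI[of _ "smult r f"])
    qed
  qed
  have lc_mono: "lc K d \<subseteq> lc K (d + e)" if K: "is_ideal K" for K d e
  proof
    fix a assume "a \<in> lc K d"
    then obtain f where f: "f \<in> K" "degree f \<le> d" "coeff f d = a" by (auto simp: lc_def)
    have "degree (monom 1 e * f) \<le> d + e"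
      using degree_mult_le[of "monom 1 e" f] degree_monom_le[of "1::'a" e] f(2) by linarith
    moreover have "coeff (monom 1 e * f) (d + e) = a" using f(3) by (simp add: coeff_monom_mult)
    ultimately show "a \<in> lc K (d + e)" unfolding lc_def using is_idealD(3)[OF K f(1)] by blast
  qed
  define L where "L = (\<Union>d. lc I d)"
  have "is_ideal L"
    unfolding is_ideal_def
  proof (intro conjI ballI allI)
    show "0 \<in> L" unfolding L_def UN_iff by (rule bexI[of _ 0]) (rule is_idealD(1)[OF lc_ideal[OF I]] UNIV_I)+
    show "a + b \<in> L" if ab: "a \<in> L" "b \<in> L" for a b
    proof -
      obtain d e where "a \<in> lc I d" "b \<in> lc I e" using ab unfolding L_def by blast
      hence "a \<in> lc I (d + e)" "b \<in> lc I (d + e)"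
        using subsetD[OF lc_mono[OF I, of d e], of a] subsetD[OF lc_mono[OF I, of e d], of b]
        unfolding add.commute[of e d] by simp_all
      hence "a + b \<in> lc I (d + e)" by (rule is_idealD(2)[OF lc_ideal[OF I]])
      thus ?thesis unfolding L_def UN_iff by (rule bexI[of _ "d + e"]) (rule UNIV_I)
    qed
    show "r * a \<in> L" if a: "a \<in> L" for a r
    proof -
      obtain d where "a \<in> lc I d" using a unfolding L_def by blast
      hence "r * a \<in> lc I d" by (rule is_idealD(3)[OF lc_ideal[OF I]])
      thus ?thesis unfolding L_def UN_iff by (rule bexI[of _ d]) (rule UNIV_I)
    qed
  qed
  hence "\<exists>A. finite A \<and> A \<subseteq> L \<and> (\<forall>J. is_ideal J \<longrightarrow> A \<subseteq> J \<longrightarrow> L \<subseteq> J)"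
    using noeth unfolding noetherian_type_def by (elim allE[of _ L] impE) assumption+
  then obtain A where A: "finite A" "A \<subseteq> L" "\<And>J. is_ideal J \<Longrightarrow> A \<subseteq> J \<Longrightarrow> L \<subseteq> J"
    by (elim exE conjE) simp
  \<comment> \<open>Finitely many generators of the ideal of all leading coefficients occur in one
    common degree, since \<open>lc\<close> is increasing.\<close>
  have "\<exists>N. A \<subseteq> lc I N"
    using A(1,2)
  proof (induction rule: finite_induct)
    case (insert a A)
    obtain N where N: "A \<subseteq> lc I N" using insert.IH insert.prems by blast
    have "a \<in> L" using insert.prems by blast
    then obtain d where d: "a \<in> lc I d" unfolding L_def by blast
    have "A \<subseteq> lc I (N + d)" using N lc_mono[OF I, of N d] by (rule subset_trans)
    moreover have "a \<in> lc I (d + N)" using d lc_mono[OF I, of d N] by (rule rev_subsetD)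
    hence "a \<in> lc I (N + d)" unfolding add.commute[of d N] .
    ultimately show ?case by (intro exI[of _ "N + d"]) (rule insert_subsetI)
  qed simp
  then obtain N where "A \<subseteq> lc I N" by blast
  hence L: "L \<subseteq> lc I N" by (rule A(3)[OF lc_ideal[OF I]])
  \<comment> \<open>In each degree finitely many elements of \<open>I\<close> suffice to realise all
    leading coefficients inside any ideal that contains them. Degrees up to \<open>N\<close> will be
    enough, as higher ones are reached by shifting.\<close>
  have "\<exists>G. finite G \<and> G \<subseteq> I \<and> (\<forall>J. is_ideal J \<longrightarrow> G \<subseteq> J \<longrightarrow> lc I d \<subseteq> lc (I \<inter> J) d)" for d
  proof -
    have "\<exists>B. finite B \<and> B \<subseteq> lc I d \<and> (\<forall>J. is_ideal J \<longrightarrow> B \<subseteq> J \<longrightarrow> lc I d \<subseteq> J)"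
      using noeth lc_ideal[OF I, of d] unfolding noetherian_type_def
      by (elim allE[of _ "lc I d"] impE) assumption+
    then obtain B where B: "finite B" "B \<subseteq> lc I d" "\<And>J. is_ideal J \<Longrightarrow> B \<subseteq> J \<Longrightarrow> lc I d \<subseteq> J"
      by (elim exE conjE) simp
    have "\<forall>b\<in>B. \<exists>g. g \<in> I \<and> degree g \<le> d \<and> coeff g d = b" using B(2) by (auto simp: lc_def)
    from bchoice[OF this] obtain g where
      g: "\<forall>b\<in>B. g b \<in> I \<and> degree (g b) \<le> d \<and> coeff (g b) d = b" ..
    have "lc I d \<subseteq> lc (I \<inter> J) d" if J: "is_ideal J" "g ` B \<subseteq> J" for J
    proof (rule B(3))
      have "is_ideal (I \<inter> J)" using I J(1) by (auto simp: is_ideal_def)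
      thus "is_ideal (lc (I \<inter> J) d)" by (rule lc_ideal)
      show "B \<subseteq> lc (I \<inter> J) d"
      proof
        fix b assume b: "b \<in> B"
        hence "g b \<in> I \<inter> J" using g J(2) by blast
        moreover have "degree (g b) \<le> d" "coeff (g b) d = b" using g b by simp_all
        ultimately show "b \<in> lc (I \<inter> J) d" unfolding lc_def by blast
      qed
    qed
    moreover have "finite (g ` B)" using B(1) by simp
    moreover have "g ` B \<subseteq> I" using g by blast
    ultimately show ?thesis by (intro exI[of _ "g ` B"] conjI allI impI)
  qed
  hence "\<forall>d. \<exists>G. finite G \<and> G \<subseteq> I \<and> (\<forall>J. is_ideal J \<longrightarrow> G \<subseteq> J \<longrightarrow> lc I d \<subseteq> lc (I \<inter> J) d)" ..
  from choice[OF this] obtain G where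
    G0: "\<forall>d. finite (G d) \<and> G d \<subseteq> I \<and> (\<forall>J. is_ideal J \<longrightarrow> G d \<subseteq> J \<longrightarrow> lc I d \<subseteq> lc (I \<inter> J) d)" ..
  have G: "finite (G d)" "G d \<subseteq> I" "is_ideal J \<Longrightarrow> G d \<subseteq> J \<Longrightarrow> lc I d \<subseteq> lc (I \<inter> J) d" for d J
    using G0 by simp_all
  have "f \<in> J" if J: "is_ideal J" "(\<Union>d\<le>N. G d) \<subseteq> J" and f: "f \<in> I" for J f
    using f
  proof (induction "degree f" arbitrary: f rule: less_induct)
    case (less f)
    define d where "d = degree f"
    define c where "c = lead_coeff f"
    have c: "c \<in> lc I d" unfolding lc_def c_def d_def using less.prems by blast
    have IJ: "is_ideal (I \<inter> J)" using I J(1) by (auto simp: is_ideal_def)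
    have "c \<in> lc (I \<inter> J) d"
    proof (cases "d \<le> N")
      case True
      have "G d \<subseteq> J" using True J(2) by blast
      thus ?thesis using G(3)[OF J(1)] c by blast
    next
      case False
      have "c \<in> lc I N" using c L by (auto simp: L_def)
      moreover have "G N \<subseteq> J" using J(2) by blast
      ultimately have "c \<in> lc (I \<inter> J) N" using G(3)[OF J(1)] by blast
      moreover have "N + (d - N) = d" using False by simp
      ultimately show ?thesis using lc_mono[OF IJ, of N "d - N"] by (metis subsetD)
    qed
    then obtain g where g: "g \<in> I" "g \<in> J" "degree g \<le> d" "coeff g d = c" unfolding lc_def by blast
    have fg: "f - g \<in> I" using is_idealD(4)[OF I less.prems g(1)] .
    have "f - g \<in> J"
    proof (cases "f - g = 0")
      case True
      thus ?thesis using is_idealD(1)[OF J(1)] by simp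
    next
      case False
      have "degree (f - g) \<le> d" using g(3) by (intro degree_diff_le) (simp_all add: d_def)
      moreover have "coeff (f - g) d = 0" using g(4) by (simp add: c_def d_def)
      hence "degree (f - g) \<noteq> d" using False by (metis leading_coeff_0_iff)
      ultimately have "degree (f - g) < degree f" by (simp add: d_def)
      thus ?thesis using less.hyps fg by blast
    qed
    hence "(f - g) + g \<in> J" using g(2) by (rule is_idealD(2)[OF J(1)])
    thus ?case by simp
  qed
  thus "\<exists>A. finite A \<and> A \<subseteq> I \<and> (\<forall>J. is_ideal J \<longrightarrow> A \<subseteq> J \<longrightarrow> I \<subseteq> J)"
    using G(1,2) by (intro exI[of _ "\<Union>d\<le>N. G d"] conjI allI impI subsetI) (simp, blast, simp)
qed

subsection \<open>The ring \<open>R\<^sub>t\<close>\<close>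

definition tau :: Lt where "tau = to_fract [:0, 1:]"

lemma F_t_eq: "F_t = quartic tau"
  by (simp add: F_t_def quartic_def tau_def x_gen_def y_gen_def z_gen_def t_gen_def px_def py_def pz_def
      cst_def to_fract_def algebra_simps)

lemma gens_eq: "x_gen = px" "y_gen = py" "z_gen = pz"
  by (simp_all add: x_gen_def y_gen_def z_gen_def px_def py_def pz_def)

lemma CHAR_bit: "CHAR(bit) = 2"
proof (rule CHAR_eq_posI)
  fix n :: nat assume "0 < n" "n < 2"
  hence "n = 1" by simp
  thus "of_nat n \<noteq> (0::bit)" by simp
qed simp_all

lemma CHAR_L: "CHAR(L) = 2"
  by (simp add: CHAR_bit)

lemma CHAR_Lt: "CHAR(Lt) = 2"
proof (rule CHAR_eqI)
  have eq: "of_nat n = to_fract (of_nat n :: L poly)" for n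
    by (induction n) simp_all
  have "CHAR(L poly) = 2" by (simp add: CHAR_bit)
  thus "of_nat 2 = (0 :: Lt)" unfolding eq by (metis of_nat_CHAR to_fract_0)
  show "2 dvd n" if "of_nat n = (0 :: Lt)" for n
    using that \<open>CHAR(L poly) = 2\<close> unfolding eq by (metis of_nat_eq_0_iff_char_dvd to_fract_eq_0_iff)
qed

text \<open>As a polynomial in \<open>t\<close>, the term of index \<open>n + 1\<close> has degree
  \<open>2^n\<close>.\<close>

lemma lam_tau_nz:
  assumes "i \<ge> 1"
  shows "lam tau i \<noteq> 0"
proof -
  have deg: "degree (lam [:0, 1 :: L:] (Suc n)) = 2 ^ n" for n
  proof (induction n)
    case (Suc n)
    define p where "p = lam [:0, 1 :: L:] (Suc n)"
    have "degree (p\<^sup>2) = 2 ^ Suc n"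
      using Suc.IH unfolding p_def[symmetric] by (subst degree_power_eq) auto
    moreover have "(1::nat) < 2 ^ Suc n" by (rule one_less_power) simp_all
    ultimately have "degree ([:0, 1:] + p\<^sup>2) = 2 ^ Suc n"
      by (subst degree_add_eq_right) simp_all
    thus ?case by (simp add: p_def)
  qed simp
  obtain n where i: "i = Suc n" using assms by (cases i) auto
  have "lam [:0, 1 :: L:] i \<noteq> 0" using deg[of n] unfolding i by (metis degree_0 power_not_zero zero_neq_numeral)
  thus ?thesis
    unfolding tau_def lam_ring_map[OF ring_map_to_fract, symmetric] by simp
qed

text \<open>Embeds the coordinate ring of \<open>R_t\<close> into a field. Scalars pass to the
  algebraic closure of \<open>L(t)\<close> first, where the results on \<open>ev\<close>
  apply.\<close>

definition theta :: "Lt_xyz \<Rightarrow> Lt alg_closure big" where "theta p = ev (to_ac tau) (map3 to_ac p)"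

lemma ring_map_theta: "ring_map theta"
  unfolding theta_def by (rule ring_map_comp[OF ring_map_map3[OF ring_map_to_ac] ring_map_ev])

lemma tau_nz: "tau \<noteq> 0"
  using lam_tau_nz[of 1] by simp

lemma theta_eq_0_iff: "theta p = 0 \<longleftrightarrow> F_t dvd p"
proof
  interpret h: ring_map theta by (rule ring_map_theta)
  have F0: "theta F_t = 0"
    by (simp add: theta_def F_t_eq map3_quartic[OF ring_map_to_ac] ev_quartic)
  show "theta p = 0" if "F_t dvd p" using that F0 by (auto simp: h.mult elim!: dvdE)
  assume 0: "theta p = 0"
  obtain q r where qr: "p = quartic tau * q + r" "degree r < 4" by (rule quartic_division)
  have "theta r = 0" using 0 F0 by (simp add: qr(1) h.simps F_t_eq)
  moreover have "degree (map3 to_ac r) < 4"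
    using qr(2) map_poly_degree_leq[of "map_poly (map_poly to_ac)" r] unfolding map3_def by linarith
  ultimately have "map3 to_ac r = 0"
    unfolding theta_def using CHAR_Lt tau_nz by (intro ev_eq_0_imp_eq_0) simp_all
  moreover have "map3 to_ac 0 = (0 :: Lt alg_closure poly poly poly)"
    by (simp add: map3_def)
  ultimately have "r = 0" using inj_map3[OF to_ac_0 inj_to_ac] by (metis injD)
  thus "F_t dvd p" by (simp add: qr(1) F_t_eq)
qed

text \<open>The kernel of a ring map into a field is prime.\<close>

lemma F_t_prime: "F_t dvd p * q \<Longrightarrow> F_t dvd p \<or> F_t dvd q"
  unfolding theta_eq_0_iff[symmetric] ring_map.mult[OF ring_map_theta] by simp

lemma F_t_not_dvd_small: "p \<noteq> 0 \<Longrightarrow> degree p < 4 \<Longrightarrow> \<not> F_t dvd p"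
  using dvd_imp_degree_le[of F_t p] by (auto simp: F_t_eq degree_quartic)

section \<open>The quotient \<open>R_t\<close> and its ideals in terms of polynomial
  representatives\<close>

abbreviation "F_ideal \<equiv> Idl\<^bsub>Lt_xyz_ring\<^esub> {F_t}"

lemma Lt_ring_simps:
  "carrier Lt_xyz_ring = UNIV" "a \<otimes>\<^bsub>Lt_xyz_ring\<^esub> b = a * b" "a \<oplus>\<^bsub>Lt_xyz_ring\<^esub> b = a + b"
  "\<one>\<^bsub>Lt_xyz_ring\<^esub> = 1" "\<zero>\<^bsub>Lt_xyz_ring\<^esub> = 0"
  by (simp_all add: ring_of_type_algebra_def)

lemma cring_Lt_ring: "cring Lt_xyz_ring" by (rule cring_from_type_algebra)

lemma is_ideal_iff: "ideal I Lt_xyz_ring \<longleftrightarrow> is_ideal I"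
proof
  assume "ideal I Lt_xyz_ring"
  then interpret ideal I Lt_xyz_ring .
  show "is_ideal I"
    unfolding is_ideal_def
    using I_l_closed additive_subgroup.a_closed[OF is_additive_subgroup]
      additive_subgroup.zero_closed[OF is_additive_subgroup]
    by (auto simp: Lt_ring_simps)
next
  interpret P: cring Lt_xyz_ring by (rule cring_Lt_ring)
  assume I: "is_ideal I"
  show "ideal I Lt_xyz_ring"
  proof (rule idealI)
    show "ring Lt_xyz_ring" by (rule P.ring_axioms)
    show "subgroup I (add_monoid Lt_xyz_ring)"
    proof (rule P.add.subgroupI)
      show "I \<noteq> {}" using is_idealD(1)[OF I] by blast
      show "\<ominus>\<^bsub>Lt_xyz_ring\<^esub> a \<in> I" if "a \<in> I" for a
      proof -
        have "(- 1) * a \<oplus>\<^bsub>Lt_xyz_ring\<^esub> a = \<zero>\<^bsub>Lt_xyz_ring\<^esub>" by (simp add: Lt_ring_simps)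
        hence "\<ominus>\<^bsub>Lt_xyz_ring\<^esub> a = (- 1) * a"
          by (rule P.minus_equality) (simp_all add: Lt_ring_simps)
        thus ?thesis using is_idealD(3)[OF I that, of "- 1"] by simp
      qed
    qed (use is_idealD(2)[OF I] in \<open>auto simp: Lt_ring_simps\<close>)
  qed (use is_idealD(3)[OF I] in \<open>auto simp: Lt_ring_simps mult.commute\<close>)
qed

lemma F_ideal_eq: "F_ideal = {p. F_t dvd p}"
proof
  interpret P: cring Lt_xyz_ring by (rule cring_Lt_ring)
  have "is_ideal {p. F_t dvd p}" by (auto simp: is_ideal_def)
  thus "F_ideal \<subseteq> {p. F_t dvd p}"
    by (intro P.genideal_minimal) (auto simp: is_ideal_iff)
  have "is_ideal F_ideal" unfolding is_ideal_iff[symmetric]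
    by (rule P.genideal_ideal) (simp add: Lt_ring_simps)
  moreover have "F_t \<in> F_ideal" by (rule P.genideal_self') (simp add: Lt_ring_simps)
  ultimately show "{p. F_t dvd p} \<subseteq> F_ideal"
    by (auto elim!: dvdE simp: mult.commute[of F_t] dest: is_idealD(3))
qed

lemma ideal_F_ideal: "ideal F_ideal Lt_xyz_ring"
  unfolding is_ideal_iff F_ideal_eq by (auto simp: is_ideal_def)

lemma residue_class_eq: "residue_class g = {p. F_t dvd p - g}"
proof -
  have "residue_class g = (\<Union>h\<in>F_ideal. {h + g})"
    unfolding residue_class_def a_r_coset_def' by (simp add: Lt_ring_simps)
  also have "\<dots> = {p. F_t dvd p - g}"
    unfolding F_ideal_eq by (auto intro!: exI[of _ "_ - g"])
  finally show ?thesis .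
qed

lemma residue_class_eq_iff: "residue_class g = residue_class h \<longleftrightarrow> F_t dvd g - h"
proof
  assume "residue_class g = residue_class h"
  moreover have "g \<in> residue_class g" by (simp add: residue_class_eq)
  ultimately show "F_t dvd g - h" by (simp add: residue_class_eq)
next
  assume d: "F_t dvd g - h"
  have "F_t dvd p - g \<longleftrightarrow> F_t dvd p - h" for p
    using dvd_add_left_iff[OF d, of "p - g"] by simp
  thus "residue_class g = residue_class h" by (simp add: residue_class_eq)
qed

lemma residue_class_hom: "residue_class \<in> ring_hom Lt_xyz_ring R_t"
  using ideal.rcos_ring_hom[OF ideal_F_ideal]
  unfolding R_t_def residue_class_def[abs_def] .

lemma carrier_R_t: "carrier R_t = range residue_class"
  unfolding R_t_def FactRing_def A_RCOSETS_defs residue_class_def[abs_def] a_r_coset_def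
  by (auto simp: Lt_ring_simps)

lemma residue_class_simps:
  "residue_class a \<oplus>\<^bsub>R_t\<^esub> residue_class b = residue_class (a + b)"
  "residue_class a \<otimes>\<^bsub>R_t\<^esub> residue_class b = residue_class (a * b)"
  "\<one>\<^bsub>R_t\<^esub> = residue_class 1" "\<zero>\<^bsub>R_t\<^esub> = residue_class 0"
proof -
  show "residue_class a \<oplus>\<^bsub>R_t\<^esub> residue_class b = residue_class (a + b)"
    "residue_class a \<otimes>\<^bsub>R_t\<^esub> residue_class b = residue_class (a * b)"
    "\<one>\<^bsub>R_t\<^esub> = residue_class 1"
    using ring_hom_add[OF residue_class_hom, of a b] ring_hom_mult[OF residue_class_hom, of a b]
      ring_hom_one[OF residue_class_hom] by (simp_all add: Lt_ring_simps)
  have "\<zero>\<^bsub>R_t\<^esub> = F_ideal" by (simp add: R_t_def FactRing_def)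
  thus "\<zero>\<^bsub>R_t\<^esub> = residue_class 0" by (simp add: residue_class_eq F_ideal_eq)
qed

lemma residue_class_carrier: "residue_class a \<in> carrier R_t"
  by (simp add: carrier_R_t)

lemma cring_R_t: "cring R_t"
  unfolding R_t_def by (rule ideal.quotient_is_cring[OF ideal_F_ideal cring_Lt_ring])

lemma residue_class_power: "residue_class a [^]\<^bsub>R_t\<^esub> (n::nat) = residue_class (a ^ n)"
proof -
  interpret R: cring R_t by (rule cring_R_t)
  show ?thesis
    by (induction n) (simp_all add: R.nat_pow_Suc residue_class_simps mult.commute)
qed

lemma residue_class_eq_zero_iff: "residue_class a = \<zero>\<^bsub>R_t\<^esub> \<longleftrightarrow> F_t dvd a"
  by (simp add: residue_class_simps residue_class_eq_iff)

lemma domain_R_t: "domain R_t"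
proof -
  interpret R: cring R_t by (rule cring_R_t)
  show ?thesis
  proof
    have "\<not> F_t dvd 1" by (rule F_t_not_dvd_small) simp_all
    thus "\<one>\<^bsub>R_t\<^esub> \<noteq> \<zero>\<^bsub>R_t\<^esub>" unfolding residue_class_simps(3) residue_class_eq_zero_iff .
    fix a b assume ab: "a \<otimes>\<^bsub>R_t\<^esub> b = \<zero>\<^bsub>R_t\<^esub>" "a \<in> carrier R_t" "b \<in> carrier R_t"
    obtain p q where "a = residue_class p" "b = residue_class q"
      using ab(2,3) by (auto simp: carrier_R_t)
    thus "a = \<zero>\<^bsub>R_t\<^esub> \<or> b = \<zero>\<^bsub>R_t\<^esub>"
      using ab(1) F_t_prime[of p q] by (simp add: residue_class_simps(2) residue_class_eq_zero_iff)
  qed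
qed

definition preimage :: "Lt_xyz set set \<Rightarrow> Lt_xyz set" where
  "preimage I = {p. residue_class p \<in> I}"

lemma preimage_ideal: "ideal I R_t \<Longrightarrow> is_ideal (preimage I)"
proof -
  assume "ideal I R_t"
  then interpret ideal I R_t .
  show ?thesis unfolding is_ideal_def preimage_def
  proof (intro conjI ballI allI; (elim CollectE)?)
    show "0 \<in> {p. residue_class p \<in> I}"
      using additive_subgroup.zero_closed[OF is_additive_subgroup] by (simp add: residue_class_simps)
    show "a + b \<in> {p. residue_class p \<in> I}" if "residue_class a \<in> I" "residue_class b \<in> I" for a b
      using additive_subgroup.a_closed[OF is_additive_subgroup that] by (simp add: residue_class_simps)
    show "r * a \<in> {p. residue_class p \<in> I}" if "residue_class a \<in> I" for a r
      using I_l_closed[OF that residue_class_carrier[of r]] by (simp add: residue_class_simps)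
  qed
qed

lemma image_ideal:
  assumes "is_ideal I"
  shows "ideal (residue_class ` I) R_t"
proof (rule idealI)
  interpret R: cring R_t by (rule cring_R_t)
  show "ring R_t" by (rule R.ring_axioms)
  show "subgroup (residue_class ` I) (add_monoid R_t)"
  proof (rule R.add.subgroupI)
    show "residue_class ` I \<subseteq> carrier R_t" by (auto simp: carrier_R_t)
    show "residue_class ` I \<noteq> {}" using is_idealD(1)[OF assms] by blast
    show "\<ominus>\<^bsub>R_t\<^esub> a \<in> residue_class ` I" if a: "a \<in> residue_class ` I" for a
    proof -
      obtain p where p: "p \<in> I" "a = residue_class p" using a by blast
      have "residue_class (- 1 * p) \<oplus>\<^bsub>R_t\<^esub> a = \<zero>\<^bsub>R_t\<^esub>"
        unfolding p(2) residue_class_simps by simp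
      hence "\<ominus>\<^bsub>R_t\<^esub> a = residue_class (- 1 * p)"
        by (rule R.minus_equality) (simp_all add: p residue_class_carrier)
      thus ?thesis using is_idealD(3)[OF assms p(1), of "- 1"] by blast
    qed
    show "a \<oplus>\<^bsub>R_t\<^esub> b \<in> residue_class ` I" if ab: "a \<in> residue_class ` I" "b \<in> residue_class ` I" for a b
    proof -
      obtain p q where "p \<in> I" "a = residue_class p" "q \<in> I" "b = residue_class q" using ab by blast
      thus ?thesis using is_idealD(2)[OF assms] by (auto simp: residue_class_simps)
    qed
  qed
  fix a x assume ax: "a \<in> residue_class ` I" "x \<in> carrier R_t"
  obtain p q where pq: "p \<in> I" "a = residue_class p" "x = residue_class q"
    using ax by (auto simp: carrier_R_t)
  have "q * p \<in> I" using is_idealD(3)[OF assms pq(1)] .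
  thus "x \<otimes>\<^bsub>R_t\<^esub> a \<in> residue_class ` I" "a \<otimes>\<^bsub>R_t\<^esub> x \<in> residue_class ` I"
    by (auto simp: pq residue_class_simps mult.commute)
qed

lemma noetherian_domain_R_t: "noetherian_domain R_t"
proof -
  interpret R: domain R_t by (rule domain_R_t)
  have noeth: "noetherian_type TYPE(Lt_xyz)"
    by (intro hilbert_basis noetherian_field)
  show ?thesis
  proof
    fix I assume I: "ideal I R_t"
    interpret I: ideal I R_t by (rule I)
    have "\<exists>A. finite A \<and> A \<subseteq> preimage I \<and> (\<forall>J. is_ideal J \<longrightarrow> A \<subseteq> J \<longrightarrow> preimage I \<subseteq> J)"
      using noeth preimage_ideal[OF I] unfolding noetherian_type_def
      by (elim allE[of _ "preimage I"] impE) assumption+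
    then obtain A where A: "finite A" "A \<subseteq> preimage I"
      "\<And>J. is_ideal J \<Longrightarrow> A \<subseteq> J \<Longrightarrow> preimage I \<subseteq> J"
      by (elim exE conjE) simp
    have AI: "residue_class ` A \<subseteq> I" using A(2) by (auto simp: preimage_def)
    have carr: "residue_class ` A \<subseteq> carrier R_t" by (auto simp: carrier_R_t)
    have "I \<subseteq> Idl\<^bsub>R_t\<^esub> (residue_class ` A)"
    proof
      fix a assume a: "a \<in> I"
      then obtain p where p: "a = residue_class p" using I.Icarr by (auto simp: carrier_R_t)
      have "A \<subseteq> preimage (Idl\<^bsub>R_t\<^esub> (residue_class ` A))"
        using R.genideal_self[OF carr] by (auto simp: preimage_def)
      hence "preimage I \<subseteq> preimage (Idl\<^bsub>R_t\<^esub> (residue_class ` A))"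
        by (rule A(3)[OF preimage_ideal[OF R.genideal_ideal[OF carr]]])
      thus "a \<in> Idl\<^bsub>R_t\<^esub> (residue_class ` A)" using a by (auto simp: preimage_def p)
    qed
    moreover have "Idl\<^bsub>R_t\<^esub> (residue_class ` A) \<subseteq> I" by (rule R.genideal_minimal[OF I AI])
    ultimately show "\<exists>A\<subseteq>carrier R_t. finite A \<and> I = Idl\<^bsub>R_t\<^esub> A"
      using carr A(1) by (intro exI[of _ "residue_class ` A"]) auto
  qed
qed

lemma residue_class_two: "residue_class (a + a) = \<zero>\<^bsub>R_t\<^esub>"
proof -
  have "a + a = 0" by (rule char2_add_self) (simp add: CHAR_Lt)
  thus ?thesis by (simp only: residue_class_simps(4))
qed

lemma contains_field_R_t: "contains_field_of_char 2 R_t"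
proof -
  interpret R: domain R_t by (rule domain_R_t)
  define K where "K = {\<zero>\<^bsub>R_t\<^esub>, \<one>\<^bsub>R_t\<^esub>}"
  have two: "\<one>\<^bsub>R_t\<^esub> \<oplus>\<^bsub>R_t\<^esub> \<one>\<^bsub>R_t\<^esub> = \<zero>\<^bsub>R_t\<^esub>"
    unfolding residue_class_simps(3) residue_class_simps(1) by (rule residue_class_two)
  hence neg: "\<ominus>\<^bsub>R_t\<^esub> \<one>\<^bsub>R_t\<^esub> = \<one>\<^bsub>R_t\<^esub>" by (rule R.minus_equality) simp_all
  have "subring K R_t"
    by (rule R.subringI) (auto simp: K_def neg two)
  hence "subcring K R_t" by (rule R.subcringI')
  moreover have "Units (R_t \<lparr>carrier := K\<rparr>) = K - {\<zero>\<^bsub>R_t\<^esub>}"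
  proof -
    have units: "{x \<in> {o', i}. \<exists>y\<in>{o', i}. m y x = i \<and> m x y = i} = {o', i} - {o'}"
      if "m o' o' = o'" "m o' i = o'" "m i o' = o'" "m i i = i" "o' \<noteq> i" for m and o' i :: "Lt_xyz set"
      using that by auto
    have sub: "carrier (R_t \<lparr>carrier := K\<rparr>) = K" "x \<otimes>\<^bsub>R_t \<lparr>carrier := K\<rparr>\<^esub> y = x \<otimes>\<^bsub>R_t\<^esub> y"
      "\<one>\<^bsub>R_t \<lparr>carrier := K\<rparr>\<^esub> = \<one>\<^bsub>R_t\<^esub>" for x y by simp_all
    have "Units (R_t \<lparr>carrier := K\<rparr>) = {x \<in> {\<zero>\<^bsub>R_t\<^esub>, \<one>\<^bsub>R_t\<^esub>}. \<exists>y\<in>{\<zero>\<^bsub>R_t\<^esub>, \<one>\<^bsub>R_t\<^esub>}.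
        y \<otimes>\<^bsub>R_t\<^esub> x = \<one>\<^bsub>R_t\<^esub> \<and> x \<otimes>\<^bsub>R_t\<^esub> y = \<one>\<^bsub>R_t\<^esub>}"
      unfolding Units_def sub unfolding K_def by (rule refl)
    also have "\<dots> = K - {\<zero>\<^bsub>R_t\<^esub>}"
      unfolding K_def by (rule units) simp_all
    finally show ?thesis .
  qed
  ultimately have "subfield K R_t" by (rule R.subfieldI)
  moreover have "[n] \<cdot>\<^bsub>R_t\<^esub> \<one>\<^bsub>R_t\<^esub> = (if even n then \<zero>\<^bsub>R_t\<^esub> else \<one>\<^bsub>R_t\<^esub>)" for n :: nat
    by (induction n) (auto simp: two R.add.nat_pow_Suc)
  hence "\<forall>n::nat. [n] \<cdot>\<^bsub>R_t\<^esub> \<one>\<^bsub>R_t\<^esub> = \<zero>\<^bsub>R_t\<^esub> \<longleftrightarrow> 2 dvd n" by simp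
  ultimately show ?thesis unfolding contains_field_of_char_def by (intro exI[of _ K] conjI)
qed

subsection \<open>Dimension\<close>

lemma primeideal_kernel:
  fixes h :: "Lt_xyz \<Rightarrow> 'd::idom"
  assumes h: "ring_map h" and F: "h F_t = 0"
  shows "primeideal {residue_class g | g. h g = 0} R_t"
    and "residue_class g \<in> {residue_class g | g. h g = 0} \<longleftrightarrow> h g = 0"
proof -
  interpret h: ring_map h by (rule h)
  interpret R: cring R_t by (rule cring_R_t)
  define P where "P = {residue_class g | g. h g = 0}"
  have mem: "residue_class g \<in> P \<longleftrightarrow> h g = 0" for g
  proof
    assume "residue_class g \<in> P"
    then obtain g' where "F_t dvd g - g'" "h g' = 0" by (auto simp: P_def residue_class_eq_iff)
    then obtain q where "g - g' = F_t * q" by (elim dvdE)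
    hence "g = F_t * q + g'" by (simp add: algebra_simps)
    thus "h g = 0" using F \<open>h g' = 0\<close> by (simp add: h.simps)
  qed (auto simp: P_def)
  show "residue_class g \<in> {residue_class g | g. h g = 0} \<longleftrightarrow> h g = 0"
    using mem unfolding P_def .
  have "is_ideal {g. h g = 0}" by (auto simp: is_ideal_def h.simps)
  moreover have "P = residue_class ` {g. h g = 0}" by (auto simp: P_def)
  ultimately have "ideal P R_t" using image_ideal by simp
  moreover have "carrier R_t \<noteq> P"
    using mem[of 1] residue_class_carrier[of 1] by (auto simp: h.one)
  moreover have "a \<in> P \<or> b \<in> P" if "a \<in> carrier R_t" "b \<in> carrier R_t" "a \<otimes>\<^bsub>R_t\<^esub> b \<in> P" for a b
    using that by (auto simp: carrier_R_t residue_class_simps mem h.mult)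
  ultimately have "primeideal P R_t" using R.is_cring by (intro primeidealI)
  thus "primeideal {residue_class g | g. h g = 0} R_t" unfolding P_def .
qed

text \<open>In a chain of four primes take \<open>u\<close>, \<open>v\<close>, \<open>w\<close>,
  each new in the next prime. Peeling their dependence relation with
  \<open>lowest_coefficient\<close>, once for each of them, ends with a nonzero scalar in the
  largest prime.\<close>

lemma prime_chain_length:
  assumes prime: "\<And>i. i \<le> n \<Longrightarrow> primeideal (P i) R_t" and strict: "\<And>i. i < n \<Longrightarrow> P i \<subset> P (Suc i)"
  shows "n \<le> 2"
proof (rule ccontr)
  assume "\<not> n \<le> 2"
  define Q where "Q i = preimage (P i)" for i
  have Q: "is_ideal (Q i)" if "i \<le> 3" for i
    unfolding Q_def by (rule preimage_ideal) (use prime[of i] that \<open>\<not> n \<le> 2\<close> in \<open>auto simp: primeideal_def\<close>)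
  have Qp: "a \<in> Q i \<or> b \<in> Q i" if "i \<le> 3" "a * b \<in> Q i" for i a b
    using primeideal.I_prime[OF prime, of i "residue_class a" "residue_class b"] that \<open>\<not> n \<le> 2\<close>
    by (auto simp: Q_def preimage_def residue_class_simps residue_class_carrier)
  have Qs: "Q i \<subseteq> Q (Suc i)" "\<exists>u. u \<in> Q (Suc i) \<and> u \<notin> Q i" if "i < 3" for i
  proof -
    have i: "i < n" using that \<open>\<not> n \<le> 2\<close> by simp
    show "Q i \<subseteq> Q (Suc i)" using strict[OF i] by (auto simp: Q_def preimage_def)
    obtain a where a: "a \<in> P (Suc i)" "a \<notin> P i" using strict[OF i] by blast
    have "a \<in> carrier R_t"
      using prime[of "Suc i"] i a(1) ideal.Icarr[of "P (Suc i)" R_t a] by (auto simp: primeideal_def)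
    thus "\<exists>u. u \<in> Q (Suc i) \<and> u \<notin> Q i" using a by (auto simp: Q_def preimage_def carrier_R_t)
  qed
  obtain u where u: "u \<in> Q 1" "u \<notin> Q 0" using Qs(2)[of 0] by auto
  obtain v where v: "v \<in> Q 2" "v \<notin> Q 1" using Qs(2)[of 1] by (auto simp: numeral_2_eq_2)
  obtain w where w: "w \<in> Q 3" "w \<notin> Q 2" using Qs(2)[of 2] by (auto simp: numeral_3_eq_3 numeral_2_eq_2)
  have step: "a \<in> Q (Suc i)" if "i < 3" "s \<in> Q (Suc i)" "a + s * b \<in> Q i" for a b s i
  proof -
    have I: "is_ideal (Q (Suc i))" using Q that(1) by simp
    have "a + s * b \<in> Q (Suc i)" using Qs(1)[OF that(1)] that(3) by blast
    from is_idealD(4)[OF I this is_idealD(3)[OF I that(2), of b]]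
    show ?thesis by (simp add: mult.commute)
  qed
  obtain G where G: "G \<noteq> 0" "F_t dvd eval3 w v u G"
    using algebraic_dependence[of tau w v u] by (auto simp: F_t_eq)
  have "residue_class (eval3 w v u G) = residue_class 0" using G(2) by (simp add: residue_class_eq_iff)
  hence 0: "poly (map_poly (eval2 w v) G) u \<in> Q 0"
    using is_idealD(1)[OF Q[of 0]] unfolding eval3_def by (simp add: Q_def preimage_def)
  have u1: "u \<in> Q (Suc 0)" and v1: "v \<in> Q (Suc 1)" and w1: "w \<in> Q (Suc 2)"
    using u(1) v(1) w(1) by (simp_all add: numeral_2_eq_2 numeral_3_eq_3)
  have "\<exists>a. a \<noteq> 0 \<and> eval2 w v a \<in> Q (Suc 0)"
  proof (rule lowest_coefficient[OF ring_map_eval2 0 G(1) u(2)])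
    show "a \<in> Q 0 \<or> b \<in> Q 0" if "a * b \<in> Q 0" for a b by (rule Qp[OF _ that]) simp
    show "a \<in> Q (Suc 0)" if "a + u * b \<in> Q 0" for a b by (rule step[OF _ u1 that]) simp
  qed
  then obtain G1 where G1: "G1 \<noteq> 0" "eval2 w v G1 \<in> Q (Suc 0)" by (elim exE conjE)
  have 1: "poly (map_poly (eval1 w) G1) v \<in> Q 1" using G1(2) unfolding eval2_def by simp
  have "\<exists>a. a \<noteq> 0 \<and> eval1 w a \<in> Q (Suc 1)"
  proof (rule lowest_coefficient[OF ring_map_eval1 1 G1(1) v(2)])
    show "a \<in> Q 1 \<or> b \<in> Q 1" if "a * b \<in> Q 1" for a b by (rule Qp[OF _ that]) simp
    show "a \<in> Q (Suc 1)" if "a + v * b \<in> Q 1" for a b by (rule step[OF _ v1 that]) simp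
  qed
  then obtain G2 where G2: "G2 \<noteq> 0" "eval1 w G2 \<in> Q (Suc 1)" by (elim exE conjE)
  have 2: "poly (map_poly cst G2) w \<in> Q 2" using G2(2) unfolding eval1_def by (simp add: numeral_2_eq_2)
  have "\<exists>c. c \<noteq> 0 \<and> cst c \<in> Q (Suc 2)"
  proof (rule lowest_coefficient[OF ring_map_cst 2 G2(1) w(2)])
    show "a \<in> Q 2 \<or> b \<in> Q 2" if "a * b \<in> Q 2" for a b by (rule Qp[OF _ that]) simp
    show "a \<in> Q (Suc 2)" if "a + w * b \<in> Q 2" for a b by (rule step[OF _ w1 that]) simp
  qed
  then obtain c where "c \<noteq> 0" "cst c \<in> Q (Suc 2)" by (elim exE conjE)
  hence c: "c \<noteq> 0" "cst c \<in> Q 3" by (simp_all add: numeral_2_eq_2 numeral_3_eq_3)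
  have "cst (1 / c) * cst c \<in> Q 3" by (rule is_idealD(3)[OF Q c(2)]) simp
  moreover have "cst (1 / c) * cst c = 1" using c(1) by (simp add: cst_def one_pCons)
  ultimately have 1: "1 \<in> Q 3" by simp
  have "carrier R_t \<subseteq> P 3"
  proof
    fix a assume "a \<in> carrier R_t"
    then obtain p where p: "a = residue_class p" by (auto simp: carrier_R_t)
    have "p * 1 \<in> Q 3" by (rule is_idealD(3)[OF Q 1]) simp
    thus "a \<in> P 3" by (simp add: Q_def preimage_def p)
  qed
  moreover have pr: "primeideal (P 3) R_t" using prime \<open>\<not> n \<le> 2\<close> by simp
  hence "P 3 \<subseteq> carrier R_t" using ideal.Icarr[of "P 3" R_t] by (auto simp: primeideal_def)
  ultimately show False using primeideal.I_notcarr[OF pr] by blast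
qed

lemma krull_dim_R_t: "krull_dim R_t = 2"
  unfolding krull_dim_def
proof (rule antisym)
  show "Sup {enat n | n. \<exists>P. (\<forall>i\<le>n. primeideal (P i) R_t) \<and> (\<forall>i<n. P i \<subset> P (Suc i))} \<le> 2"
  proof (rule Sup_least)
    fix d assume "d \<in> {enat n | n. \<exists>P. (\<forall>i\<le>n. primeideal (P i) R_t) \<and> (\<forall>i<n. P i \<subset> P (Suc i))}"
    then obtain n P where "d = enat n" "\<forall>i\<le>n. primeideal (P i) R_t" "\<forall>i<n. P i \<subset> P (Suc i)" by blast
    thus "d \<le> 2" using prime_chain_length[of n P] by (simp add: numeral_eq_enat)
  qed
  \<comment> \<open>The chain is \<open>0\<close>, \<open>(y, z)\<close>, \<open>(x, y, z)\<close>,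
    given as kernels of \<open>theta\<close>, of evaluation at \<open>y = z = 0\<close> and of
    evaluation at the origin; the quartic vanishes under all three.\<close>
  define h1 where "h1 g = poly (poly g 0) 0" for g :: Lt_xyz
  define h2 where "h2 g = poly (h1 g) 0" for g :: Lt_xyz
  have h1: "ring_map h1" unfolding h1_def by (rule ring_map_comp[OF ring_map_poly ring_map_poly])
  have h2: "ring_map h2" unfolding h2_def by (rule ring_map_comp[OF h1 ring_map_poly])
  have F: "theta F_t = 0" "h1 F_t = 0" "h2 F_t = 0"
    by (simp_all add: theta_eq_0_iff F_t_eq h1_def h2_def quartic_eq)
  define P where "P i = (if i = 0 then {residue_class g | g. theta g = 0}
    else if i = 1 then {residue_class g | g. h1 g = 0} else {residue_class g | g. h2 g = 0})" for i :: nat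
  note mem = primeideal_kernel(2)[OF ring_map_theta F(1)] primeideal_kernel(2)[OF h1 F(2)]
    primeideal_kernel(2)[OF h2 F(3)]
  have P012: "P 0 = {residue_class g | g. theta g = 0}" "P (Suc 0) = {residue_class g | g. h1 g = 0}"
    "P 2 = {residue_class g | g. h2 g = 0}" by (simp_all add: P_def)
  have prime: "\<forall>i\<le>2. primeideal (P i) R_t"
    using primeideal_kernel(1)[OF ring_map_theta F(1)] primeideal_kernel(1)[OF h1 F(2)]
      primeideal_kernel(1)[OF h2 F(3)] by (simp add: P_def)
  have "P 0 \<subset> P (Suc 0)"
  proof
    have "h1 g = 0" if "theta g = 0" for g
      using that F(2) by (auto simp: theta_eq_0_iff ring_map.mult[OF h1] elim!: dvdE)
    thus "P 0 \<subseteq> P (Suc 0)" by (auto simp: P_def)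
    have "residue_class py \<in> P (Suc 0)" unfolding P012 mem by (simp add: h1_def py_def)
    moreover have "\<not> F_t dvd py" by (rule F_t_not_dvd_small) (simp_all add: py_def)
    hence "residue_class py \<notin> P 0" unfolding P012 mem unfolding theta_eq_0_iff .
    ultimately show "P 0 \<noteq> P (Suc 0)" by blast
  qed
  moreover have "P (Suc 0) \<subset> P 2"
  proof
    show "P (Suc 0) \<subseteq> P 2" by (auto simp: P_def h2_def)
    have "residue_class px \<in> P 2" unfolding P012 mem by (simp add: h1_def h2_def px_def)
    moreover have "residue_class px \<notin> P (Suc 0)" unfolding P012 mem by (simp add: h1_def px_def)
    ultimately show "P (Suc 0) \<noteq> P 2" by blast
  qed
  ultimately have "\<forall>i<2. P i \<subset> P (Suc i)" by (auto simp: less_Suc_eq numeral_2_eq_2)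
  hence "enat 2 \<in> {enat n | n. \<exists>P. (\<forall>i\<le>n. primeideal (P i) R_t) \<and> (\<forall>i<n. P i \<subset> P (Suc i))}"
    using prime by blast
  thus "2 \<le> Sup {enat n | n. \<exists>P. (\<forall>i\<le>n. primeideal (P i) R_t) \<and> (\<forall>i<n. P i \<subset> P (Suc i))}"
    by (intro Sup_upper) (simp add: numeral_eq_enat)
qed

subsection \<open>Membership in the tight closure\<close>

lemma f_t_in_tight_closure: "f_t \<in> tight_closure 2 R_t I_t"
proof -
  interpret R: domain R_t by (rule domain_R_t)
  define S where "S = {residue_class (x_gen ^ 4), residue_class (y_gen ^ 4), residue_class (z_gen ^ 4)}"
  have S: "S \<subseteq> carrier R_t" by (auto simp: S_def residue_class_carrier)
  have SI: "S \<subseteq> I_t" unfolding I_t_def S_def[symmetric] by (rule R.genideal_self[OF S])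
  have IC: "I_t \<subseteq> carrier R_t"
    unfolding I_t_def S_def[symmetric]
    using ideal.Icarr[OF R.genideal_ideal[OF S]] by blast
  have "residue_class py \<otimes>\<^bsub>R_t\<^esub> f_t [^]\<^bsub>R_t\<^esub> (2 ^ e :: nat) \<in> frobenius_power R_t I_t (2 ^ e)" for e :: nat
  proof -
    define q :: nat where "q = 2 ^ e"
    define T where "T = (\<lambda>a. a [^]\<^bsub>R_t\<^esub> q) ` I_t"
    have T: "T \<subseteq> carrier R_t" using IC by (auto simp: T_def)
    define K where "K = preimage (Idl\<^bsub>R_t\<^esub> T)"
    have K: "is_ideal K" unfolding K_def by (rule preimage_ideal[OF R.genideal_ideal[OF T]])
    have gens: "g ^ (4 * q) \<in> K" if "residue_class (g ^ 4) \<in> S" for g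
    proof -
      have "residue_class (g ^ 4) [^]\<^bsub>R_t\<^esub> q \<in> T" using that SI by (auto simp: T_def)
      thus ?thesis using R.genideal_self[OF T]
        by (auto simp: K_def preimage_def residue_class_power power_mult)
    qed
    have "F_t \<in> K"
    proof -
      have "residue_class F_t = residue_class 0" by (simp add: residue_class_eq_iff)
      thus ?thesis using is_idealD(1)[OF K] by (simp add: K_def preimage_def)
    qed
    obtain a b c d where "py * (py * pz) ^ (3 * q)
      = a * px ^ (4 * q) + b * py ^ (4 * q) + c * pz ^ (4 * q) + d * F_t"
      using yz_power_in_frobenius_ideal[OF CHAR_Lt lam_tau_nz, of e]
      unfolding frobenius_ideal_def q_def F_t_eq by blast
    moreover have "px ^ (4 * q) \<in> K" "py ^ (4 * q) \<in> K" "pz ^ (4 * q) \<in> K"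
      by (rule gens; simp add: S_def gens_eq)+
    ultimately have "py * (py * pz) ^ (3 * q) \<in> K"
      using \<open>F_t \<in> K\<close> by (simp add: is_idealD(2,3)[OF K])
    moreover have "py * (py * pz) ^ (3 * q) = (py * (py ^ 3 * pz ^ 3) ^ q :: Lt_xyz)"
      by (simp add: power_mult_distrib flip: power_mult)
    ultimately have "residue_class (py * (py ^ 3 * pz ^ 3) ^ q) \<in> Idl\<^bsub>R_t\<^esub> T"
      unfolding K_def preimage_def by (simp only: mem_Collect_eq)
    thus ?thesis
      unfolding frobenius_power_def f_t_def T_def[symmetric] q_def[symmetric]
      by (simp only: residue_class_power residue_class_simps gens_eq)
  qed
  moreover have "residue_class py \<noteq> \<zero>\<^bsub>R_t\<^esub>"
    unfolding residue_class_eq_zero_iff by (rule F_t_not_dvd_small) (simp_all add: py_def)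
  ultimately show ?thesis
    unfolding tight_closure_def f_t_def using residue_class_carrier by blast
qed

subsection \<open>Common denominators\<close>

text \<open>The map \<open>i\<close> tells how the ground ring sits inside the coefficients, so the
  lemma can be applied once per variable; denominators of the coefficients are multiplied
  together.\<close>

lemma common_denominator:
  fixes f :: "'a::comm_ring_1 \<Rightarrow> 'b::comm_ring_1" and i :: "'d::idom \<Rightarrow> 'a"
  assumes f: "ring_map f" and i: "ring_map i"
    and base: "\<And>a. \<exists>D a'. D \<noteq> 0 \<and> f (i D) * a = f a'"
  shows "\<exists>D p'. D \<noteq> 0 \<and> map_poly f [:i D:] * p = map_poly f p'"
proof -
  interpret f: ring_map f by (rule f)
  interpret i: ring_map i by (rule i)
  interpret fp: ring_map "map_poly f" by (rule f.ring_map_map_poly)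
  have const: "map_poly f [:c:] = [:f c:]" for c by (simp add: f.map_poly_pCons)
  show ?thesis
  proof (induction p)
    case 0
    show ?case by (intro exI[of _ 1] exI[of _ 0]) simp
  next
    case (pCons a p)
    obtain D p' where p: "D \<noteq> 0" "map_poly f [:i D:] * p = map_poly f p'" using pCons.IH by (elim exE conjE)
    obtain E a' where a: "E \<noteq> 0" "f (i E) * a = f a'" using base[of a] by (elim exE conjE)
    have "smult (f (i (E * D))) p = [:f (i E):] * (map_poly f [:i D:] * p)"
      by (simp add: const i.mult f.mult mult.commute)
    also have "\<dots> = map_poly f ([:i E:] * p')" by (simp only: p(2)) (simp only: fp.mult const)
    finally have 1: "smult (f (i (E * D))) p = map_poly f ([:i E:] * p')" .
    have "f (i (E * D)) * a = f (i D) * (f (i E) * a)" by (simp add: i.mult f.mult algebra_simps)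
    also have "\<dots> = f (i D * a')" by (simp only: a(2) f.mult)
    finally have "map_poly f [:i (E * D):] * pCons a p = map_poly f (pCons (i D * a') ([:i E:] * p'))"
      using 1 unfolding const f.map_poly_pCons by (simp add: mult.commute)
    moreover have "E * D \<noteq> 0" using a(1) p(1) by simp
    ultimately show ?case by (intro exI conjI)
  qed
qed

lemma fract_denominator: "\<exists>D a'. D \<noteq> 0 \<and> to_fract D * a = to_fract a'"
proof -
  obtain n D where "a = Fract n D" "D \<noteq> 0" by (cases a) auto
  hence "to_fract D * a = to_fract n" by (simp add: to_fract_def eq_fract)
  thus ?thesis using \<open>D \<noteq> 0\<close> by (intro exI conjI)
qed

lemma ring_map_id: "ring_map (\<lambda>x. x)" by standard simp_all

lemma ring_map_const: "ring_map i \<Longrightarrow> ring_map (\<lambda>D. [:i D:])"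
  by (simp add: ring_map_def one_pCons)

lemma fract_poly_denominator:
  "\<exists>D p'. D \<noteq> 0 \<and> map_poly (map_poly to_fract) [:[:D:]:] * p = map_poly (map_poly to_fract) p'"
  by (intro common_denominator[where i = "\<lambda>D. [:D:]"] common_denominator[where i = "\<lambda>D. D"]
      ring_map.ring_map_map_poly ring_map_to_fract ring_map_const ring_map_id fract_denominator)

lemma fract_poly3_denominator: "\<exists>D p'. D \<noteq> 0 \<and> map3 to_fract (cst D) * p = map3 to_fract p'"
  unfolding map3_def cst_def
  by (intro common_denominator[where i = "\<lambda>D. [:[:D:]:]"] fract_poly_denominator
      ring_map.ring_map_map_poly ring_map_to_fract ring_map_const ring_map_id)

text \<open>The elements of \<open>L(t)[x,y,z]\<close> with coefficients in \<open>L[t, 1/D]\<close>.\<close>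

definition loc :: "L poly \<Rightarrow> Lt_xyz set" where
  "loc D = {p. \<exists>k p'. map3 to_fract (cst D ^ k) * p = map3 to_fract p'}"

interpretation fr: ring_map "map3 (to_fract :: L poly \<Rightarrow> Lt)"
  by (rule ring_map_map3[OF ring_map_to_fract])

lemma locI: "map3 to_fract (cst D ^ k) * p = map3 to_fract p' \<Longrightarrow> p \<in> loc D"
  unfolding loc_def by blast

lemma locE:
  assumes "p \<in> loc D"
  obtains k p' where "map3 to_fract (cst D ^ k) * p = map3 to_fract p'"
  using assms unfolding loc_def by blast

lemma loc_integral: "map3 to_fract p \<in> loc D"
  by (rule locI[of _ 0]) (simp add: fr.one)

lemma loc_0: "0 \<in> loc D"
  using loc_integral[of 0 D] by (simp only: fr.zero)

lemma loc_add:
  assumes "p \<in> loc D" "q \<in> loc D"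
  shows "p + q \<in> loc D"
proof -
  obtain k p' where p: "map3 to_fract (cst D ^ k) * p = map3 to_fract p'" by (rule locE[OF assms(1)])
  obtain l q' where q: "map3 to_fract (cst D ^ l) * q = map3 to_fract q'" by (rule locE[OF assms(2)])
  have "map3 to_fract (cst D ^ (k + l)) * (p + q)
    = map3 to_fract (cst D ^ l) * (map3 to_fract (cst D ^ k) * p)
      + map3 to_fract (cst D ^ k) * (map3 to_fract (cst D ^ l) * q)"
    by (simp only: power_add fr.mult) (simp only: algebra_simps)
  thus ?thesis unfolding p q by (intro locI) (simp only: fr.mult[symmetric] fr.add[symmetric])
qed

lemma loc_mult:
  assumes "p \<in> loc D" "q \<in> loc D"
  shows "p * q \<in> loc D"
proof -
  obtain k p' where p: "map3 to_fract (cst D ^ k) * p = map3 to_fract p'" by (rule locE[OF assms(1)])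
  obtain l q' where q: "map3 to_fract (cst D ^ l) * q = map3 to_fract q'" by (rule locE[OF assms(2)])
  have "map3 to_fract (cst D ^ (k + l)) * (p * q)
    = (map3 to_fract (cst D ^ k) * p) * (map3 to_fract (cst D ^ l) * q)"
    by (simp only: power_add fr.mult) (simp only: mult_ac)
  thus ?thesis unfolding p q by (intro locI) (simp only: fr.mult[symmetric])
qed

lemma loc_mono:
  assumes "p \<in> loc D"
  shows "p \<in> loc (D * E)"
proof -
  interpret c: ring_map "cst :: L poly \<Rightarrow> _" by (rule ring_map_cst)
  obtain k p' where p: "map3 to_fract (cst D ^ k) * p = map3 to_fract p'" by (rule locE[OF assms])
  have "map3 to_fract (cst (D * E) ^ k) * p = map3 to_fract (cst E ^ k) * (map3 to_fract (cst D ^ k) * p)"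
    by (simp only: power_mult_distrib fr.mult c.mult) (simp only: mult_ac)
  thus ?thesis unfolding p by (intro locI) (simp only: fr.mult[symmetric])
qed

lemma finite_subset_loc: "finite S \<Longrightarrow> \<exists>D. D \<noteq> 0 \<and> S \<subseteq> loc D"
proof (induction rule: finite_induct)
  case empty
  show ?case by (intro exI[of _ 1]) simp
next
  case (insert p S)
  obtain D where D: "D \<noteq> 0" "S \<subseteq> loc D" using insert.IH by (elim exE conjE)
  obtain E p' where E: "E \<noteq> 0" "map3 to_fract (cst E) * p = map3 to_fract p'"
    using fract_poly3_denominator[of p] by (elim exE conjE)
  have "p \<in> loc E" using E(2) by (intro locI[of _ 1]) simp
  hence "p \<in> loc (D * E)" using loc_mono[of p E D] by (simp only: mult.commute[of D E])
  moreover have "S \<subseteq> loc (D * E)" using D(2) loc_mono by (intro subsetI) (rule loc_mono, rule subsetD)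
  moreover have "D * E \<noteq> 0" using D(1) E(1) by simp
  ultimately show ?case by (intro exI[of _ "D * E"]) simp
qed

subsection \<open>Module-finite extensions\<close>

text \<open>Instead of the inclusion of \<open>R_t\<close>, a map from polynomials with kernel
  generated by \<open>F_t\<close> is used, so that coefficients remain polynomials whose
  denominators in \<open>t\<close> can be controlled.\<close>

locale extension_domain = domain T for T :: "('c, 'm) ring_scheme" (structure) +
  fixes \<pi> :: "Lt_xyz \<Rightarrow> 'c"
  assumes hom_closed [simp]: "\<pi> p \<in> carrier T"
    and hom_add: "\<pi> (p + q) = \<pi> p \<oplus> \<pi> q"
    and hom_mult: "\<pi> (p * q) = \<pi> p \<otimes> \<pi> q"
    and hom_one: "\<pi> 1 = \<one>"
    and kernel: "\<pi> p = \<zero> \<longleftrightarrow> F_t dvd p"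
begin

lemma hom_zero: "\<pi> 0 = \<zero>"
  by (simp add: kernel)

lemma hom_power: "\<pi> (p ^ n) = \<pi> p [^] n"
  by (induction n) (simp_all add: hom_one hom_mult m_comm)

lemma add_self: "u \<in> carrier T \<Longrightarrow> u \<oplus> u = \<zero>"
proof -
  assume u: "u \<in> carrier T"
  have "1 + 1 = (0 :: Lt_xyz)" by (rule char2_add_self) (simp add: CHAR_Lt)
  hence "\<one> \<oplus> \<one> = \<zero>" using hom_add[of 1 1] by (simp add: hom_one hom_zero)
  hence "(\<one> \<oplus> \<one>) \<otimes> u = \<zero>" using u by simp
  thus ?thesis using u by (simp add: l_distr)
qed

lemma add_cancel: "u \<in> carrier T \<Longrightarrow> v \<in> carrier T \<Longrightarrow> u \<oplus> (u \<oplus> v) = v"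
  by (simp add: a_assoc[symmetric] add_self)

lemma frobenius_add:
  assumes [simp]: "u \<in> carrier T" "v \<in> carrier T"
  shows "(u \<oplus> v) [^] (2 ^ n :: nat) = u [^] (2 ^ n :: nat) \<oplus> v [^] (2 ^ n :: nat)"
proof (induction n)
  case (Suc n)
  have sq: "w [^] (2 ^ Suc n :: nat) = w [^] (2 ^ n :: nat) \<otimes> w [^] (2 ^ n :: nat)"
    if "w \<in> carrier T" for w
    using that by (simp add: nat_pow_mult mult_2)
  define a b where "a = u [^] (2 ^ n :: nat)" and "b = v [^] (2 ^ n :: nat)"
  have [simp]: "a \<in> carrier T" "b \<in> carrier T" by (simp_all add: a_def b_def)
  have "(a \<oplus> b) \<otimes> (a \<oplus> b) = a \<otimes> a \<oplus> (a \<otimes> b \<oplus> (a \<otimes> b \<oplus> b \<otimes> b))"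
    by (simp add: l_distr r_distr m_comm[of b a] a_assoc)
  also have "\<dots> = a \<otimes> a \<oplus> b \<otimes> b" by (simp add: add_cancel)
  finally show ?case using Suc.IH by (simp add: sq a_def b_def del: power_Suc)
qed simp

definition submodule :: "'c set \<Rightarrow> bool" where
  "submodule N \<longleftrightarrow> N \<subseteq> carrier T \<and> \<zero> \<in> N \<and> (\<forall>u\<in>N. \<forall>v\<in>N. u \<oplus> v \<in> N) \<and> (\<forall>u\<in>N. \<forall>p. \<pi> p \<otimes> u \<in> N)"

lemma submoduleD:
  assumes "submodule N"
  shows "u \<in> N \<Longrightarrow> u \<in> carrier T" "\<zero> \<in> N" "u \<in> N \<Longrightarrow> v \<in> N \<Longrightarrow> u \<oplus> v \<in> N" "u \<in> N \<Longrightarrow> \<pi> p \<otimes> u \<in> N"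
  using assms unfolding submodule_def by auto

text \<open>\<open>N\<close> is the kernel of a functional to the fraction field of
  \<open>R_t\<close> that is nonzero at 1, with common denominator \<open>d\<close> on
  \<open>B\<close>. A generator dependent on \<open>R_t\<close> modulo \<open>N\<close> only
  enlarges \<open>d\<close>; an independent one is adjoined to \<open>N\<close>, which then still
  meets \<open>R_t\<close> in 0.\<close>

lemma complementary_submodule:
  assumes "finite B" "B \<subseteq> carrier T"
  shows "\<exists>N d. submodule N \<and> (\<forall>p. \<pi> p \<in> N \<longrightarrow> F_t dvd p) \<and> \<not> F_t dvd d \<and>
    (\<forall>b\<in>B. \<exists>p. \<pi> d \<otimes> b \<oplus> \<pi> p \<in> N)"
  using assms
proof (induction rule: finite_induct)
  case empty
  have "submodule {\<zero>}" by (simp add: submodule_def)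
  moreover have "\<not> F_t dvd 1" by (rule F_t_not_dvd_small) simp_all
  ultimately show ?case by (intro exI[of _ "{\<zero>}"] exI[of _ 1]) (simp add: kernel)
next
  case (insert b B)
  obtain N d where N: "submodule N" "\<And>p. \<pi> p \<in> N \<Longrightarrow> F_t dvd p" "\<not> F_t dvd d"
    "\<And>b. b \<in> B \<Longrightarrow> \<exists>p. \<pi> d \<otimes> b \<oplus> \<pi> p \<in> N"
    using insert.IH insert.prems by auto
  have [simp]: "b \<in> carrier T" and BT: "\<And>c. c \<in> B \<Longrightarrow> c \<in> carrier T" using insert.prems by auto
  note NT = submoduleD[OF N(1)]
  show ?case
  proof (cases "\<exists>d' p. \<not> F_t dvd d' \<and> \<pi> d' \<otimes> b \<oplus> \<pi> p \<in> N")
    case True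
    then obtain d' p' where d': "\<not> F_t dvd d'" "\<pi> d' \<otimes> b \<oplus> \<pi> p' \<in> N" by (elim exE conjE)
    have "\<not> F_t dvd d * d'" using F_t_prime[of d d'] N(3) d'(1) by (elim contrapos_nn) simp
    moreover have "\<exists>p. \<pi> (d * d') \<otimes> c \<oplus> \<pi> p \<in> N" if c: "c \<in> insert b B" for c
    proof (cases "c = b")
      case True
      have "\<pi> d \<otimes> (\<pi> d' \<otimes> b \<oplus> \<pi> p') = \<pi> (d * d') \<otimes> b \<oplus> \<pi> (d * p')"
        by (simp add: hom_mult r_distr m_assoc)
      thus ?thesis using NT(4)[OF d'(2), of d] unfolding True by (intro exI[of _ "d * p'"]) simp
    next
      case False
      hence cB: "c \<in> B" using c by simp
      note [simp] = BT[OF cB]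
      obtain p where p: "\<pi> d \<otimes> c \<oplus> \<pi> p \<in> N" using N(4)[OF cB] by (elim exE)
      have "\<pi> d' \<otimes> (\<pi> d \<otimes> c \<oplus> \<pi> p) = \<pi> (d * d') \<otimes> c \<oplus> \<pi> (d' * p)"
        by (simp add: hom_mult mult.commute[of d d'] r_distr m_assoc)
      thus ?thesis using NT(4)[OF p, of d'] by (intro exI[of _ "d' * p"]) simp
    qed
    ultimately show ?thesis using N(1,2) by (intro exI[of _ N] exI[of _ "d * d'"]) simp
  next
    case False
    define N' where "N' = {n \<oplus> \<pi> c \<otimes> b | n c. n \<in> N}"
    have N'I: "n \<oplus> \<pi> c \<otimes> b \<in> N'" if "n \<in> N" for n c using that unfolding N'_def by blast
    have sub: "n \<in> N'" if n: "n \<in> N" for n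
      using N'I[OF n, of 0] NT(1)[OF n] by (simp add: hom_zero)
    have "submodule N'"
      unfolding submodule_def
    proof (intro conjI ballI allI subsetI)
      show "\<zero> \<in> N'" by (rule sub[OF NT(2)])
      show "u \<in> carrier T" if "u \<in> N'" for u using that NT(1) by (auto simp: N'_def)
      fix u assume "u \<in> N'"
      then obtain n c where u: "u = n \<oplus> \<pi> c \<otimes> b" "n \<in> N" unfolding N'_def by blast
      note [simp] = NT(1)[OF u(2)]
      show "\<pi> p \<otimes> u \<in> N'" for p
      proof -
        have "\<pi> p \<otimes> u = \<pi> p \<otimes> n \<oplus> \<pi> (p * c) \<otimes> b" by (simp add: u(1) r_distr hom_mult m_assoc)
        thus ?thesis using N'I[OF NT(4)[OF u(2), of p]] by simp
      qed
      fix v assume "v \<in> N'"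
      then obtain n' c' where v: "v = n' \<oplus> \<pi> c' \<otimes> b" "n' \<in> N" unfolding N'_def by blast
      note [simp] = NT(1)[OF v(2)]
      have "u \<oplus> v = (n \<oplus> n') \<oplus> \<pi> (c + c') \<otimes> b"
        by (simp add: u(1) v(1) l_distr hom_add a_ac)
      thus "u \<oplus> v \<in> N'" using N'I[OF NT(3)[OF u(2) v(2)]] by simp
    qed
    moreover have "F_t dvd p" if p: "\<pi> p \<in> N'" for p
    proof -
      obtain n c where n: "\<pi> p = n \<oplus> \<pi> c \<otimes> b" "n \<in> N" using p unfolding N'_def by blast
      note [simp] = NT(1)[OF n(2)]
      have "\<pi> c \<otimes> b \<oplus> \<pi> p = n"
        by (simp add: n(1) a_comm[of n] add_cancel)
      hence "F_t dvd c" using False n(2) by auto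
      hence "\<pi> p = n" using n(1) by (simp add: kernel[symmetric])
      thus ?thesis using N(2)[of p] n(2) by simp
    qed
    moreover have "\<exists>p. \<pi> d \<otimes> c \<oplus> \<pi> p \<in> N'" if c: "c \<in> insert b B" for c
    proof (cases "c = b")
      case True
      show ?thesis unfolding True using N'I[OF NT(2), of d] by (intro exI[of _ 0]) (simp add: hom_zero)
    next
      case False
      thus ?thesis using N(4)[of c] c sub by auto
    qed
    ultimately show ?thesis using N(3) by (intro exI[of _ N'] exI[of _ d]) simp
  qed
qed

text \<open>The coefficient set \<open>G\<close> will be \<open>loc D\<close>; keeping it explicit
  is what bounds the denominators of all powers at once.\<close>

inductive_set gspan :: "Lt_xyz set \<Rightarrow> 'c set \<Rightarrow> 'c set" for G B where
  zero: "\<zero> \<in> gspan G B"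
| step: "m \<in> gspan G B \<Longrightarrow> g \<in> G \<Longrightarrow> b \<in> B \<Longrightarrow> m \<oplus> \<pi> g \<otimes> b \<in> gspan G B"

context
  fixes G :: "Lt_xyz set" and B :: "'c set"
  assumes B: "B \<subseteq> carrier T" and G0: "0 \<in> G" and G_add: "\<And>p q. p \<in> G \<Longrightarrow> q \<in> G \<Longrightarrow> p + q \<in> G"
    and G_mult: "\<And>p q. p \<in> G \<Longrightarrow> q \<in> G \<Longrightarrow> p * q \<in> G"
begin

lemma B_closed: "b \<in> B \<Longrightarrow> b \<in> carrier T" using B by blast

lemma gspan_closed: "m \<in> gspan G B \<Longrightarrow> m \<in> carrier T"
  by (induction rule: gspan.induct) (simp_all add: B_closed)

lemma gspan_add:
  assumes "m' \<in> gspan G B" "m \<in> gspan G B"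
  shows "m' \<oplus> m \<in> gspan G B"
  using assms(2)
proof (induction rule: gspan.induct)
  case zero
  show ?case using assms(1) gspan_closed[OF assms(1)] by simp
next
  case (step m g b)
  have "m' \<oplus> (m \<oplus> \<pi> g \<otimes> b) = m' \<oplus> m \<oplus> \<pi> g \<otimes> b"
    using gspan_closed[OF assms(1)] gspan_closed[OF step.hyps(1)] B_closed[OF step.hyps(3)] by (simp add: a_assoc)
  thus ?case using gspan.step[OF step.IH step.hyps(2,3)] by simp
qed

lemma gspan_smult:
  assumes "m \<in> gspan G B" "p \<in> G"
  shows "\<pi> p \<otimes> m \<in> gspan G B"
  using assms(1)
proof (induction rule: gspan.induct)
  case zero
  show ?case by (simp add: gspan.zero)
next
  case (step m g b)
  have "\<pi> p \<otimes> (m \<oplus> \<pi> g \<otimes> b) = \<pi> p \<otimes> m \<oplus> \<pi> (p * g) \<otimes> b"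
    using gspan_closed[OF step.hyps(1)] B_closed[OF step.hyps(3)] by (simp add: r_distr hom_mult m_assoc)
  thus ?case using gspan.step[OF step.IH G_mult[OF assms(2) step.hyps(2)] step.hyps(3)] by simp
qed

lemma gspan_mult:
  assumes a: "a \<in> carrier T" "\<And>b. b \<in> B \<Longrightarrow> a \<otimes> b \<in> gspan G B" and "m \<in> gspan G B"
  shows "a \<otimes> m \<in> gspan G B"
  using assms(3)
proof (induction rule: gspan.induct)
  case zero
  show ?case using a(1) by (simp add: gspan.zero)
next
  case (step m g b)
  have "a \<otimes> (m \<oplus> \<pi> g \<otimes> b) = a \<otimes> m \<oplus> \<pi> g \<otimes> (a \<otimes> b)"
    using a(1) gspan_closed[OF step.hyps(1)] B_closed[OF step.hyps(3)] by (simp add: r_distr m_lcomm)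
  thus ?case using gspan_add[OF step.IH gspan_smult[OF a(2)[OF step.hyps(3)] step.hyps(2)]] by simp
qed

lemma gspan_power:
  assumes a: "a \<in> carrier T" "\<And>b. b \<in> B \<Longrightarrow> a \<otimes> b \<in> gspan G B" and one: "\<one> \<in> gspan G B"
  shows "a [^] (n :: nat) \<in> gspan G B"
proof (induction n)
  case (Suc n)
  show ?case using gspan_mult[OF a Suc.IH] a(1) by (simp add: m_comm)
qed (simp add: one)

text \<open>If the functional takes values with numerators in \<open>G\<close> on \<open>B\<close>,
  it does so on the whole span, with the same \<open>d\<close>.\<close>

lemma gspan_functional:
  assumes N: "submodule N" and d: "\<And>b. b \<in> B \<Longrightarrow> \<exists>p\<in>G. \<pi> d \<otimes> b \<oplus> \<pi> p \<in> N" and "m \<in> gspan G B"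
  shows "\<exists>p\<in>G. \<pi> d \<otimes> m \<oplus> \<pi> p \<in> N"
  using assms(3)
proof (induction rule: gspan.induct)
  case zero
  show ?case using G0 submoduleD(2)[OF N] by (intro bexI[of _ 0]) (simp_all add: hom_zero)
next
  case (step m g b)
  obtain p where p: "p \<in> G" "\<pi> d \<otimes> m \<oplus> \<pi> p \<in> N" using step.IH by (elim bexE)
  obtain r where r: "r \<in> G" "\<pi> d \<otimes> b \<oplus> \<pi> r \<in> N" using d[OF step.hyps(3)] by (elim bexE)
  have "\<pi> d \<otimes> (m \<oplus> \<pi> g \<otimes> b) \<oplus> \<pi> (p + g * r)
    = (\<pi> d \<otimes> m \<oplus> \<pi> p) \<oplus> \<pi> g \<otimes> (\<pi> d \<otimes> b \<oplus> \<pi> r)"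
    using gspan_closed[OF step.hyps(1)] B_closed[OF step.hyps(3)]
    by (simp add: r_distr hom_add hom_mult m_lcomm a_ac)
  hence "\<pi> d \<otimes> (m \<oplus> \<pi> g \<otimes> b) \<oplus> \<pi> (p + g * r) \<in> N"
    using submoduleD(3)[OF N p(2) submoduleD(4)[OF N r(2), of g]] by simp
  thus ?case using G_add[OF p(1) G_mult[OF step.hyps(2) r(1)]] by (intro bexI)
qed

lemma gspan_finsum:
  assumes "finite B'" "B' \<subseteq> B" "\<And>b. b \<in> B' \<Longrightarrow> c b \<in> G"
  shows "(\<Oplus>b\<in>B'. \<pi> (c b) \<otimes> b) \<in> gspan G B"
  using assms
proof (induction rule: finite_induct)
  case empty
  show ?case by (simp add: gspan.zero)
next
  case (insert b B')
  have BT: "b' \<in> carrier T" if "b' \<in> insert b B'" for b' using that insert.prems(1) B by blast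
  have "(\<Oplus>b\<in>insert b B'. \<pi> (c b) \<otimes> b) = \<pi> (c b) \<otimes> b \<oplus> (\<Oplus>b\<in>B'. \<pi> (c b) \<otimes> b)"
    using insert.hyps BT by (intro finsum_insert) auto
  also have "\<dots> = (\<Oplus>b\<in>B'. \<pi> (c b) \<otimes> b) \<oplus> \<pi> (c b) \<otimes> b"
    using BT by (intro a_comm finsum_closed) auto
  finally show ?case
    using gspan.step[OF insert.IH, of "c b" b] insert.prems by simp
qed

end

text \<open>Multiplication by each \<open>a_i\<close> preserves the span of \<open>B\<close> over
  one \<open>loc D\<close>, so all powers \<open>a_i^q\<close> lie in that span. Applying the
  functional to \<open>f^q = \<Sum> a_i^q x_i^q\<close> gives coefficients in \<open>loc D\<close>,
  with \<open>D\<close> and \<open>d\<close> independent of \<open>n\<close>.\<close>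

lemma uniform_denominators:
  assumes fin: "finite B" and B: "B \<subseteq> carrier T"
    and span: "\<And>s. s \<in> carrier T \<Longrightarrow> \<exists>c. s = (\<Oplus>b\<in>B. \<pi> (c b) \<otimes> b)"
    and a [simp]: "a1 \<in> carrier T" "a2 \<in> carrier T" "a3 \<in> carrier T"
    and f: "\<pi> f = a1 \<otimes> \<pi> x1 \<oplus> a2 \<otimes> \<pi> x2 \<oplus> a3 \<otimes> \<pi> x3"
  shows "\<exists>D d. D \<noteq> 0 \<and> \<not> F_t dvd d \<and> (\<forall>n. \<exists>p1\<in>loc D. \<exists>p2\<in>loc D. \<exists>p3\<in>loc D.
    F_t dvd d * f ^ 2 ^ n + (p1 * x1 ^ 2 ^ n + p2 * x2 ^ 2 ^ n + p3 * x3 ^ 2 ^ n))"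
proof -
  obtain N d where N: "submodule N" "\<And>p. \<pi> p \<in> N \<Longrightarrow> F_t dvd p" "\<not> F_t dvd d"
    "\<And>b. b \<in> B \<Longrightarrow> \<exists>p. \<pi> d \<otimes> b \<oplus> \<pi> p \<in> N"
    using complementary_submodule[OF fin B] by auto
  have "\<forall>b\<in>B. \<exists>p. \<pi> d \<otimes> b \<oplus> \<pi> p \<in> N" using N(4) by (rule ballI)
  from bchoice[OF this] obtain r where r: "\<And>b. b \<in> B \<Longrightarrow> \<pi> d \<otimes> b \<oplus> \<pi> (r b) \<in> N" by auto
  have "\<forall>s\<in>carrier T. \<exists>c. s = (\<Oplus>b\<in>B. \<pi> (c b) \<otimes> b)" using span by (rule ballI)
  from bchoice[OF this] obtain c where c: "\<forall>s\<in>carrier T. s = (\<Oplus>b\<in>B. \<pi> (c s b) \<otimes> b)" ..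
  \<comment> \<open>\<open>\<one>\<close> starts the powers, and the products with \<open>B\<close>
    close the span under multiplication by \<open>a1\<close>, \<open>a2\<close>,
    \<open>a3\<close>.\<close>
  define S where "S = insert \<one> ((\<otimes>) a1 ` B \<union> (\<otimes>) a2 ` B \<union> (\<otimes>) a3 ` B)"
  have ST: "s \<in> carrier T" if "s \<in> S" for s using that B by (auto simp: S_def)
  have "finite (r ` B \<union> (\<Union>s\<in>S. c s ` B))" using fin by (simp add: S_def)
  from finite_subset_loc[OF this] obtain D where
    D: "D \<noteq> 0" "r ` B \<union> (\<Union>s\<in>S. c s ` B) \<subseteq> loc D" by (elim exE conjE)
  have S: "s \<in> gspan (loc D) B" if s: "s \<in> S" for s
  proof -
    have "(\<Oplus>b\<in>B. \<pi> (c s b) \<otimes> b) \<in> gspan (loc D) B"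
    proof (rule gspan_finsum[OF B loc_0])
      show "c s b \<in> loc D" if "b \<in> B" for b using D(2) s that by blast
    qed (erule (1) loc_add loc_mult | rule fin subset_refl)+
    thus ?thesis using c ST[OF s] by simp
  qed
  have pow: "\<exists>p\<in>loc D. \<pi> d \<otimes> a [^] n \<oplus> \<pi> p \<in> N"
    if aT: "a \<in> carrier T" and aS: "\<And>b. b \<in> B \<Longrightarrow> a \<otimes> b \<in> S" for a and n :: nat
  proof -
    have "\<one> \<in> gspan (loc D) B" by (rule S) (simp add: S_def)
    hence "a [^] n \<in> gspan (loc D) B"
    proof (rule gspan_power[OF B loc_0 _ _ aT, rotated 3])
      show "a \<otimes> b \<in> gspan (loc D) B" if "b \<in> B" for b by (rule S[OF aS[OF that]])
    qed (erule (1) loc_add loc_mult)+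
    thus ?thesis
    proof (rule gspan_functional[OF B loc_0 _ _ N(1), rotated 3])
      show "\<exists>p\<in>loc D. \<pi> d \<otimes> b \<oplus> \<pi> p \<in> N" if b: "b \<in> B" for b
      proof (rule bexI)
        show "\<pi> d \<otimes> b \<oplus> \<pi> (r b) \<in> N" by (rule r[OF b])
        show "r b \<in> loc D" using D(2) b by blast
      qed
    qed (erule (1) loc_add loc_mult)+
  qed
  have "\<exists>p1\<in>loc D. \<exists>p2\<in>loc D. \<exists>p3\<in>loc D.
    F_t dvd d * f ^ 2 ^ n + (p1 * x1 ^ 2 ^ n + p2 * x2 ^ 2 ^ n + p3 * x3 ^ 2 ^ n)" for n
  proof -
    define q :: nat where "q = 2 ^ n"
    obtain p1 where p1: "p1 \<in> loc D" "\<pi> d \<otimes> a1 [^] q \<oplus> \<pi> p1 \<in> N"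
      using pow[of a1 q] a(1) unfolding S_def by blast
    obtain p2 where p2: "p2 \<in> loc D" "\<pi> d \<otimes> a2 [^] q \<oplus> \<pi> p2 \<in> N"
      using pow[of a2 q] a(2) unfolding S_def by blast
    obtain p3 where p3: "p3 \<in> loc D" "\<pi> d \<otimes> a3 [^] q \<oplus> \<pi> p3 \<in> N"
      using pow[of a3 q] a(3) unfolding S_def by blast
    have fq: "\<pi> (f ^ q) = a1 [^] q \<otimes> \<pi> (x1 ^ q) \<oplus> a2 [^] q \<otimes> \<pi> (x2 ^ q) \<oplus> a3 [^] q \<otimes> \<pi> (x3 ^ q)"
      unfolding hom_power f q_def by (simp add: frobenius_add nat_pow_distrib)
    have "\<pi> (d * f ^ q + (p1 * x1 ^ q + p2 * x2 ^ q + p3 * x3 ^ q))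
      = \<pi> (x1 ^ q) \<otimes> (\<pi> d \<otimes> a1 [^] q \<oplus> \<pi> p1) \<oplus> \<pi> (x2 ^ q) \<otimes> (\<pi> d \<otimes> a2 [^] q \<oplus> \<pi> p2)
        \<oplus> \<pi> (x3 ^ q) \<otimes> (\<pi> d \<otimes> a3 [^] q \<oplus> \<pi> p3)"
      unfolding hom_add hom_mult fq by (simp add: r_distr a_ac m_ac)
    also have "\<dots> \<in> N"
      by (intro submoduleD(3,4)[OF N(1)] p1(2) p2(2) p3(2))
    finally show ?thesis using N(2) p1(1) p2(1) p3(1) unfolding q_def by (intro bexI)
  qed
  thus ?thesis using D(1) N(3) by (intro exI conjI allI)
qed

end

subsection \<open>Specialisation of \<open>t\<close>\<close>

text \<open>A root \<open>\<alpha>\<close> of \<open>1 + X p\<close> satisfies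
  \<open>\<alpha> * p(\<alpha>) = -1\<close>.\<close>

lemma alg_closed_nonroot:
  fixes p :: "'a::alg_closed_field poly"
  assumes "p \<noteq> 0"
  shows "\<exists>\<alpha>. poly p \<alpha> \<noteq> 0"
proof -
  have "degree (pCons 1 p) > 0" using assms by simp
  then obtain \<alpha> where "poly (pCons 1 p) \<alpha> = 0" using alg_closed_imp_poly_has_root[of "pCons 1 p"] by auto
  hence "poly p \<alpha> \<noteq> 0" by auto
  thus ?thesis ..
qed

lemma finite_degree_less:
  assumes fin: "finite (UNIV :: 'a::zero set)"
  shows "finite {p :: 'a poly. degree p < n}"
proof (rule finite_subset)
  show "{p :: 'a poly. degree p < n} \<subseteq> Poly ` {xs. set xs \<subseteq> UNIV \<and> length xs \<le> n}"
  proof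
    fix p :: "'a poly" assume "p \<in> {p. degree p < n}"
    hence "length (coeffs p) \<le> n" by (cases "p = 0") (simp_all add: length_coeffs_degree)
    thus "p \<in> Poly ` {xs. set xs \<subseteq> UNIV \<and> length xs \<le> n}"
      by (intro image_eqI[of _ _ "coeffs p"]) simp_all
  qed
  show "finite (Poly ` {xs :: 'a list. set xs \<subseteq> UNIV \<and> length xs \<le> n})"
    by (intro finite_imageI finite_lists_length_le fin)
qed

text \<open>The sequence \<open>lam \<alpha>\<close> stays in the finite set \<open>\<F>\<^sub>2[\<alpha>]\<close> and
  is an orbit of the injective map \<open>y \<mapsto> \<alpha> + y\<^sup>2\<close>, so it returns to \<open>0\<close>.\<close>

lemma lam_vanishes:
  fixes \<alpha> :: L
  shows "\<exists>j\<ge>1. lam \<alpha> j = 0"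
proof -
  define h where "h p = poly (map_poly to_ac p) \<alpha>" for p :: "bit poly"
  interpret h: ring_map h
    unfolding h_def by (rule ring_map_comp[OF ring_map.ring_map_map_poly[OF ring_map_to_ac] ring_map_poly])
  obtain p :: "bit poly" where p: "p \<noteq> 0" "poly (map_poly to_ac p) \<alpha> = 0"
    by (rule alg_closure_algebraic)
  have "b \<in> {0, 1}" for b :: bit by (cases "b = 1") simp_all
  hence "(UNIV :: bit set) \<subseteq> {0, 1}" by (rule subsetI)
  hence bit: "finite (UNIV :: bit set)" by (rule finite_subset) simp
  have hX: "h [:0, 1:] = \<alpha>" by (simp add: h_def map_poly_pCons)
  have "lam \<alpha> n \<in> insert 0 (h ` {r. degree r < degree p})" for n
  proof -
    define r where "r = lam [:0, 1:] n mod p"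
    define x where "x = lam [:0, 1:] n div p"
    have e: "p * x + r = lam [:0, 1:] n" by (simp add: r_def x_def)
    have "h (p * x + r) = lam \<alpha> n" unfolding e by (simp add: lam_ring_map[OF h.ring_map_axioms] hX)
    moreover have "h p = 0" using p(2) by (simp add: h_def)
    ultimately have "lam \<alpha> n = h r" by (simp only: h.add h.mult mult_zero_left add_0_left)
    moreover have "r = 0 \<or> degree r < degree p" unfolding r_def using degree_mod_less[OF p(1), of "lam [:0, 1:] n"] .
    ultimately show ?thesis using h.zero by auto
  qed
  hence "range (lam \<alpha>) \<subseteq> insert 0 (h ` {r. degree r < degree p})" by blast
  hence "finite (range (lam \<alpha>))" by (rule finite_subset) (intro finite.insertI finite_imageI finite_degree_less bit)
  hence "\<not> inj (lam \<alpha>)" using finite_imageD[of "lam \<alpha>" UNIV] by auto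
  then obtain i' j' where ij': "lam \<alpha> i' = lam \<alpha> j'" "i' \<noteq> j'" by (auto simp: inj_def)
  obtain i j where ij: "i < j" "lam \<alpha> i = lam \<alpha> j"
    by (cases "i' < j'") (use ij' that[of i' j'] that[of j' i'] in simp_all)
  have cancel: "lam \<alpha> (i + k) = lam \<alpha> i \<Longrightarrow> lam \<alpha> k = 0" for k
  proof (induction i)
    case (Suc i)
    define u v where "u = lam \<alpha> (i + k)" and "v = lam \<alpha> i"
    have two: "a + a = 0" for a :: L by (rule char2_add_self) (simp add: CHAR_bit)
    have "u\<^sup>2 = v\<^sup>2" using Suc.prems by (simp add: u_def v_def)
    moreover have "(u + v)\<^sup>2 = u\<^sup>2 + v\<^sup>2 + (u * v + u * v)" by (simp add: power2_eq_square algebra_simps)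
    ultimately have "(u + v)\<^sup>2 = 0" by (simp only: two add_0_left)
    hence "u + v = 0" by (simp only: power2_eq_square mult_eq_0_iff disj_absorb)
    hence "u + v = v + v" by (simp only: two)
    hence "u = v" by (rule add_right_imp_eq)
    thus ?case using Suc.IH by (simp add: u_def v_def)
  qed simp
  have "i + (j - i) = j" using ij(1) by simp
  hence "lam \<alpha> (j - i) = 0" using ij(2) by (intro cancel) (simp only:)
  moreover have "1 \<le> j - i" using ij(1) by simp
  ultimately show ?thesis by (intro exI conjI)
qed

lemma eval1_px: "eval1 px p = [:[:p:]:]"
proof -
  interpret c: ring_map "cst :: 'a \<Rightarrow> _" by (rule ring_map_cst)
  show ?thesis
    by (induction p) (simp_all add: eval1_def c.map_poly_pCons px_def cst_def)
qed

lemma eval2_px_py: "eval2 px py p = [:p:]"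
proof -
  interpret e: ring_map "eval1 (px :: 'a poly poly poly)" by (rule ring_map_eval1)
  show ?thesis
  proof (induction p)
    case (pCons a p)
    have "eval2 px py (pCons a p) = eval1 px a + py * eval2 px py p"
      by (simp add: eval2_def e.map_poly_pCons)
    thus ?case unfolding pCons.IH eval1_px by (simp add: py_def)
  qed (simp add: eval2_def)
qed

text \<open>\<open>x\<close>, \<open>y\<close>, \<open>d\<close> are algebraically dependent modulo
  \<open>F_t\<close>, and the lowest nonzero coefficient in \<open>d\<close> of such a relation is a
  multiple of \<open>d\<close> lying in \<open>L(t)[x, y]\<close>. A multiplier without
  \<open>z\<close> preserves normal forms.\<close>

lemma multiple_without_z:
  assumes d: "\<not> F_t dvd d"
  shows "\<exists>cp v. cp \<noteq> 0 \<and> F_t dvd [:cp:] + d * v"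
proof -
  obtain G where G: "G \<noteq> 0" "F_t dvd eval3 px py d G"
    using algebraic_dependence[of tau px py d] unfolding F_t_eq by (elim exE conjE)
  have "\<exists>a. a \<noteq> 0 \<and> eval2 px py a \<in> {a. \<exists>v. F_t dvd a + d * v}"
  proof (rule lowest_coefficient[OF ring_map_eval2 _ G(1), where P = "{a. F_t dvd a}" and u = d])
    show "poly (map_poly (eval2 px py) G) d \<in> {a. F_t dvd a}" using G(2) by (simp add: eval3_def)
    show "a \<in> {a. F_t dvd a} \<or> b \<in> {a. F_t dvd a}" if "a * b \<in> {a. F_t dvd a}" for a b
      using F_t_prime[of a b] that by simp
  qed (use d in auto)
  thus ?thesis unfolding eval2_px_py by blast
qed

text \<open>Multiplying by \<open>v\<close> replaces \<open>d\<close> by \<open>cp\<close>, and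
  clearing denominators gives a fixed \<open>s\<close> over \<open>L[t]\<close>. Only the exponent
  \<open>k\<close> of \<open>D\<close> depends on \<open>n\<close>.\<close>

lemma integral_relation:
  assumes D: "D \<noteq> 0" and d: "\<not> F_t dvd d"
    and rel: "\<And>n. \<exists>p1\<in>loc D. \<exists>p2\<in>loc D. \<exists>p3\<in>loc D.
      F_t dvd d * f ^ 2 ^ n + (p1 * px ^ (4 * 2 ^ n) + p2 * py ^ (4 * 2 ^ n) + p3 * pz ^ (4 * 2 ^ n))"
    and f: "f = map3 to_fract f'"
  shows "\<exists>D s. D \<noteq> 0 \<and> s \<noteq> 0 \<and>
    (\<forall>n. \<exists>k. cst D ^ k * ([:s:] * f' ^ 2 ^ n) \<in> frobenius_ideal [:0, 1:] (4 * 2 ^ n))"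
proof -
  obtain cp v where cp: "cp \<noteq> 0" "F_t dvd [:cp:] + d * v"
    using multiple_without_z[OF d] by (elim exE conjE)
  obtain E s where E: "E \<noteq> 0" "map_poly (map_poly to_fract) [:[:E:]:] * cp = map_poly (map_poly to_fract) s"
    using fract_poly_denominator[of cp] by (elim exE conjE)
  obtain D' where D': "D' \<noteq> 0" "{v} \<subseteq> loc D'" using finite_subset_loc[of "{v}"] by auto
  have inj2: "inj (map_poly (map_poly (to_fract :: L poly \<Rightarrow> Lt)))"
    by (intro inj_map_poly) (simp_all add: inj_def)
  have "map_poly (map_poly to_fract) [:[:E:]:] \<noteq> (0 :: Lt poly poly)"
    using E(1) by (simp add: map_poly_pCons)
  hence "map_poly (map_poly to_fract) s \<noteq> (0 :: Lt poly poly)" using cp(1) E(2) by (metis mult_eq_0_iff)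
  hence s: "s \<noteq> 0" by auto
  have Es: "map3 to_fract (cst E) * [:cp:] = map3 to_fract [:s:]"
    using E(2) by (simp add: map3_def cst_def map_poly_pCons)
  have "\<exists>k. cst (D * D') ^ k * ([:s:] * f' ^ 2 ^ n) \<in> frobenius_ideal [:0, 1:] (4 * 2 ^ n)" for n
  proof -
    define q :: nat where "q = 2 ^ n"
    define e where "e = (map3 to_fract (cst E) :: Lt_xyz)"
    obtain p1 p2 p3 where p: "p1 \<in> loc D" "p2 \<in> loc D" "p3 \<in> loc D"
      "F_t dvd d * f ^ q + (p1 * px ^ (4 * q) + p2 * py ^ (4 * q) + p3 * pz ^ (4 * q))"
      using rel[of n] unfolding q_def by (elim bexE)
    have loc': "e * v * p \<in> loc (D * D')" if "p \<in> loc D" for p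
    proof -
      have "v \<in> loc (D * D')" using D'(2) loc_mono[of v D' D] by (simp add: mult.commute)
      thus ?thesis unfolding e_def by (intro loc_mult loc_integral loc_mono[OF that])
    qed
    obtain k1 P1 where P1: "map3 to_fract (cst (D * D') ^ k1) * (e * v * p1) = map3 to_fract P1"
      by (rule locE[OF loc'[OF p(1)]])
    obtain k2 P2 where P2: "map3 to_fract (cst (D * D') ^ k2) * (e * v * p2) = map3 to_fract P2"
      by (rule locE[OF loc'[OF p(2)]])
    obtain k3 P3 where P3: "map3 to_fract (cst (D * D') ^ k3) * (e * v * p3) = map3 to_fract P3"
      by (rule locE[OF loc'[OF p(3)]])
    define c where "c k = cst (D * D') ^ k" for k
    define m where "m = (map3 to_fract :: L poly poly poly poly \<Rightarrow> Lt_xyz)"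
    interpret m: ring_map m unfolding m_def by (rule ring_map_map3[OF ring_map_to_fract])
    note mP = P1[folded m_def c_def] P2[folded m_def c_def] P3[folded m_def c_def]
    have mx: "m px = px" "m py = py" "m pz = pz"
      unfolding m_def by (simp_all add: map3_gens[OF ring_map_to_fract])
    define S where "S = p1 * px ^ (4 * q) + p2 * py ^ (4 * q) + p3 * pz ^ (4 * q)"
    define Q where "Q = c (k2 + k3) * P1 * px ^ (4 * q) + c (k1 + k3) * P2 * py ^ (4 * q)
      + c (k1 + k2) * P3 * pz ^ (4 * q)"
    define K where "K = k1 + k2 + k3"
    have "m Q = m (c (k2 + k3)) * (m (c k1) * (e * v * p1)) * px ^ (4 * q)
       + m (c (k1 + k3)) * (m (c k2) * (e * v * p2)) * py ^ (4 * q)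
       + m (c (k1 + k2)) * (m (c k3) * (e * v * p3)) * pz ^ (4 * q)"
      unfolding Q_def mP by (simp only: m.add m.mult m.power mx)
    also have "\<dots> = m (c K) * (e * v * S)"
      unfolding c_def K_def S_def power_add m.mult by (simp only: algebra_simps)
    finally have mQ: "m Q = m (c K) * (e * v * S)" .
    define Y where "Y = c K * ([:s:] * f' ^ q) - Q"
    have es: "e * [:cp:] = m [:s:]" using Es by (simp only: e_def m_def)
    have mf: "m f' = f" by (simp only: m_def f)
    have "m Y = m (c K) * e * ([:cp:] * f ^ q - v * S)"
      unfolding Y_def m.diff m.mult m.power mf mQ es[symmetric] by (simp only: algebra_simps)
    also have "\<dots> = m (c K) * e * (([:cp:] + d * v) * f ^ q - v * (d * f ^ q + S))"
      by (simp only: algebra_simps)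
    finally have "F_t dvd m Y" using cp(2) p(4) unfolding S_def[symmetric] by simp
    \<comment> \<open>The quartic is monic in \<open>z\<close>, so the division takes place over
      \<open>L[t]\<close>; a nonzero remainder would survive over \<open>L(t)\<close> and contradict
      divisibility there.\<close>
    obtain g r where gr: "Y = quartic [:0, 1:] * g + r" "r = 0 \<or> degree r < degree (quartic [:0, 1 :: L:])"
      by (rule monic_division[OF lead_coeff_quartic])
    have mF: "m (quartic [:0, 1:]) = F_t"
      unfolding m_def map3_quartic[OF ring_map_to_fract] F_t_eq tau_def ..
    have "r = 0"
    proof (rule ccontr)
      assume "r \<noteq> 0"
      hence "degree r < 4" using gr(2) by (simp add: degree_quartic)
      hence "degree (m r) < 4"
        using map_poly_degree_leq[of "map_poly (map_poly to_fract)" r] unfolding m_def map3_def by linarith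
      moreover have "inj m" unfolding m_def by (intro inj_map3) (simp_all add: inj_def)
      hence "m r \<noteq> 0" using \<open>r \<noteq> 0\<close> m.zero by (metis injD)
      moreover have "m Y = F_t * m g + m r" unfolding gr(1) m.add m.mult mF ..
      hence "F_t dvd m r" using \<open>F_t dvd m Y\<close> by (simp add: dvd_add_right_iff)
      ultimately show False using F_t_not_dvd_small by blast
    qed
    hence "c K * ([:s:] * f' ^ q) = Q + quartic [:0, 1:] * g"
      using gr(1) unfolding Y_def by (simp add: algebra_simps)
    also have "\<dots> = (c (k2 + k3) * P1) * px ^ (4 * q) + (c (k1 + k3) * P2) * py ^ (4 * q)
      + (c (k1 + k2) * P3) * pz ^ (4 * q) + g * quartic [:0, 1:]"
      unfolding Q_def by (simp only: mult.commute[of g])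
    finally show ?thesis
      unfolding c_def q_def by (intro exI[of _ K] frobenius_idealI)
  qed
  thus ?thesis using D D'(1) s by (intro exI[of _ "D * D'"] exI[of _ s]) simp
qed

lemma frobenius_ideal_map:
  assumes h: "ring_map h" and p: "p \<in> frobenius_ideal t n"
  shows "map3 h p \<in> frobenius_ideal (h t) n"
proof -
  interpret m: ring_map "map3 h" by (rule ring_map_map3[OF h])
  obtain a b c d where p: "p = a * px ^ n + b * py ^ n + c * pz ^ n + d * quartic t"
    using p unfolding frobenius_ideal_def by blast
  show ?thesis
    unfolding p m.add m.mult m.power map3_gens(1-3)[OF h] map3_quartic[OF h]
    by (rule frobenius_idealI) (rule refl)
qed

lemma no_integral_relation:
  fixes D :: "L poly" and s :: "L poly poly poly"
  assumes D: "D \<noteq> 0" and s: "s \<noteq> 0"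
    and rel: "\<And>n. \<exists>k. cst D ^ k * ([:s:] * (py ^ 3 * pz ^ 3) ^ 2 ^ n) \<in> frobenius_ideal [:0, 1:] (4 * 2 ^ n)"
  shows False
proof -
  have CHAR_L': "CHAR(L) = 2" by (rule CHAR_L)
  obtain n i j where ij: "i < 2 * 2 ^ n" "j < 2 * 2 ^ n"
    and nz: "coeff (coeff (s * fst (wz [:0, 1:] n)) j) i \<noteq> 0"
    using wz_multiple_nonzero[OF CHAR_L' s] by (elim exE conjE)
  define C where "C = coeff (coeff (s * fst (wz [:0, 1:] n)) j) i"
  \<comment> \<open>Besides the zeros of \<open>D\<close> and \<open>C\<close>, the values 0 and 1
    are avoided: there \<open>lam\<close> vanishes already at index 1 or 2, too early for the final
    double step.\<close>
  have "D * [:0, 1:] * [:1, 1:] * C \<noteq> 0" using D nz unfolding C_def by (intro no_zero_divisors) simp_all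
  then obtain \<alpha> where "poly (D * [:0, 1:] * [:1, 1:] * C) \<alpha> \<noteq> 0" using alg_closed_nonroot by blast
  hence "poly D \<alpha> \<noteq> 0 \<and> poly [:0, 1:] \<alpha> \<noteq> 0 \<and> poly [:1, 1:] \<alpha> \<noteq> 0 \<and> poly C \<alpha> \<noteq> 0"
    by (simp only: poly_mult mult_eq_0_iff de_Morgan_disj simp_thms)
  hence \<alpha>: "poly D \<alpha> \<noteq> 0" "\<alpha> \<noteq> 0" "1 + \<alpha> \<noteq> 0" "poly C \<alpha> \<noteq> 0" by simp_all
  define h where "h p = poly p \<alpha>" for p :: "L poly"
  have h: "ring_map h" unfolding h_def by (rule ring_map_poly)
  interpret h: ring_map h by (rule h)
  interpret h1: ring_map "map_poly h" by (rule h.ring_map_map_poly)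
  interpret h2: ring_map "map_poly (map_poly h)" by (rule h1.ring_map_map_poly)
  interpret m: ring_map "map3 h" by (rule ring_map_map3[OF h])
  interpret c: ring_map "cst :: L \<Rightarrow> _" by (rule ring_map_cst)
  have ht: "h [:0, 1:] = \<alpha>" by (simp add: h_def)
  define cp where "cp = map_poly (map_poly h) s"
  have H: "[:cp:] * (py ^ 3 * pz ^ 3) ^ 2 ^ n \<in> frobenius_ideal \<alpha> (4 * 2 ^ n)" for n
  proof -
    obtain k where k: "cst D ^ k * ([:s:] * (py ^ 3 * pz ^ 3) ^ 2 ^ n) \<in> frobenius_ideal [:0, 1:] (4 * 2 ^ n)"
      using rel[of n] by (elim exE)
    have ms: "map3 h [:s:] = [:cp:]" unfolding map3_def cp_def by (simp add: h2.map_poly_pCons)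
    have "map3 h (cst D ^ k * ([:s:] * (py ^ 3 * pz ^ 3) ^ 2 ^ n)) \<in> frobenius_ideal (h [:0, 1:]) (4 * 2 ^ n)"
      by (rule frobenius_ideal_map[OF h k])
    hence 1: "cst (h D ^ k) * ([:cp:] * (py ^ 3 * pz ^ 3) ^ 2 ^ n) \<in> frobenius_ideal \<alpha> (4 * 2 ^ n)"
      by (simp only: m.mult m.power map3_gens[OF h] ms ht c.power)
    have "h D ^ k \<noteq> 0" using \<alpha>(1) by (simp add: h_def)
    hence "1 / h D ^ k * h D ^ k = 1" by (simp only: times_divide_eq_left mult_1_left) (erule divide_self)
    hence "cst (1 / h D ^ k) * cst (h D ^ k) = 1" by (simp only: c.mult[symmetric] c.one)
    hence "cst (1 / h D ^ k) * (cst (h D ^ k) * ([:cp:] * (py ^ 3 * pz ^ 3) ^ 2 ^ n))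
      = [:cp:] * (py ^ 3 * pz ^ 3) ^ 2 ^ n" by (simp only: mult.assoc[symmetric] mult_1_left)
    thus ?thesis using frobenius_ideal_mult[OF 1, of "cst (1 / h D ^ k)"] by (simp only:)
  qed
  define l where "l = (LEAST j. 1 \<le> j \<and> lam \<alpha> j = 0)"
  have l: "1 \<le> l \<and> lam \<alpha> l = 0" unfolding l_def by (rule LeastI_ex) (rule lam_vanishes)
  have min: "lam \<alpha> j \<noteq> 0" if j: "1 \<le> j" "j < l" for j
    using not_less_Least[OF j(2)[unfolded l_def]] j(1) by simp
  have l1: "l \<noteq> 1"
  proof
    assume "l = 1"
    thus False using conjunct2[OF l] \<alpha>(2) by simp
  qed
  have "lam \<alpha> 2 = \<alpha> * (1 + \<alpha>)" by (simp add: numeral_2_eq_2 algebra_simps)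
  hence "lam \<alpha> 2 \<noteq> 0" using \<alpha>(2,3) by (simp only: mult_eq_0_iff disj_not1 simp_thms)
  hence "l \<noteq> 2" using conjunct2[OF l] by (intro notI) (simp only: not_True_eq_False)
  hence l3: "l \<ge> 3" using l1 conjunct1[OF l] by linarith
  obtain w0 w1 w2 w3 where w: "wz \<alpha> n = (w0, w1, w2, w3)" by (cases "wz \<alpha> n")
  have W: "quartic \<alpha> dvd (pz ^ 3 + px * py * pz) ^ 2 ^ n - [:w0, w1, w2, w3:]"
    using wz_correct[OF CHAR_L', of \<alpha> n] unfolding w by simp
  have "degree [:w0, w1, w2, w3:] < 4" by (simp add: degree_pCons_eq_if)
  hence "coeff (coeff (cp * coeff [:w0, w1, w2, w3:] 0) j) i = 0"
    by (intro coefficient_vanishes[OF CHAR_L' \<alpha>(2) H conjunct2[OF l] l3 min W _ ij])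
  moreover have "w0 = map_poly (map_poly h) (fst (wz [:0, 1:] n))"
    using wz_map[OF h, of "[:0, 1:]" n] unfolding ht w by (simp split: prod.splits)
  ultimately have "coeff (coeff (map_poly (map_poly h) (s * fst (wz [:0, 1:] n))) j) i = 0"
    by (simp add: cp_def h2.mult)
  hence "h C = 0" by (simp add: C_def coeff_map_poly h.zero)
  thus False using \<alpha>(4) by (simp add: h_def)
qed

subsection \<open>Membership in the plus closure\<close>

lemma f_t_notin_plus_closure: "f_t \<notin> plus_closure R_t I_t"
proof
  assume "f_t \<in> plus_closure R_t I_t"
  then obtain T :: "Lt_xyz set list set ring" and \<phi> where
    ext: "finite_domain_extension R_t T \<phi>" and mem: "\<phi> f_t \<in> Idl\<^bsub>T\<^esub> (\<phi> ` I_t)"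
    unfolding plus_closure_def by blast
  from ext have T: "domain T" and hom: "\<phi> \<in> ring_hom R_t T" and inj: "inj_on \<phi> (carrier R_t)"
    by (auto simp: finite_domain_extension_def)
  from ext obtain B where B: "finite B" "B \<subseteq> carrier T"
    and gen: "\<And>s. s \<in> carrier T \<Longrightarrow>
      \<exists>c \<in> B \<rightarrow> carrier R_t. s = (\<Oplus>\<^bsub>T\<^esub>b\<in>B. \<phi> (c b) \<otimes>\<^bsub>T\<^esub> b)"
    unfolding finite_domain_extension_def by blast
  interpret T: domain T by (rule T)
  interpret R: domain R_t by (rule domain_R_t)
  define \<pi> where "\<pi> p = \<phi> (residue_class p)" for p
  have \<phi>0: "\<phi> \<zero>\<^bsub>R_t\<^esub> = \<zero>\<^bsub>T\<^esub>" by (rule ring_hom_zero[OF hom R.ring_axioms T.ring_axioms])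
  interpret E: extension_domain T \<pi>
  proof
    show "\<pi> p \<in> carrier T" for p unfolding \<pi>_def by (rule ring_hom_closed[OF hom residue_class_carrier])
    show "\<pi> (p + q) = \<pi> p \<oplus>\<^bsub>T\<^esub> \<pi> q" for p q
      unfolding \<pi>_def residue_class_simps(1)[symmetric]
      by (rule ring_hom_add[OF hom residue_class_carrier residue_class_carrier])
    show "\<pi> (p * q) = \<pi> p \<otimes>\<^bsub>T\<^esub> \<pi> q" for p q
      unfolding \<pi>_def residue_class_simps(2)[symmetric]
      by (rule ring_hom_mult[OF hom residue_class_carrier residue_class_carrier])
    show "\<pi> 1 = \<one>\<^bsub>T\<^esub>" unfolding \<pi>_def residue_class_simps(3)[symmetric] by (rule ring_hom_one[OF hom])
    show "\<pi> p = \<zero>\<^bsub>T\<^esub> \<longleftrightarrow> F_t dvd p" for p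
    proof -
      have "\<pi> p = \<zero>\<^bsub>T\<^esub> \<longleftrightarrow> \<phi> (residue_class p) = \<phi> \<zero>\<^bsub>R_t\<^esub>" by (simp only: \<pi>_def \<phi>0)
      also have "\<dots> \<longleftrightarrow> residue_class p = \<zero>\<^bsub>R_t\<^esub>"
        by (rule inj_on_eq_iff[OF inj residue_class_carrier R.zero_closed])
      finally show ?thesis unfolding residue_class_eq_zero_iff .
    qed
  qed
  have span: "\<exists>c. s = (\<Oplus>\<^bsub>T\<^esub>b\<in>B. \<pi> (c b) \<otimes>\<^bsub>T\<^esub> b)" if s: "s \<in> carrier T" for s
  proof -
    obtain c where c: "c \<in> B \<rightarrow> carrier R_t" "s = (\<Oplus>\<^bsub>T\<^esub>b\<in>B. \<phi> (c b) \<otimes>\<^bsub>T\<^esub> b)"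
      using gen[OF s] by blast
    have "\<forall>b\<in>B. \<exists>p. c b = residue_class p" using c(1) by (auto simp: carrier_R_t)
    from bchoice[OF this] obtain c' where c': "\<forall>b\<in>B. c b = residue_class (c' b)" ..
    have "s = (\<Oplus>\<^bsub>T\<^esub>b\<in>B. \<pi> (c' b) \<otimes>\<^bsub>T\<^esub> b)"
      unfolding c(2) using c' B(2) by (intro T.finsum_cong') (auto simp: \<pi>_def[symmetric])
    thus ?thesis by (intro exI[of _ c'])
  qed
  \<comment> \<open>The extended ideal as a sum of principal ideals, from which the coefficients
    \<open>a1\<close>, \<open>a2\<close>, \<open>a3\<close> of a membership can be
    extracted.\<close>
  define J where "J = PIdl\<^bsub>T\<^esub> (\<pi> (px ^ 4)) <+>\<^bsub>T\<^esub> PIdl\<^bsub>T\<^esub> (\<pi> (py ^ 4)) <+>\<^bsub>T\<^esub> PIdl\<^bsub>T\<^esub> (\<pi> (pz ^ 4))"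
  have Jeq: "J = {a1 \<otimes>\<^bsub>T\<^esub> \<pi> (px ^ 4) \<oplus>\<^bsub>T\<^esub> a2 \<otimes>\<^bsub>T\<^esub> \<pi> (py ^ 4) \<oplus>\<^bsub>T\<^esub> a3 \<otimes>\<^bsub>T\<^esub> \<pi> (pz ^ 4) |
      a1 a2 a3. a1 \<in> carrier T \<and> a2 \<in> carrier T \<and> a3 \<in> carrier T}"
    unfolding J_def cgenideal_def set_add_def' by blast
  have JI: "a1 \<otimes>\<^bsub>T\<^esub> \<pi> (px ^ 4) \<oplus>\<^bsub>T\<^esub> a2 \<otimes>\<^bsub>T\<^esub> \<pi> (py ^ 4) \<oplus>\<^bsub>T\<^esub> a3 \<otimes>\<^bsub>T\<^esub> \<pi> (pz ^ 4) \<in> J"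
    if "a1 \<in> carrier T" "a2 \<in> carrier T" "a3 \<in> carrier T" for a1 a2 a3
    unfolding Jeq using that by blast
  have J: "ideal J T"
    unfolding J_def by (intro T.add_ideals T.cgenideal_ideal E.hom_closed)
  have gens: "\<pi> (px ^ 4) \<in> J" "\<pi> (py ^ 4) \<in> J" "\<pi> (pz ^ 4) \<in> J"
    using JI[of "\<one>\<^bsub>T\<^esub>" "\<zero>\<^bsub>T\<^esub>" "\<zero>\<^bsub>T\<^esub>"] JI[of "\<zero>\<^bsub>T\<^esub>" "\<one>\<^bsub>T\<^esub>" "\<zero>\<^bsub>T\<^esub>"]
      JI[of "\<zero>\<^bsub>T\<^esub>" "\<zero>\<^bsub>T\<^esub>" "\<one>\<^bsub>T\<^esub>"] by simp_all
  have "ideal {r \<in> carrier R_t. \<phi> r \<in> J} R_t"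
    by (rule ring_hom_ring.ideal_vimage[OF ring_hom_ringI2 J])
      (rule R.ring_axioms T.ring_axioms hom)+
  moreover have "{residue_class (x_gen ^ 4), residue_class (y_gen ^ 4), residue_class (z_gen ^ 4)}
      \<subseteq> {r \<in> carrier R_t. \<phi> r \<in> J}"
    using gens by (auto simp: gens_eq \<pi>_def residue_class_carrier)
  ultimately have "I_t \<subseteq> {r \<in> carrier R_t. \<phi> r \<in> J}" unfolding I_t_def by (rule R.genideal_minimal)
  hence "\<phi> ` I_t \<subseteq> J" by auto
  hence "Idl\<^bsub>T\<^esub> (\<phi> ` I_t) \<subseteq> J" by (rule T.genideal_minimal[OF J])
  hence "\<pi> (py ^ 3 * pz ^ 3) \<in> J" using mem by (auto simp: \<pi>_def f_t_def gens_eq)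
  then obtain a1 a2 a3 where a: "a1 \<in> carrier T" "a2 \<in> carrier T" "a3 \<in> carrier T"
    "\<pi> (py ^ 3 * pz ^ 3) = a1 \<otimes>\<^bsub>T\<^esub> \<pi> (px ^ 4) \<oplus>\<^bsub>T\<^esub> a2 \<otimes>\<^bsub>T\<^esub> \<pi> (py ^ 4) \<oplus>\<^bsub>T\<^esub> a3 \<otimes>\<^bsub>T\<^esub> \<pi> (pz ^ 4)"
    unfolding Jeq by blast
  have "\<exists>D d. D \<noteq> 0 \<and> \<not> F_t dvd d \<and> (\<forall>n. \<exists>p1\<in>loc D. \<exists>p2\<in>loc D. \<exists>p3\<in>loc D.
    F_t dvd d * (py ^ 3 * pz ^ 3) ^ 2 ^ n
      + (p1 * (px ^ 4) ^ 2 ^ n + p2 * (py ^ 4) ^ 2 ^ n + p3 * (pz ^ 4) ^ 2 ^ n))"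
    by (rule E.uniform_denominators[OF B span a])
  then obtain D d where Dd: "D \<noteq> 0" "\<not> F_t dvd d" "\<forall>n. \<exists>p1\<in>loc D. \<exists>p2\<in>loc D. \<exists>p3\<in>loc D.
    F_t dvd d * (py ^ 3 * pz ^ 3) ^ 2 ^ n
      + (p1 * (px ^ 4) ^ 2 ^ n + p2 * (py ^ 4) ^ 2 ^ n + p3 * (pz ^ 4) ^ 2 ^ n)"
    by (elim exE conjE)
  have rel: "\<exists>p1\<in>loc D. \<exists>p2\<in>loc D. \<exists>p3\<in>loc D. F_t dvd d * (py ^ 3 * pz ^ 3) ^ 2 ^ n
      + (p1 * px ^ (4 * 2 ^ n) + p2 * py ^ (4 * 2 ^ n) + p3 * pz ^ (4 * 2 ^ n))" for n
    unfolding power_mult by (rule spec[OF Dd(3)])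
  have "py ^ 3 * pz ^ 3 = (map3 to_fract (py ^ 3 * pz ^ 3 :: L poly poly poly poly) :: Lt_xyz)"
    by (simp only: fr.mult fr.power map3_gens[OF ring_map_to_fract])
  from integral_relation[OF Dd(1,2) rel this]
  obtain D s where Ds: "D \<noteq> 0" "s \<noteq> 0" "\<forall>n. \<exists>k. cst D ^ k * ([:s:] * (py ^ 3 * pz ^ 3) ^ 2 ^ n)
    \<in> frobenius_ideal [:0, 1 :: L:] (4 * 2 ^ n)"
    by (elim exE conjE)
  show False by (rule no_integral_relation[OF Ds(1,2)]) (rule spec[OF Ds(3)])
qed

theorem mainTheorem2:
  shows "noetherian_domain_of_char 2 R_t \<and>
         krull_dim R_t = 2 \<and>
         f_t \<in> tight_closure 2 R_t I_t \<and>
         f_t \<notin> plus_closure R_t I_t \<and>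
         (\<exists>p (R :: Lt_xyz set ring) I.
            noetherian_domain_of_char p R \<and> krull_dim R = 2 \<and> ideal I R \<and>
            tight_closure p R I \<noteq> plus_closure R I)"
proof (intro conjI)
  interpret R: domain R_t by (rule domain_R_t)
  show 1: "noetherian_domain_of_char 2 R_t"
    unfolding noetherian_domain_of_char_def using noetherian_domain_R_t contains_field_R_t by simp
  show 2: "krull_dim R_t = 2" by (rule krull_dim_R_t)
  show 3: "f_t \<in> tight_closure 2 R_t I_t" by (rule f_t_in_tight_closure)
  show 4: "f_t \<notin> plus_closure R_t I_t" by (rule f_t_notin_plus_closure)
  have "ideal I_t R_t"
    unfolding I_t_def by (rule R.genideal_ideal) (auto simp: residue_class_carrier)
  moreover have "tight_closure 2 R_t I_t \<noteq> plus_closure R_t I_t" using 3 4 by metis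
  ultimately show "\<exists>p (R :: Lt_xyz set ring) I.
      noetherian_domain_of_char p R \<and> krull_dim R = 2 \<and> ideal I R \<and>
      tight_closure p R I \<noteq> plus_closure R I"
    using 1 2 by (intro exI[of _ 2] exI[of _ R_t] exI[of _ I_t] conjI)
qed

end
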